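(* For any integer $n\geq 3$ the Dehn function $\delta_{\mathcal{H}_n}(x)$ of Houghton's group $\mathcal{H}_n$ satisfies $$\delta_{\mathcal{H}_n}(x)\preccurlyeq e^x .$$
   Context: $\mathbb{N}$ denotes the positive integers. For $n\ge 1$ let $Y_n=\{1,\dots,n\}\times\mathbb{N}$. A bijection $g:Y_n\to Y_n$ (written on the right) is an eventual translation if there are $(m_1,\dots,m_n)\in\mathbb{Z}^n$ and a finite set $K_g\subset Y_n$ such that $(k,p)\cdot g=(k,p+m_k)$ for all $(k,p)\in Y_n-K_g$. Houghton's group $\mathcal{H}_n$ is the group of all eventual translations of $Y_n$. For $n\ge 3$ it is finitely presented. Let $P=\langle \mathcal{A}\mid\mathcal{R}\rangle$ be a finite presentation of a group $G$. A word is an element of the free monoid on $\mathcal{A}\cup\mathcal{A}^{-1}$; $|w|$ denotes its length. A word $w$ is null-homotopic if $w=1$ in $G$, and then $$\mathrm{Area}(w)=\min\Big\{N \;\Big|\; w=\prod_{i=1}^N u_i^{-1}r_iu_i \text{ in the free group } F(\mathcal{A}),\ u_i\in F(\mathcal{A}),\ r_i\in\mathcal{R}^{\pm1}\Big\}.$$ The Dehn function of $P$ is $\delta_P(x)=\max\{\mathrm{Area}(w)\mid w=1 \text{ in } G,\ |w|\le x\}$. For functions $f,g:\mathbb{N}\to[0,\infty)$ (with $g$ extended to $[0,\infty)$ if needed), $f\preccurlyeq g$ means there is a constant $C>0$ with $f(x)\le C\,g(Cx+C)+Cx+C$ for all $x\in\mathbb{N}$; $f\simeq g$ means $f\preccurlyeq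 g$ and $g\preccurlyeq f$. Up to $\simeq$, $\delta_P$ does not depend on the finite presentation $P$ of $G$, and $\delta_G$ denotes this class (or any representative $\delta_P$). *)

theory Defs
  imports Complex_Main "HOL-Algebra.Algebra"
begin

section \<open>Houghton's groups\<close>

text \<open>The positive integers are the elements of \<^term>\<open>{1..} :: nat set\<close>.\<close>

definition rays :: "nat \<Rightarrow> (nat \<times> nat) set" where
  "rays n = {1..n} \<times> {1..}"

definition eventual_translation :: "nat \<Rightarrow> (nat \<times> nat \<Rightarrow> nat \<times> nat) \<Rightarrow> bool" where
  "eventual_translation n g \<longleftrightarrow>
     bij_betw g (rays n) (rays n) \<and>
     (\<exists>(m :: nat \<Rightarrow> int) K. finite K \<and> K \<subseteq> rays n \<and>
        (\<forall>(k, p) \<in> rays n - K.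
           fst (g (k, p)) = k \<and> int (snd (g (k, p))) = int p + m k))"

text \<open>
  As in \<^const>\<open>BijGroup\<close>, permutations of \<^term>\<open>rays n\<close> are made extensional so that equality
  in the carrier is equality on \<^term>\<open>rays n\<close>.  Maps act on the right, so in the product
  of \<open>f\<close> and \<open>g\<close> the map \<open>f\<close> is applied first.
\<close>

definition houghton :: "nat \<Rightarrow> (nat \<times> nat \<Rightarrow> nat \<times> nat) monoid" where
  "houghton n =
     \<lparr>carrier = {g \<in> extensional (rays n). eventual_translation n g},
      monoid.mult = (\<lambda>f g. compose (rays n) g f),
      one = (\<lambda>y \<in> rays n. y)\<rparr>"

section \<open>Free groups and presentations\<close>

text \<open>The letter \<open>(a, True)\<close> is the generator \<open>a\<close>, and \<open>(a, False)\<close> is its formal inverse.\<close>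

type_synonym 'a word = "('a \<times> bool) list"

definition words :: "'a set \<Rightarrow> 'a word set" where
  "words A = lists (A \<times> UNIV)"

inductive_set free_rel :: "'a set \<Rightarrow> ('a word \<times> 'a word) set" for A :: "'a set" where
  cancel: "u \<in> words A \<Longrightarrow> v \<in> words A \<Longrightarrow> a \<in> A \<Longrightarrow>
             (u @ [(a, b), (a, \<not> b)] @ v, u @ v) \<in> free_rel A"
| refl: "w \<in> words A \<Longrightarrow> (w, w) \<in> free_rel A"
| sym: "(u, v) \<in> free_rel A \<Longrightarrow> (v, u) \<in> free_rel A"
| trans: "(u, v) \<in> free_rel A \<Longrightarrow> (v, w) \<in> free_rel A \<Longrightarrow> (u, w) \<in> free_rel A"

definition word_class :: "'a set \<Rightarrow> 'a word \<Rightarrow> 'a word set" where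
  "word_class A w = free_rel A `` {w}"

definition free_group :: "'a set \<Rightarrow> 'a word set monoid" where
  "free_group A =
     \<lparr>carrier = words A // free_rel A,
      monoid.mult = (\<lambda>U V. free_rel A `` {u @ v | u v. u \<in> U \<and> v \<in> V}),
      one = word_class A []\<rparr>"

text \<open>
  A relator is given as a word and stands for the element of the free group which that word
  represents.
\<close>

definition relator_conjugates :: "'a set \<Rightarrow> 'a word set \<Rightarrow> 'a word set set" where
  "relator_conjugates A R =
     {inv\<^bsub>free_group A\<^esub> u \<otimes>\<^bsub>free_group A\<^esub> r \<otimes>\<^bsub>free_group A\<^esub> u | u r.
        u \<in> carrier (free_group A) \<and>
        r \<in> word_class A ` R \<union> (\<lambda>s. inv\<^bsub>free_group A\<^esub> (word_class A s)) ` R}"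

definition relator_closure :: "'a set \<Rightarrow> 'a word set \<Rightarrow> 'a word set set" where
  "relator_closure A R = generate (free_group A) (relator_conjugates A R)"

definition presented_group :: "'a set \<Rightarrow> 'a word set \<Rightarrow> 'a word set set monoid" where
  "presented_group A R = free_group A Mod relator_closure A R"

definition finite_presentation ::
    "'a set \<Rightarrow> 'a word set \<Rightarrow> ('g, 'm) monoid_scheme \<Rightarrow> bool" where
  "finite_presentation A R G \<longleftrightarrow>
     finite A \<and> finite R \<and> R \<subseteq> words A \<and> presented_group A R \<cong> G"

text \<open>
  A finite generating set can always be renamed to a set of natural numbers, so fixing the
  type of the generators here loses no generality.
\<close>

definition finitely_presented :: "('g, 'm) monoid_scheme \<Rightarrow> bool" where
  "finitely_presented G \<longleftrightarrow> (\<exists>(A :: nat set) R. finite_presentation A R G)"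

section \<open>Dehn functions\<close>

definition null_homotopic :: "'a set \<Rightarrow> 'a word set \<Rightarrow> 'a word \<Rightarrow> bool" where
  "null_homotopic A R w \<longleftrightarrow>
     w \<in> words A \<and>
     relator_closure A R #>\<^bsub>free_group A\<^esub> word_class A w = \<one>\<^bsub>presented_group A R\<^esub>"

text \<open>The minimum is over a nonempty set exactly when \<open>w\<close> is null-homotopic.\<close>

definition area :: "'a set \<Rightarrow> 'a word set \<Rightarrow> 'a word \<Rightarrow> nat" where
  "area A R w =
     (LEAST N. \<exists>cs. length cs = N \<and> set cs \<subseteq> relator_conjugates A R \<and>
        word_class A w = foldr (\<otimes>\<^bsub>free_group A\<^esub>) cs \<one>\<^bsub>free_group A\<^esub>)"

text \<open>
  For finite \<open>A\<close> the maximum is over a finite set, which contains the area of the empty word.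
\<close>

definition dehn :: "'a set \<Rightarrow> 'a word set \<Rightarrow> nat \<Rightarrow> nat" where
  "dehn A R x = Max (area A R ` {w. null_homotopic A R w \<and> length w \<le> x})"

definition dominated :: "(nat \<Rightarrow> real) \<Rightarrow> (real \<Rightarrow> real) \<Rightarrow> bool" (infix "\<preceq>" 50) where
  "f \<preceq> g \<longleftrightarrow>
     (\<exists>C > 0. \<forall>x \<ge> 1. f x \<le> C * g (C * real x + C) + C * real x + C)"

end

theory Submission
  imports Defs "HOL-Combinatorics.Permutations"
begin

text \<open>
  Why the theorem holds.  It is enough to find one finite presentation of Houghton's group in which
  a word of length \<open>L\<close> that acts trivially is a product of at most exponentially many conjugates of
  relators: such a bound says both that the relators present the group (\<open>presented_groupI\<close>) and that
  the Dehn function is at most exponential, and it passes to every other finite presentation by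
  rewriting the generators of one presentation in those of the other (\<open>change_of_presentation\<close>).

  Regard the set \<open>Y\<^sub>n\<close> as a centre, an auxiliary point and \<open>n\<close> rays.  The generators are the
  transposition \<open>a\<close> of the centre and the auxiliary point, the transposition \<open>b\<close> of the auxiliary
  point and the first point of ray 1, and the translations \<open>t\<^sub>k\<close> which push ray 1 into ray \<open>k\<close>
  and fix the centre and the auxiliary point.  The relators are all short words acting trivially, so
  that every true relation of bounded length costs one relator.

  For each point \<open>y\<close> on a ray a word represents the star transposition of the centre and
  \<open>y\<close>: a bounded word conjugated along the ray of \<open>y\<close>.  The core of the proof is
  \<open>ray_star_slide_commute\<close>.  At depth \<open>p\<close> it bounds by \<open>11 ^ p\<close> the cost of two facts: every
  translation of another ray into the ray of \<open>y\<close> moves the star transposition one step outwards,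
  and the star transposition commutes with the transpositions of the auxiliary point and the first
  point of a ray.  Each of the two facts at depth \<open>p + 1\<close> follows from a bounded number of uses of
  both at depth \<open>p\<close>, which is where the exponential comes from.  The third ray is needed here:
  with it, a translation into a given ray can be chosen not to disturb a given other ray.

  Hence words in \<open>b\<close> and the \<open>t\<^sub>k\<close> permute the star transpositions as they permute the points,
  at exponential cost (\<open>moves_stars\<close>).  The conjugate by \<open>a\<close> of a star transposition is the
  transposition of the auxiliary point and \<open>y\<close>, which is again such a word, so it acts on the
  other star transpositions as it should.  These relations suffice to derive the conjugation relations between
  all transpositions (\<open>conj_by_tau_tau\<close>), and with these a trivial product of transpositions is
  rewritten to the empty product in polynomially many steps (\<open>transpositions_area\<close>).

  A word acting trivially is now treated as follows.  The star transpositions in it are pushed to the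
  right, which leaves a word in the \<open>t\<^sub>k\<close> followed by polynomially many star transpositions
  (\<open>split_word\<close>).  Far out on the rays only the first factor acts, so each \<open>t\<^sub>k\<close> occurs in it as
  often as its inverse; commuting letters past each other at the price of further star
  transpositions cancels all of them (\<open>balanced_word\<close>).  What remains is a trivial product of
  polynomially many transpositions of points of linear depth.
\<close>

section \<open>Free groups\<close>

lemma words_UNIV [simp]: "words UNIV = UNIV"
  by (auto simp: words_def)

lemma words_simps [simp]:
  "[] \<in> words A" "x # w \<in> words A \<longleftrightarrow> fst x \<in> A \<and> w \<in> words A"
  "u @ v \<in> words A \<longleftrightarrow> u \<in> words A \<and> v \<in> words A"
  by (auto simp: words_def mem_Times_iff)

definition inv_word :: "'a word \<Rightarrow> 'a word" where
  "inv_word w = rev (map (\<lambda>(a, b). (a, \<not> b)) w)"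

lemma inv_word_simps [simp]:
  "inv_word [] = []" "inv_word ((a, b) # w) = inv_word w @ [(a, \<not> b)]"
  "inv_word (u @ v) = inv_word v @ inv_word u" "inv_word (inv_word w) = w"
  "length (inv_word w) = length w" "inv_word w \<in> words A \<longleftrightarrow> w \<in> words A"
proof -
  show "inv_word (inv_word w) = w"
    by (induction w) (auto simp: inv_word_def rev_map comp_def)
  show "inv_word w \<in> words A \<longleftrightarrow> w \<in> words A"
    by (induction w) (auto simp: inv_word_def)
qed (auto simp: inv_word_def)

lemma free_rel_words: "(u, v) \<in> free_rel A \<Longrightarrow> u \<in> words A \<and> v \<in> words A"
  by (induction rule: free_rel.induct) auto

lemma free_rel_append:
  assumes "(u, v) \<in> free_rel A" "p \<in> words A" "q \<in> words A"
  shows "(p @ u @ q, p @ v @ q) \<in> free_rel A"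
  using assms
proof (induction rule: free_rel.induct)
  case (cancel u v a b)
  then show ?case using free_rel.cancel[of "p @ u" A "v @ q" a b] by simp
qed (auto intro: free_rel.intros)

lemma free_rel_append2:
  assumes "(u, u') \<in> free_rel A" "(v, v') \<in> free_rel A"
  shows "(u @ v, u' @ v') \<in> free_rel A"
  using free_rel_append[OF assms(1), of "[]" v] free_rel_append[OF assms(2), of u' "[]"]
    free_rel_words[OF assms(1)] free_rel_words[OF assms(2)] free_rel.trans by fastforce

lemma free_rel_inv_word: "w \<in> words A \<Longrightarrow> (w @ inv_word w, []) \<in> free_rel A"
proof (induction w)
  case Nil
  then show ?case by (auto intro: free_rel.refl)
next
  case (Cons x w)
  obtain a b where x: "x = (a, b)" by force
  have "((a, b) # (w @ inv_word w) @ [(a, \<not> b)], (a, b) # [(a, \<not> b)]) \<in> free_rel A"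
    using free_rel_append[OF Cons.IH, of "[(a,b)]" "[(a, \<not> b)]"] Cons.prems x by auto
  moreover have "((a, b) # [(a, \<not> b)], []) \<in> free_rel A"
    using free_rel.cancel[of "[]" A "[]" a b] Cons.prems x by auto
  ultimately show ?case using x free_rel.trans by fastforce
qed

lemma free_rel_inv_word': "w \<in> words A \<Longrightarrow> (inv_word w @ w, []) \<in> free_rel A"
  using free_rel_inv_word[of "inv_word w" A] by simp

lemma free_rel_cong_inv_word:
  assumes "(u, v) \<in> free_rel A" shows "(inv_word u, inv_word v) \<in> free_rel A"
proof -
  note w = free_rel_words[OF assms]
  have "(inv_word u @ v @ inv_word v, inv_word u @ [] @ []) \<in> free_rel A"
    using free_rel_append[OF free_rel_inv_word[of v A], of "inv_word u" "[]"] w by auto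
  moreover have "(inv_word u @ u @ inv_word v, inv_word u @ v @ inv_word v) \<in> free_rel A"
    using free_rel_append[OF assms, of "inv_word u" "inv_word v"] w by auto
  moreover have "((inv_word u @ u) @ inv_word v, inv_word v) \<in> free_rel A"
    using free_rel_append[OF free_rel_inv_word'[of u A], of "[]" "inv_word v"] w by auto
  ultimately show ?thesis using free_rel.trans free_rel.sym by (metis append_Nil2 append_assoc)
qed

lemma equiv_free_rel: "equiv (words A) (free_rel A)"
proof (rule equivI)
  show "free_rel A \<subseteq> words A \<times> words A" by (auto dest: free_rel_words)
  show "refl_on (words A) (free_rel A)"
    by (auto simp: refl_on_def intro: free_rel.refl)
  show "Relation.sym (free_rel A)" by (auto simp: sym_def intro: free_rel.sym)
  show "Relation.trans (free_rel A)" by (auto simp: trans_def intro: free_rel.trans)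
qed

text \<open>The free group on all elements of a type, as an instance of \<open>group_add\<close>: the simplifier then
  decides identities that hold in every group.  The operation is written additively although it
  is not commutative.\<close>

quotient_type 'a free_grp = "'a word" / "\<lambda>u v. (u, v) \<in> free_rel UNIV"
  morphisms rep_free_grp elt
proof (rule equivpI)
  show "reflp (\<lambda>u v. (u, v) \<in> free_rel UNIV)" by (auto simp: reflp_def intro: free_rel.refl)
  show "symp (\<lambda>u v. (u, v) \<in> free_rel UNIV)" by (auto simp: symp_def intro: free_rel.sym)
  show "transp (\<lambda>u v. (u, v) \<in> free_rel UNIV)" by (auto simp: transp_def intro: free_rel.trans)
qed

instantiation free_grp :: (type) group_add
begin

lift_definition zero_free_grp :: "'a free_grp" is "[]" .
lift_definition plus_free_grp :: "'a free_grp \<Rightarrow> 'a free_grp \<Rightarrow> 'a free_grp" is "(@)"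
  by (rule free_rel_append2)
lift_definition uminus_free_grp :: "'a free_grp \<Rightarrow> 'a free_grp" is inv_word
  by (rule free_rel_cong_inv_word)
definition minus_free_grp :: "'a free_grp \<Rightarrow> 'a free_grp \<Rightarrow> 'a free_grp" where "minus_free_grp u v = u + - v"

instance
proof
  fix u v w :: "'a free_grp"
  show "u + v + w = u + (v + w)" by transfer (auto intro: free_rel.refl)
  show "0 + u = u" by transfer (auto intro: free_rel.refl)
  show "u + 0 = u" by transfer (auto intro: free_rel.refl)
  show "- u + u = 0" by transfer (auto intro: free_rel_inv_word')
  show "u + - v = u - v" by (simp add: minus_free_grp_def)
qed

end

lemma elt_eq_iff: "elt u = elt v \<longleftrightarrow> (u, v) \<in> free_rel UNIV"
  by (rule free_grp.abs_eq_iff)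

lemma elt_simps: "elt [] = 0" "elt (u @ v) = elt u + elt v" "elt (inv_word u) = - elt u"
  by (simp_all add: zero_free_grp.abs_eq plus_free_grp.abs_eq uminus_free_grp.abs_eq)

lemma elt_surj: "\<exists>w. g = elt w"
  by (induction g) auto

definition gen :: "'a \<Rightarrow> 'a free_grp" where "gen a = elt [(a, True)]"

lemma elt_Cons: "elt ((a, b) # w) = (if b then gen a else - gen a) + elt w"
  using elt_simps(2)[of "[(a, b)]" w] elt_simps(3)[of "[(a, True)]"] by (auto simp: gen_def)

text \<open>Deleting all letters outside of an alphabet retracts the free group on all letters onto the
  free group on that alphabet.  It lets all calculations take place in one group, without side
  conditions on the letters of the conjugators.\<close>

definition restrict_word :: "'a set \<Rightarrow> 'a word \<Rightarrow> 'a word" where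
  "restrict_word A w = filter (\<lambda>x. fst x \<in> A) w"

lemma restrict_word_simps [simp]:
  "restrict_word A [] = []" "restrict_word A (u @ v) = restrict_word A u @ restrict_word A v"
  "restrict_word A w \<in> words A" "w \<in> words A \<Longrightarrow> restrict_word A w = w"
  "restrict_word A (inv_word w) = inv_word (restrict_word A w)"
proof -
  show "restrict_word A w \<in> words A" by (auto simp: restrict_word_def words_def mem_Times_iff)
  show "w \<in> words A \<Longrightarrow> restrict_word A w = w"
    by (induction w) (auto simp: restrict_word_def)
  show "restrict_word A (inv_word w) = inv_word (restrict_word A w)"
    by (induction w) (auto simp: restrict_word_def)
qed (auto simp: restrict_word_def)

lemma free_rel_restrict:
  assumes "(u, v) \<in> free_rel UNIV" shows "(restrict_word A u, restrict_word A v) \<in> free_rel A"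
  using assms
proof (induction rule: free_rel.induct)
  case (cancel u v a b)
  show ?case
  proof (cases "a \<in> A")
    case True
    then show ?thesis using free_rel.cancel[of "restrict_word A u" A "restrict_word A v" a b]
        restrict_word_simps(3)[of A u] restrict_word_simps(3)[of A v]
      by (simp add: restrict_word_def) 
  next
    case False
    then show ?thesis using free_rel.refl[of "restrict_word A (u @ v)" A]
        restrict_word_simps(3)[of A u] restrict_word_simps(3)[of A v]
      by (simp add: restrict_word_def)
  qed
next
  case (refl w)
  then show ?case by (auto intro: free_rel.refl)
qed (auto intro: free_rel.intros)

lemma free_rel_mono: assumes "(u, v) \<in> free_rel A" shows "(u, v) \<in> free_rel UNIV"
  using assms
proof (induction rule: free_rel.induct)
  case (cancel u v a b)
  then show ?case by (intro free_rel.cancel) auto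
qed (auto intro: free_rel.intros)

text \<open>Free equivalence through words over a subset of the letters is no finer than through all words,
  because a chain of elementary cancellations can be retracted.\<close>

lemma word_class_eq_iff:
  assumes "u \<in> words A" "v \<in> words A"
  shows "word_class A u = word_class A v \<longleftrightarrow> elt u = elt v"
proof -
  have "word_class A u = word_class A v \<longleftrightarrow> (u, v) \<in> free_rel A"
    unfolding word_class_def using eq_equiv_class_iff[OF equiv_free_rel] assms by blast
  also have "\<dots> \<longleftrightarrow> (u, v) \<in> free_rel UNIV"
    using free_rel_mono free_rel_restrict[of u v A] assms by auto
  finally show ?thesis by (simp add: elt_eq_iff)
qed

lemma carrier_free_group: "carrier (free_group A) = word_class A ` words A"
  by (auto simp: free_group_def word_class_def quotient_def)

lemma word_class_mult:
  assumes "u \<in> words A" "v \<in> words A"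
  shows "word_class A u \<otimes>\<^bsub>free_group A\<^esub> word_class A v = word_class A (u @ v)"
proof -
  have "free_rel A `` {u' @ v' |u' v'. u' \<in> word_class A u \<and> v' \<in> word_class A v} = word_class A (u @ v)"
    (is "?L = ?R")
  proof
    show "?L \<subseteq> ?R"
      unfolding word_class_def using free_rel_append2 free_rel.trans by fastforce
    show "?R \<subseteq> ?L"
      unfolding word_class_def using free_rel.refl assms by blast
  qed
  then show ?thesis by (simp add: free_group_def)
qed

lemma one_free_group: "\<one>\<^bsub>free_group A\<^esub> = word_class A []"
  by (simp add: free_group_def)

lemma group_free_group: "Group.group (free_group A)"
proof (rule groupI)
  fix x assume "x \<in> carrier (free_group A)"
  then obtain u where u: "u \<in> words A" "x = word_class A u" by (auto simp: carrier_free_group)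
  have "word_class A (inv_word u @ u) = word_class A []"
    using u by (subst word_class_eq_iff) (auto simp: elt_simps)
  then show "\<exists>y\<in>carrier (free_group A). y \<otimes>\<^bsub>free_group A\<^esub> x = \<one>\<^bsub>free_group A\<^esub>"
    using u by (intro bexI[of _ "word_class A (inv_word u)"])
      (auto simp: carrier_free_group word_class_mult one_free_group)
qed (auto simp: carrier_free_group word_class_mult one_free_group)

lemma word_class_inv:
  assumes "u \<in> words A"
  shows "inv\<^bsub>free_group A\<^esub> word_class A u = word_class A (inv_word u)"
proof -
  interpret group "free_group A" by (rule group_free_group)
  have "word_class A (inv_word u @ u) = word_class A []"
    using assms by (subst word_class_eq_iff) (auto simp: elt_simps)
  then show ?thesis
    using assms by (intro inv_equality) (auto simp: carrier_free_group word_class_mult one_free_group)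
qed

section \<open>Area in free groups\<close>

lemmas group_norm = add.assoc minus_add diff_conv_add_uminus

text \<open>Area bounds in an arbitrary group.  The conjugators range over the whole group, so that bounds are
  preserved by conjugation and pushed forward by homomorphisms.\<close>

inductive area_le :: "'f::group_add set \<Rightarrow> nat \<Rightarrow> 'f \<Rightarrow> bool" for S where
  zero: "area_le S N 0"
| pos: "area_le S N g \<Longrightarrow> r \<in> S \<Longrightarrow> area_le S (Suc N) (g + (- u + r + u))"
| neg: "area_le S N g \<Longrightarrow> r \<in> S \<Longrightarrow> area_le S (Suc N) (g + (- u - r + u))"

lemma area_le_mono: "area_le S M g \<Longrightarrow> M \<le> N \<Longrightarrow> area_le S N g"
proof (induction arbitrary: N rule: area_le.induct)
  case (pos M g r u)
  then obtain N' where "N = Suc N'" "M \<le> N'" by (cases N) auto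
  then show ?case using pos area_le.pos by blast
next
  case (neg M g r u)
  then obtain N' where "N = Suc N'" "M \<le> N'" by (cases N) auto
  then show ?case using neg area_le.neg by blast
qed (rule area_le.zero)

lemma area_le_add: "area_le S N h \<Longrightarrow> area_le S M g \<Longrightarrow> area_le S (M + N) (g + h)"
proof (induction rule: area_le.induct)
  case (zero N)
  then show ?case using area_le_mono by fastforce
next
  case (pos N h r u)
  then show ?case using area_le.pos[of S "M + N" "g + h" r u] by (simp add: add.assoc)
next
  case (neg N h r u)
  then show ?case using area_le.neg[of S "M + N" "g + h" r u] by (simp add: add.assoc)
qed

lemma area_le_conj: "area_le S N g \<Longrightarrow> area_le S N (- u + g + u)"
proof (induction rule: area_le.induct)
  case (pos N g r v)
  show ?case using area_le.pos[OF pos.IH pos.hyps(2), of "v + u"]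
    by (simp add: group_norm del: add_uminus_conv_diff)
next
  case (neg N g r v)
  show ?case using area_le.neg[OF neg.IH neg.hyps(2), of "v + u"]
    by (simp add: group_norm del: add_uminus_conv_diff)
qed (auto intro: area_le.zero)

lemma area_le_neg: "area_le S N g \<Longrightarrow> area_le S N (- g)"
proof (induction rule: area_le.induct)
  case (pos N g r u)
  have "area_le S (0 + 1) (0 + (- u - r + u))"
    using area_le.neg[OF area_le.zero pos.hyps(2), of 0 u] by simp
  then have "area_le S (1 + N) (- u - r + u - g)"
    using area_le_add[OF pos.IH, of 1 "- u - r + u"] by simp
  then show ?case by (simp add: group_norm del: add_uminus_conv_diff)
next
  case (neg N g r u)
  have "area_le S (0 + 1) (0 + (- u + r + u))"
    using area_le.pos[OF area_le.zero neg.hyps(2), of 0 u] by simp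
  then have "area_le S (1 + N) (- u + r + u - g)"
    using area_le_add[OF neg.IH, of 1 "- u + r + u"] by simp
  then show ?case by (simp add: group_norm del: add_uminus_conv_diff)
qed (auto intro: area_le.zero)

lemma area_le_relator: "r \<in> S \<Longrightarrow> area_le S 1 r"
  using area_le.pos[OF area_le.zero, of r S 0 0] by simp

lemma relator_conjugates_eq:
  assumes "R \<subseteq> words A"
  shows "relator_conjugates A R =
    {word_class A (inv_word u @ r @ u) | u r. u \<in> words A \<and> r \<in> R \<union> inv_word ` R}"
proof -
  have inv_R: "(\<lambda>s. inv\<^bsub>free_group A\<^esub> word_class A s) ` R = word_class A ` inv_word ` R"
    using assms by (auto simp: word_class_inv image_image subset_iff intro!: image_cong)
  have "relator_conjugates A R =
    {inv\<^bsub>free_group A\<^esub> word_class A u \<otimes>\<^bsub>free_group A\<^esub> word_class A r \<otimes>\<^bsub>free_group A\<^esub> word_class A u |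
      u r. u \<in> words A \<and> r \<in> R \<union> inv_word ` R}"
    unfolding relator_conjugates_def inv_R carrier_free_group image_Un[symmetric] by blast
  also have "\<dots> = {word_class A (inv_word u @ r @ u) | u r. u \<in> words A \<and> r \<in> R \<union> inv_word ` R}"
    using assms by (intro Collect_cong ex_cong1) (auto simp: word_class_inv word_class_mult subset_iff)
  finally show ?thesis .
qed

lemma relator_conjugates_subset:
  "R \<subseteq> words A \<Longrightarrow> relator_conjugates A R \<subseteq> carrier (free_group A)"
  by (auto simp: relator_conjugates_eq carrier_free_group subset_iff)

lemma normal_relator_closure:
  assumes "R \<subseteq> words A" shows "relator_closure A R \<lhd> free_group A"
proof -
  interpret group "free_group A" by (rule group_free_group)
  show ?thesis unfolding relator_closure_def
  proof (rule normal_generateI[OF relator_conjugates_subset[OF assms]])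
    fix h g assume h: "h \<in> relator_conjugates A R" and g: "g \<in> carrier (free_group A)"
    obtain u r where u: "h = word_class A (inv_word u @ r @ u)" "u \<in> words A" "r \<in> R \<union> inv_word ` R"
      using h unfolding relator_conjugates_eq[OF assms] by blast
    obtain v where v: "g = word_class A v" "v \<in> words A" using g by (auto simp: carrier_free_group)
    have "g \<otimes>\<^bsub>free_group A\<^esub> h \<otimes>\<^bsub>free_group A\<^esub> inv\<^bsub>free_group A\<^esub> g =
      word_class A (inv_word (u @ inv_word v) @ r @ (u @ inv_word v))"
      using u v assms by (auto simp: word_class_inv word_class_mult subset_iff)
    moreover have "u @ inv_word v \<in> words A" using u v by simp
    ultimately show "g \<otimes>\<^bsub>free_group A\<^esub> h \<otimes>\<^bsub>free_group A\<^esub> inv\<^bsub>free_group A\<^esub> g \<in> relator_conjugates A R"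
      unfolding relator_conjugates_eq[OF assms] using u(3) by blast
  qed
qed

lemma null_homotopic_iff_closure:
  assumes "R \<subseteq> words A"
  shows "null_homotopic A R w \<longleftrightarrow> w \<in> words A \<and> word_class A w \<in> relator_closure A R"
proof -
  interpret group "free_group A" by (rule group_free_group)
  have sub: "subgroup (relator_closure A R) (free_group A)"
    using normal_relator_closure[OF assms] by (simp add: normal_def)
  have "(relator_closure A R #>\<^bsub>free_group A\<^esub> x = relator_closure A R) = (x \<in> relator_closure A R)"
    if "x \<in> carrier (free_group A)" for x
    using coset_join1[OF _ that sub] coset_join2[OF that sub] by blast
  then show ?thesis
    unfolding null_homotopic_def presented_group_def one_FactGroup
    by (auto simp: carrier_free_group)
qed

lemma (in group) foldr_mult:
  "set cs \<subseteq> carrier G \<Longrightarrow> x \<in> carrier G \<Longrightarrow> foldr (\<otimes>) cs x = foldr (\<otimes>) cs \<one> \<otimes> x \<and> foldr (\<otimes>) cs x \<in> carrier G"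
proof (induction cs)
  case (Cons c cs)
  have "foldr (\<otimes>) cs \<one> \<in> carrier G" using Cons(2) by (induction cs) auto
  then show ?case using Cons by (auto simp: m_assoc)
qed auto

lemma elt_restrict_cong: "elt u = elt v \<Longrightarrow> elt (restrict_word A u) = elt (restrict_word A v)"
  using free_rel_restrict free_rel_mono unfolding elt_eq_iff by blast

text \<open>The conjugators in \<open>area_le\<close> range over the free group on all letters; retracting the whole
  product turns them into words over \<open>A\<close> and leaves the relators alone.\<close>

lemma area_le_imp_product:
  assumes "R \<subseteq> words A"
  shows "area_le (elt ` R) N g \<Longrightarrow> g = elt w \<Longrightarrow>
    \<exists>cs. length cs \<le> N \<and> set cs \<subseteq> relator_conjugates A R \<and>
      word_class A (restrict_word A w) = foldr (\<otimes>\<^bsub>free_group A\<^esub>) cs \<one>\<^bsub>free_group A\<^esub>"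
proof (induction arbitrary: w rule: area_le.induct)
  case (zero N)
  then have "elt w = elt []" by (simp add: elt_simps)
  from elt_restrict_cong[OF this] have "word_class A (restrict_word A w) = word_class A []"
    by (subst word_class_eq_iff) auto
  then show ?case by (intro exI[of _ "[]"]) (auto simp: one_free_group)
next
  interpret group "free_group A" by (rule group_free_group)
  have step: "\<exists>cs. length cs \<le> Suc N \<and> set cs \<subseteq> relator_conjugates A R \<and>
      word_class A (restrict_word A w) = foldr (\<otimes>\<^bsub>free_group A\<^esub>) cs \<one>\<^bsub>free_group A\<^esub>"
    if IH: "\<And>w. g = elt w \<Longrightarrow> \<exists>cs. length cs \<le> N \<and> set cs \<subseteq> relator_conjugates A R \<and>
          word_class A (restrict_word A w) = foldr (\<otimes>\<^bsub>free_group A\<^esub>) cs \<one>\<^bsub>free_group A\<^esub>"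
      and w: "elt w = g + (- u + elt r + u)" and r: "r \<in> R \<union> inv_word ` R"
    for g u :: "'a free_grp" and w r N
  proof -
    obtain wg wu where wg: "g = elt wg" "u = elt wu" using elt_surj by metis
    from IH[OF wg(1)] obtain cs where cs: "length cs \<le> N" "set cs \<subseteq> relator_conjugates A R"
      "word_class A (restrict_word A wg) = foldr (\<otimes>\<^bsub>free_group A\<^esub>) cs \<one>\<^bsub>free_group A\<^esub>" by blast
    have rA: "r \<in> words A" using r assms by auto
    define u' where "u' = restrict_word A wu"
    define g' where "g' = restrict_word A wg"
    define c where "c = word_class A (inv_word u' @ r @ u')"
    have A: "g' \<in> words A" "u' \<in> words A" by (simp_all add: u'_def g'_def)
    have c: "c \<in> relator_conjugates A R" unfolding c_def relator_conjugates_eq[OF assms]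
      using A r by blast
    have cc: "c \<in> carrier (free_group A)" using c relator_conjugates_subset[OF assms] by blast
    have "elt w = elt (wg @ inv_word wu @ r @ wu)" using w wg by (simp add: elt_simps add.assoc)
    from elt_restrict_cong[OF this, of A] have "elt (restrict_word A w) = elt (g' @ inv_word u' @ r @ u')"
      using rA by (simp add: u'_def g'_def)
    then have "word_class A (restrict_word A w) = word_class A g' \<otimes>\<^bsub>free_group A\<^esub> c"
      unfolding c_def using A rA by (simp add: word_class_mult word_class_eq_iff)
    also have "\<dots> = foldr (\<otimes>\<^bsub>free_group A\<^esub>) (cs @ [c]) \<one>\<^bsub>free_group A\<^esub>"
      using cs(2,3) cc foldr_mult[of cs c] relator_conjugates_subset[OF assms] unfolding g'_def
      by (simp add: subset_iff)
    finally show ?thesis using cs c by (intro exI[of _ "cs @ [c]"]) auto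
  qed
  {
    case (pos N g r u)
    from pos.hyps obtain r' where "r' \<in> R" "r = elt r'" by blast
    then show ?case using step[OF pos.IH, where w = w and u = u and r = r'] pos.prems by auto
  next
    case (neg N g r u)
    from neg.hyps obtain r' where "r' \<in> R" "r = elt r'" by blast
    then show ?case using step[OF neg.IH, where w = w and u = u and r = "inv_word r'"] neg.prems by (auto simp: elt_simps)
  }
qed

lemma generate_foldr:
  "set cs \<subseteq> H \<Longrightarrow> foldr (\<otimes>\<^bsub>G\<^esub>) cs \<one>\<^bsub>G\<^esub> \<in> generate G H"
  by (induction cs) (auto intro: generate.intros)

lemma area_le_imp_area:
  assumes "R \<subseteq> words A" "w \<in> words A" "area_le (elt ` R) N (elt w)"
  shows "area A R w \<le> N" "null_homotopic A R w"
proof -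
  obtain cs where cs: "length cs \<le> N" "set cs \<subseteq> relator_conjugates A R"
      "word_class A w = foldr (\<otimes>\<^bsub>free_group A\<^esub>) cs \<one>\<^bsub>free_group A\<^esub>"
    using area_le_imp_product[OF assms(1,3) HOL.refl] assms(2) by auto
  have "area A R w \<le> length cs" unfolding area_def
    using cs by (intro Least_le) auto
  then show "area A R w \<le> N" using cs by simp
  show "null_homotopic A R w"
    using null_homotopic_iff_closure[OF assms(1)] assms(2) generate_foldr[OF cs(2), of "free_group A"] cs(3)
    by (simp add: relator_closure_def)
qed

lemma null_homotopic_imp_area_le:
  assumes "R \<subseteq> words A" "null_homotopic A R w"
  shows "\<exists>N. area_le (elt ` R) N (elt w)"
proof -
  have conj: "\<exists>v\<in>words A. U = word_class A v \<and> area_le (elt ` R) 1 (elt v)"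
    if U: "U \<in> relator_conjugates A R" for U
  proof -
    obtain u r where u: "U = word_class A (inv_word u @ r @ u)" "u \<in> words A" "r \<in> R \<union> inv_word ` R"
      using U unfolding relator_conjugates_eq[OF assms(1)] by blast
    have rel: "area_le (elt ` R) 1 (elt x)" if "x \<in> R" for x
      using that by (intro area_le_relator) simp
    have "area_le (elt ` R) 1 (elt r)"
      using u(3) rel area_le_neg[OF rel] by (auto simp: elt_simps)
    then have "area_le (elt ` R) 1 (elt (inv_word u @ r @ u))"
      using area_le_conj by (auto simp: elt_simps add.assoc[symmetric])
    then show ?thesis using u assms(1) by (intro bexI[of _ "inv_word u @ r @ u"]) auto
  qed
  have "\<exists>v\<in>words A. U = word_class A v \<and> (\<exists>N. area_le (elt ` R) N (elt v))"
    if "U \<in> generate (free_group A) (relator_conjugates A R)" for U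
    using that
  proof (induction rule: generate.induct)
    case one
    then show ?case by (intro bexI[of _ "[]"]) (auto simp: one_free_group elt_simps intro: area_le.zero)
  next
    case (incl h)
    then show ?case using conj by blast
  next
    case (inv h)
    then obtain v where "v \<in> words A" "h = word_class A v" "area_le (elt ` R) 1 (elt v)"
      using conj by blast
    then show ?case
      by (intro bexI[of _ "inv_word v"]) (auto simp: word_class_inv elt_simps intro: area_le_neg)
  next
    case (eng h1 h2)
    then obtain v1 v2 N1 N2 where "v1 \<in> words A" "v2 \<in> words A" "h1 = word_class A v1"
      "h2 = word_class A v2" "area_le (elt ` R) N1 (elt v1)" "area_le (elt ` R) N2 (elt v2)" by blast
    then show ?case
      by (intro bexI[of _ "v1 @ v2"]) (auto simp: word_class_mult elt_simps intro: area_le_add)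
  qed
  then obtain v N where "v \<in> words A" "word_class A w = word_class A v" "area_le (elt ` R) N (elt v)"
    using assms null_homotopic_iff_closure[OF assms(1)] unfolding relator_closure_def by blast
  then show ?thesis using null_homotopic_iff_closure[OF assms(1)] assms(2) word_class_eq_iff by metis
qed

lift_definition free_lift :: "('a \<Rightarrow> 'h::group_add) \<Rightarrow> 'a free_grp \<Rightarrow> 'h" is
  "\<lambda>f w. sum_list (map (\<lambda>(a, b). if b then f a else - f a) w)"
  by (erule free_rel.induct) (auto simp: add.assoc)

lemma free_lift_simps [simp]:
  "free_lift f 0 = 0" "free_lift f (u + v) = free_lift f u + free_lift f v" "free_lift f (- u) = - free_lift f u"
  "free_lift f (u - v) = free_lift f u - free_lift f v" "free_lift f (gen a) = f a"
proof -
  show z: "free_lift f 0 = 0" by transfer auto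
  show p: "free_lift f (u + v) = free_lift f u + free_lift f v" for u v by transfer auto
  show m: "free_lift f (- u) = - free_lift f u" for u
    using p[of "- u" u] z by (simp add: eq_neg_iff_add_eq_0)
  show "free_lift f (u - v) = free_lift f u - free_lift f v"
    using p[of u "- v"] m[of v] by simp
  show "free_lift f (gen a) = f a" by (simp add: gen_def free_lift.abs_eq)
qed

section \<open>Equality up to a number of relators\<close>

text \<open>Two elements are homotopic at cost \<open>N\<close> if one becomes the other by inserting or deleting
  conjugates of at most \<open>N\<close> relators.  Costs add along chains and under multiplication.\<close>

definition homotopic :: "'f::group_add set \<Rightarrow> nat \<Rightarrow> 'f \<Rightarrow> 'f \<Rightarrow> bool" where
  "homotopic S N u v \<longleftrightarrow> area_le S N (u - v)"

lemma homotopic_refl [simp, intro]: "homotopic S N u u"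
  by (simp add: homotopic_def area_le.zero)

lemma homotopic_mono: "homotopic S M u v \<Longrightarrow> M \<le> N \<Longrightarrow> homotopic S N u v"
  unfolding homotopic_def by (rule area_le_mono)

lemma homotopic_sym: "homotopic S N u v \<Longrightarrow> homotopic S N v u"
  unfolding homotopic_def by (drule area_le_neg) simp

lemma homotopic_trans [trans]: "homotopic S M u v \<Longrightarrow> homotopic S N v w \<Longrightarrow> homotopic S (M + N) u w"
  unfolding homotopic_def using area_le_add[of S N "v - w" M "u - v"]
  by (simp add: group_norm del: add_uminus_conv_diff)

lemma homotopic_add_right: "homotopic S N u v \<Longrightarrow> homotopic S N (u + w) (v + w)"
  unfolding homotopic_def by (simp add: group_norm del: add_uminus_conv_diff)

lemma homotopic_add_left: "homotopic S N u v \<Longrightarrow> homotopic S N (w + u) (w + v)"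
  unfolding homotopic_def using area_le_conj[of S N "u - v" "- w"]
  by (simp add: group_norm del: add_uminus_conv_diff)

lemma homotopic_add: "homotopic S M u u' \<Longrightarrow> homotopic S N v v' \<Longrightarrow> homotopic S (M + N) (u + v) (u' + v')"
  by (blast intro: homotopic_trans homotopic_add_left homotopic_add_right)

lemma homotopic_uminus: "homotopic S N u v \<Longrightarrow> homotopic S N (- u) (- v)"
proof -
  assume "homotopic S N u v"
  then have "homotopic S N (- u + v) 0"
    using homotopic_add_left[of S N u v "- u"] homotopic_sym by fastforce
  from homotopic_add_right[OF this, of "- v"] show ?thesis
    by (simp add: group_norm del: add_uminus_conv_diff)
qed

section \<open>Presentations and change of presentation\<close>

text \<open>An evaluation of words over an alphabet in a group.  The cancellation rule forces formal inverses
  to go to inverses.\<close>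

locale marked_group = Group.group G for G :: "('g, 'm) monoid_scheme" (structure) +
  fixes B :: "'b set" and E :: "'b word \<Rightarrow> 'g"
  assumes E_closed: "u \<in> words B \<Longrightarrow> E u \<in> carrier G"
    and E_append: "u \<in> words B \<Longrightarrow> v \<in> words B \<Longrightarrow> E (u @ v) = E u \<otimes> E v"
    and E_cancel: "a \<in> B \<Longrightarrow> E [(a, b), (a, \<not> b)] = \<one>"
    and E_Nil: "E [] = \<one>"
begin

lemma E_free_rel: "(u, v) \<in> free_rel B \<Longrightarrow> E u = E v"
proof (induction rule: free_rel.induct)
  case (cancel u v a b)
  then have "E (u @ [(a, b), (a, \<not> b)] @ v) = E u \<otimes> (E [(a, b), (a, \<not> b)] \<otimes> E v)"
    by (subst E_append, simp, simp, subst E_append) auto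
  then show ?case using cancel by (simp add: E_cancel E_append E_closed)
qed auto

lemma E_inv_word: "u \<in> words B \<Longrightarrow> E (inv_word u) = inv (E u)"
proof -
  assume u: "u \<in> words B"
  have "E (inv_word u @ u) = \<one>" using E_free_rel[OF free_rel_inv_word'[OF u]] by (simp add: E_Nil)
  then show ?thesis using u by (intro inv_equality[symmetric]) (auto simp: E_append E_closed)
qed

text \<open>The first isomorphism theorem: completeness says that the kernel of the evaluation is no larger
  than the normal closure of the relators.\<close>

lemma presented_groupI:
  assumes S: "S \<subseteq> words B" and surj: "carrier G \<subseteq> E ` words B"
    and rel: "\<And>s. s \<in> S \<Longrightarrow> E s = \<one>"
    and complete: "\<And>w. w \<in> words B \<Longrightarrow> E w = \<one> \<Longrightarrow> null_homotopic B S w"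
  shows "presented_group B S \<cong> G"
proof -
  define h where "h U = E (SOME w. w \<in> words B \<and> U = word_class B w)" for U
  have h: "h (word_class B w) = E w" if w: "w \<in> words B" for w
  proof -
    define v where "v = (SOME v. v \<in> words B \<and> word_class B w = word_class B v)"
    have "v \<in> words B \<and> word_class B w = word_class B v"
      unfolding v_def by (rule someI[of _ w]) (simp add: w)
    then have "(v, w) \<in> free_rel B"
      using w eq_equiv_class_iff[OF equiv_free_rel, of v B w] unfolding word_class_def by auto
    then show ?thesis using E_free_rel unfolding h_def v_def by blast
  qed
  have hom: "group_hom (free_group B) G h"
  proof -
    have "h \<in> Group.hom (free_group B) G"
      by (auto simp: hom_def carrier_free_group h E_closed word_class_mult E_append)
    then show ?thesis using group_free_group is_group by (simp add: group_hom_def group_hom_axioms_def)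
  qed
  interpret F: Group.group "free_group B" by (rule group_free_group)
  interpret h: group_hom "free_group B" G h by (rule hom)
  have "kernel (free_group B) G h = relator_closure B S"
  proof
    show "kernel (free_group B) G h \<subseteq> relator_closure B S"
      using complete null_homotopic_iff_closure[OF S] by (auto simp: kernel_def carrier_free_group h)
    have "relator_conjugates B S \<subseteq> kernel (free_group B) G h"
    proof
      fix U assume U: "U \<in> relator_conjugates B S"
      then obtain u r where u: "U = word_class B (inv_word u @ r @ u)" "u \<in> words B" "r \<in> S \<union> inv_word ` S"
        unfolding relator_conjugates_eq[OF S] by blast
      have "E r = \<one>" "r \<in> words B" using u(3) rel S by (auto simp: E_inv_word subset_iff)
      then show "U \<in> kernel (free_group B) G h"
        using u(1,2) by (auto simp: kernel_def carrier_free_group h E_append E_inv_word E_closed)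
    qed
    then show "relator_closure B S \<subseteq> kernel (free_group B) G h"
      unfolding relator_closure_def by (intro F.generate_subgroup_incl h.subgroup_kernel)
  qed
  moreover have "h ` carrier (free_group B) = E ` words B"
    by (force simp: carrier_free_group h)
  moreover have "E ` words B = carrier G" using surj E_closed by auto
  ultimately show ?thesis
    using h.FactGroup_iso by (simp add: presented_group_def)
qed

end

text \<open>The quotient map followed by an isomorphism is such an evaluation.\<close>

lemma presentation_marking:
  assumes "finite_presentation A R G" "Group.group G"
  obtains E where "marked_group G A E" "carrier G \<subseteq> E ` words A"
    "\<And>w. w \<in> words A \<Longrightarrow> E w = \<one>\<^bsub>G\<^esub> \<longleftrightarrow> null_homotopic A R w"
proof -
  interpret G: Group.group G by (rule assms(2))
  have R: "R \<subseteq> words A" and "presented_group A R \<cong> G"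
    using assms by (auto simp: finite_presentation_def)
  then obtain f where f: "f \<in> iso (presented_group A R) G" by (auto simp: is_iso_def)
  interpret N: normal "relator_closure A R" "free_group A" by (rule normal_relator_closure[OF R])
  interpret P: Group.group "presented_group A R"
    unfolding presented_group_def by (rule N.factorgroup_is_group)
  interpret f: group_hom "presented_group A R" G f
    using f P.is_group G.is_group by (auto simp: group_hom_def group_hom_axioms_def iso_def)
  define q where "q w = relator_closure A R #>\<^bsub>free_group A\<^esub> word_class A w" for w
  have q: "q w \<in> carrier (presented_group A R)" if "w \<in> words A" for w
    using that by (auto simp: q_def presented_group_def carrier_FactGroup carrier_free_group)
  have q_append: "q (u @ v) = q u \<otimes>\<^bsub>presented_group A R\<^esub> q v" if "u \<in> words A" "v \<in> words A" for u v
    using that N.rcos_sum[of "word_class A u" "word_class A v"]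
    by (simp add: q_def presented_group_def carrier_free_group word_class_mult)
  have q_one: "q w = \<one>\<^bsub>presented_group A R\<^esub> \<longleftrightarrow> null_homotopic A R w" if "w \<in> words A" for w
    using that by (simp add: null_homotopic_def q_def)
  have inj: "f (q w) = \<one>\<^bsub>G\<^esub> \<longleftrightarrow> q w = \<one>\<^bsub>presented_group A R\<^esub>" if "w \<in> words A" for w
    using f q[OF that] f.hom_one P.one_closed
    by (metis iso_iff f.inj_on_one_iff)
  have cancel: "null_homotopic A R w" if "w \<in> words A" "elt w = 0" for w
    using area_le_imp_area(2)[OF R that(1), of 0] that(2) by (simp add: area_le.zero)
  show ?thesis
  proof (rule that[of "\<lambda>w. f (q w)"])
    have "f (q [(a, b), (a, \<not> b)]) = \<one>\<^bsub>G\<^esub>" if "a \<in> A" for a b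
      using that inj[of "[(a, b), (a, \<not> b)]"] q_one cancel[of "[(a, b), (a, \<not> b)]"]
      by (auto simp: elt_Cons elt_simps)
    moreover have "f (q []) = \<one>\<^bsub>G\<^esub>"
      using inj[of "[]"] q_one cancel[of "[]"] by (auto simp: elt_simps)
    ultimately show "marked_group G A (\<lambda>w. f (q w))"
      by unfold_locales (use q q_append in auto)
    have "f ` carrier (presented_group A R) = carrier G"
      using f by (auto simp: iso_def bij_betw_def)
    then show "carrier G \<subseteq> (\<lambda>w. f (q w)) ` words A"
      by (force simp: presented_group_def carrier_FactGroup carrier_free_group q_def)
    show "f (q w) = \<one>\<^bsub>G\<^esub> \<longleftrightarrow> null_homotopic A R w" if "w \<in> words A" for w
      using inj q_one that by blast
  qed
qed

lemma area_le_free_lift: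
  assumes "\<And>s. s \<in> S \<Longrightarrow> area_le T K (free_lift f s)"
  shows "area_le S N g \<Longrightarrow> area_le T (N * K) (free_lift f g)"
proof (induction rule: area_le.induct)
  case (pos N g r u)
  show ?case using area_le_add[OF area_le_conj[OF assms[OF pos.hyps(2)]] pos.IH, of "free_lift f u"]
    by (simp add: add.commute)
next
  case (neg N g r u)
  show ?case using area_le_add[OF area_le_conj[OF area_le_neg[OF assms[OF neg.hyps(2)]]] neg.IH, of "free_lift f u"]
    by (simp add: add.commute)
qed (simp add: area_le.zero)

lemma homotopic_word_map:
  assumes "w \<in> words A" "\<And>a. a \<in> A \<Longrightarrow> homotopic T M (gen a) (f a)"
  shows "homotopic T (M * length w) (elt w) (sum_list (map (\<lambda>(a, b). if b then f a else - f a) w))"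
  using assms(1)
proof (induction w)
  case Nil
  then show ?case by (simp add: elt_simps)
next
  case (Cons x w)
  obtain a b where x: "x = (a, b)" by force
  have "homotopic T M (if b then gen a else - gen a) (if b then f a else - f a)"
    using assms(2)[of a] homotopic_uminus[OF assms(2)[of a]] Cons.prems x by auto
  from homotopic_add[OF this Cons.IH] show ?case using Cons.prems x by (simp add: elt_Cons)
qed

lemma finite_area_bound:
  assumes "finite T" "\<And>t. t \<in> T \<Longrightarrow> \<exists>N. area_le S N (f t)"
  obtains K where "\<And>t. t \<in> T \<Longrightarrow> area_le S K (f t)"
proof -
  obtain N where N: "\<And>t. t \<in> T \<Longrightarrow> area_le S (N t) (f t)" using assms(2) by metis
  have "area_le S (Max (N ` T)) (f t)" if "t \<in> T" for t
    using N[OF that] by (rule area_le_mono) (use assms(1) that in auto)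
  then show ?thesis by (rule that)
qed

text \<open>Area bounds do not depend on the presentation up to constants: a word over \<open>A\<close> is translated
  into a word over \<open>B\<close>, its area there is translated back relator by relator, and the round trip
  changes each letter by a bounded number of relators of the first presentation.\<close>

lemma change_of_presentation:
  fixes F :: "nat \<Rightarrow> nat"
  assumes P: "finite A" "R \<subseteq> words A" "marked_group G A E" "carrier G \<subseteq> E ` words A"
      "\<And>w. w \<in> words A \<Longrightarrow> E w = \<one>\<^bsub>G\<^esub> \<longleftrightarrow> null_homotopic A R w"
    and Q: "finite B" "finite S" "S \<subseteq> words B" "marked_group G B D" "carrier G \<subseteq> D ` words B"
      "\<And>s. s \<in> S \<Longrightarrow> D s = \<one>\<^bsub>G\<^esub>"
      "\<And>w. w \<in> words B \<Longrightarrow> D w = \<one>\<^bsub>G\<^esub> \<Longrightarrow> area_le (elt ` S) (F (length w)) (elt w)"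
    and F: "mono F"
  obtains K where "\<And>w. null_homotopic A R w \<Longrightarrow>
    area_le (elt ` R) (K * F (K * length w) + K * length w) (elt w)"
proof -
  interpret E: marked_group G A E by (rule P(3))
  interpret D: marked_group G B D by (rule Q(4))
  have "\<exists>u\<in>words B. D u = E [(a, True)]" if "a \<in> A" for a
    using subsetD[OF Q(5) E.E_closed[of "[(a, True)]"]] that by fastforce
  then obtain \<phi> where \<phi>: "\<And>a. a \<in> A \<Longrightarrow> \<phi> a \<in> words B" "\<And>a. a \<in> A \<Longrightarrow> D (\<phi> a) = E [(a, True)]"
    by metis
  have "\<exists>u\<in>words A. E u = D [(b, True)]" if "b \<in> B" for b
    using subsetD[OF P(4) D.E_closed[of "[(b, True)]"]] that by fastforce
  then obtain \<psi> where \<psi>: "\<And>b. b \<in> B \<Longrightarrow> \<psi> b \<in> words A" "\<And>b. b \<in> B \<Longrightarrow> E (\<psi> b) = D [(b, True)]"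
    by metis
  define \<Phi> where "\<Phi> w = concat (map (\<lambda>(a, s). if s then \<phi> a else inv_word (\<phi> a)) w)" for w
  define \<Psi> where "\<Psi> w = concat (map (\<lambda>(b, s). if s then \<psi> b else inv_word (\<psi> b)) w)" for w
  have \<Phi>: "\<Phi> w \<in> words B \<and> D (\<Phi> w) = E w" if "w \<in> words A" for w
    using that
  proof (induction w)
    case Nil
    then show ?case by (simp add: \<Phi>_def E.E_Nil D.E_Nil)
  next
    case (Cons x w)
    obtain a b where x: "x = (a, b)" by force
    have a: "a \<in> A" "w \<in> words A" using Cons.prems x by auto
    have "E (inv_word [(a, True)]) = inv\<^bsub>G\<^esub> E [(a, True)]" using a by (intro E.E_inv_word) auto
    then have "D (if b then \<phi> a else inv_word (\<phi> a)) = E [(a, b)]"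
      using a \<phi> by (auto simp: D.E_inv_word)
    moreover have "E (x # w) = E [(a, b)] \<otimes>\<^bsub>G\<^esub> E w"
      using E.E_append[of "[(a, b)]" w] a x by simp
    moreover have "\<Phi> (x # w) = (if b then \<phi> a else inv_word (\<phi> a)) @ \<Phi> w" by (simp add: \<Phi>_def x)
    ultimately show ?case using Cons.IH a \<phi>(1) by (simp add: D.E_append)
  qed
  have \<Psi>: "\<Psi> w \<in> words A \<and> E (\<Psi> w) = D w" if "w \<in> words B" for w
    using that
  proof (induction w)
    case Nil
    then show ?case by (simp add: \<Psi>_def E.E_Nil D.E_Nil)
  next
    case (Cons x w)
    obtain a b where x: "x = (a, b)" by force
    have a: "a \<in> B" "w \<in> words B" using Cons.prems x by auto
    have "D (inv_word [(a, True)]) = inv\<^bsub>G\<^esub> D [(a, True)]" using a by (intro D.E_inv_word) auto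
    then have "E (if b then \<psi> a else inv_word (\<psi> a)) = D [(a, b)]"
      using a \<psi> by (auto simp: E.E_inv_word)
    moreover have "D (x # w) = D [(a, b)] \<otimes>\<^bsub>G\<^esub> D w"
      using D.E_append[of "[(a, b)]" w] a x by simp
    moreover have "\<Psi> (x # w) = (if b then \<psi> a else inv_word (\<psi> a)) @ \<Psi> w" by (simp add: \<Psi>_def x)
    ultimately show ?case using Cons.IH a \<psi>(1) by (simp add: E.E_append)
  qed
  define \<psi>' where "\<psi>' = free_lift (\<lambda>b. elt (\<psi> b))"
  have \<Psi>': "elt (\<Psi> w) = \<psi>' (elt w)" for w
    by (induction w) (auto simp: \<Psi>_def \<psi>'_def elt_simps elt_Cons)
  have \<Phi>': "elt (\<Phi> w) = sum_list (map (\<lambda>(a, b). if b then elt (\<phi> a) else - elt (\<phi> a)) w)" for w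
    by (induction w) (auto simp: \<Phi>_def elt_simps elt_Cons)
  \<comment> \<open>The images of the relators of the second presentation have bounded area.\<close>
  have "\<exists>N. area_le (elt ` R) N (elt (\<Psi> s))" if "s \<in> S" for s
    using that \<Psi>[of s] Q(3,6) P(5)[of "\<Psi> s"] by (intro null_homotopic_imp_area_le[OF P(2)]) auto
  then obtain K1 where K1: "\<And>s. s \<in> S \<Longrightarrow> area_le (elt ` R) K1 (elt (\<Psi> s))"
    using finite_area_bound[OF Q(2), of "elt ` R" "\<lambda>s. elt (\<Psi> s)"] by auto
  \<comment> \<open>Translating a generator back and forth changes it by boundedly many relators.\<close>
  have "\<exists>N. area_le (elt ` R) N (gen a - elt (\<Psi> (\<phi> a)))" if "a \<in> A" for a
  proof -
    let ?w = "(a, True) # inv_word (\<Psi> (\<phi> a))"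
    have p: "\<Psi> (\<phi> a) \<in> words A" "E (\<Psi> (\<phi> a)) = E [(a, True)]" using \<Psi>[of "\<phi> a"] \<phi> that by auto
    have "E ([(a, True)] @ inv_word (\<Psi> (\<phi> a))) = \<one>\<^bsub>G\<^esub>"
      using that p E.E_closed[of "[(a, True)]"]
      by (subst E.E_append) (auto simp: E.E_inv_word)
    then have "null_homotopic A R ?w" using P(5)[of ?w] that p by simp
    from null_homotopic_imp_area_le[OF P(2) this] show ?thesis by (simp add: elt_Cons elt_simps)
  qed
  then obtain K2 where K2: "\<And>a. a \<in> A \<Longrightarrow> area_le (elt ` R) K2 (gen a - elt (\<Psi> (\<phi> a)))"
    using finite_area_bound[OF P(1), of "elt ` R" "\<lambda>a. gen a - elt (\<Psi> (\<phi> a))"] by auto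
  define L where "L = Max (insert 0 ((\<lambda>a. length (\<phi> a)) ` A))"
  have L: "length (\<phi> a) \<le> L" if "a \<in> A" for a
    unfolding L_def using P(1) that by (intro Max_ge) auto
  have len: "length (\<Phi> w) \<le> L * length w" if "w \<in> words A" for w
    using that by (induction w) (auto simp: \<Phi>_def add_mono L)
  define K where "K = K1 + K2 + L"
  show ?thesis
  proof (rule that[of K])
    fix w assume "null_homotopic A R w"
    then have w: "w \<in> words A" "E w = \<one>\<^bsub>G\<^esub>" using P(5) by (auto simp: null_homotopic_def)
    have "area_le (elt ` S) (F (length (\<Phi> w))) (elt (\<Phi> w))"
      using Q(7) \<Phi> w by simp
    moreover have "F (length (\<Phi> w)) \<le> F (K * length w)"
    proof (rule monoD[OF F])
      have "length (\<Phi> w) \<le> L * length w" by (rule len) (rule w)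
      also have "\<dots> \<le> K * length w" by (simp add: K_def)
      finally show "length (\<Phi> w) \<le> K * length w" .
    qed
    ultimately have "area_le (elt ` S) (F (K * length w)) (elt (\<Phi> w))" by (rule area_le_mono)
    then have "area_le (elt ` R) (F (K * length w) * K1) (\<psi>' (elt (\<Phi> w)))"
      unfolding \<psi>'_def by (rule area_le_free_lift[rotated]) (use K1 \<Psi>' in \<open>auto simp: \<psi>'_def\<close>)
    moreover have "homotopic (elt ` R) (K2 * length w) (elt w) (\<psi>' (elt (\<Phi> w)))"
    proof -
      have "homotopic (elt ` R) (K2 * length w) (elt w)
         (sum_list (map (\<lambda>(a, b). if b then elt (\<Psi> (\<phi> a)) else - elt (\<Psi> (\<phi> a))) w))"
        using K2 by (intro homotopic_word_map[OF w(1)]) (simp add: homotopic_def)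
      also have "sum_list (map (\<lambda>(a, b). if b then elt (\<Psi> (\<phi> a)) else - elt (\<Psi> (\<phi> a))) w) = \<psi>' (elt (\<Phi> w))"
        unfolding \<Phi>' \<Psi>' by (induction w) (auto simp: \<psi>'_def)
      finally show ?thesis .
    qed
    ultimately have "area_le (elt ` R) (K2 * length w + F (K * length w) * K1) (elt w)"
      using homotopic_trans[of "elt ` R" "K2 * length w" "elt w" "\<psi>' (elt (\<Phi> w))" _ 0]
      by (simp add: homotopic_def)
    then show "area_le (elt ` R) (K * F (K * length w) + K * length w) (elt w)"
      by (rule area_le_mono) (simp add: K_def algebra_simps)
  qed
qed

section \<open>The group of all permutations of a type\<close>

text \<open>All permutations of a type, composed from left to right, again as an instance of \<open>group_add\<close>.\<close>

typedef 'p perms = "{f :: 'p \<Rightarrow> 'p. bij f}" morphisms app Perm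
  by (rule exI[of _ id]) auto

setup_lifting type_definition_perms

instantiation perms :: (type) group_add
begin

lift_definition zero_perms :: "'a perms" is id by simp
lift_definition plus_perms :: "'a perms \<Rightarrow> 'a perms \<Rightarrow> 'a perms" is "\<lambda>f g. g \<circ> f"
  by (rule bij_comp)
lift_definition uminus_perms :: "'a perms \<Rightarrow> 'a perms" is "\<lambda>f. inv_into UNIV f"
  by (rule bij_imp_bij_inv)
definition minus_perms :: "'a perms \<Rightarrow> 'a perms \<Rightarrow> 'a perms" where "minus_perms u v = u + - v"

instance
proof
  fix u v w :: "'a perms"
  show "u + v + w = u + (v + w)" by transfer (simp add: comp_assoc)
  show "0 + u = u" by transfer simp
  show "u + 0 = u" by transfer simp
  show "- u + u = 0" by transfer (rule surj_iff[THEN iffD1, OF bij_is_surj])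
  show "u + - v = u - v" by (simp add: minus_perms_def)
qed

end

lemma app_simps [simp]:
  "app 0 x = x" "app (u + v) x = app v (app u x)" "app (- u) (app u x) = x" "app u (app (- u) x) = x"
  "app (u - v) x = app (- v) (app u x)"
proof -
  show z: "app 0 x = x" for x by (simp add: zero_perms.rep_eq)
  show p: "app (u + v) x = app v (app u x)" for u v x by (simp add: plus_perms.rep_eq)
  show "app (- u) (app u x) = x" "app u (app (- u) x) = x"
    by (simp_all add: p[symmetric] z del: add_uminus_conv_diff)
  show "app (u - v) x = app (- v) (app u x)" using p[of u "- v" x] by simp
qed

lemma bij_app [simp]: "bij (app u)"
  using app[of u] by simp

lemma app_eq_iff [simp]: "app u x = app u y \<longleftrightarrow> x = y"
  using bij_is_inj[OF bij_app] by (rule inj_eq)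

lemma app_uminus_eq_iff: "app (- u) x = y \<longleftrightarrow> x = app u y"
  by (auto simp del: app_eq_iff)

lemma perms_eqI: "(\<And>x. app u x = app v x) \<Longrightarrow> u = v"
  by transfer auto

lift_definition swap :: "'p \<Rightarrow> 'p \<Rightarrow> 'p perms" is Transposition.transpose by simp

lemma app_swap: "app (swap x y) z = (if z = x then y else if z = y then x else z)"
  by transfer (simp add: Transposition.transpose_def)

lemma app_swap_simps [simp]:
  "app (swap x y) x = y" "app (swap x y) y = x" "z \<noteq> x \<Longrightarrow> z \<noteq> y \<Longrightarrow> app (swap x y) z = z"
  by (auto simp: app_swap)

lemma uminus_swap [simp]: "- swap x y = swap x y"
  by (rule perms_eqI) (simp add: app_uminus_eq_iff app_swap)

lemma swap_commute: "swap x y = swap y x"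
  by (rule perms_eqI) (simp add: app_swap)

lemma conj_swap: "- u + swap x y + u = swap (app u x) (app u y)"
proof (rule perms_eqI)
  fix z
  obtain y' where z: "z = app u y'" by (metis app_simps(4))
  have [simp]: "app u y' = app u x \<longleftrightarrow> y' = x" for x y' by (rule app_eq_iff)
  show "app (- u + swap x y + u) z = app (swap (app u x) (app u y)) z"
    by (simp add: z app_swap)
qed

text \<open>Ray 1 plays a special role below, so the index 1 is kept apart from successors.\<close>

declare One_nat_def [simp del]

text \<open>Conjugation acts from the right, like the permutations do.\<close>

definition conj_by :: "'f::group_add \<Rightarrow> 'f \<Rightarrow> 'f" where "conj_by x u = - u + x + u"

lemma conj_by_conj_by [simp]: "conj_by (conj_by x u) v = conj_by x (u + v)"
  by (simp add: conj_by_def group_norm del: add_uminus_conv_diff)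

lemma add_eq_conj_by: "x + u = u + conj_by x u"
  by (simp add: conj_by_def add.assoc)

lemma conj_by_zero [simp]: "conj_by x 0 = x"
  by (simp add: conj_by_def)

lemma free_lift_conj_by [simp]: "free_lift f (conj_by x u) = conj_by (free_lift f x) (free_lift f u)"
  by (simp add: conj_by_def del: add_uminus_conv_diff)

lemma conj_by_swap [simp]: "conj_by (swap x y) u = swap (app u x) (app u y)"
  by (simp add: conj_by_def conj_swap)

lemma homotopic_conj_by: "homotopic S N x y \<Longrightarrow> homotopic S N (conj_by x u) (conj_by y u)"
  unfolding conj_by_def by (intro homotopic_add_right homotopic_add_left)

lemma homotopic_conj_by_right: "homotopic S N u v \<Longrightarrow> homotopic S (2 * N) (conj_by x u) (conj_by x v)"
  unfolding conj_by_def mult_2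
  by (intro homotopic_add homotopic_uminus) (auto intro: homotopic_add_right homotopic_uminus)

lemma homotopic_conj_by_uminus: "homotopic S N (conj_by x u) y \<Longrightarrow> homotopic S N (conj_by y (- u)) x"
  using homotopic_conj_by[of S N "conj_by x u" y "- u"] homotopic_sym by fastforce

section \<open>Generators and relators of Houghton's group\<close>

datatype pt = Ctr | Aux | Ray nat nat

text \<open>The translation of ray \<open>l\<close> into ray \<open>i\<close>.  Positions on a ray start at \<open>0\<close>, and the first point
  of ray \<open>l\<close> moves to the first point of ray \<open>i\<close>.\<close>

definition slide_fun :: "nat \<Rightarrow> nat \<Rightarrow> pt \<Rightarrow> pt" where
  "slide_fun l i x = (if l = i then x else case x of
     Ray j p \<Rightarrow> (if j = l then (case p of 0 \<Rightarrow> Ray i 0 | Suc q \<Rightarrow> Ray l q)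
                 else if j = i then Ray i (Suc p) else x)
   | _ \<Rightarrow> x)"

lemma slide_fun_inverse: "slide_fun i l (slide_fun l i x) = x"
  by (auto simp: slide_fun_def split: pt.splits nat.splits)

lemma bij_slide_fun: "bij (slide_fun l i)"
  by (rule bij_betw_byWitness[where f' = "slide_fun i l"]) (auto simp: slide_fun_inverse)

lift_definition slide :: "nat \<Rightarrow> nat \<Rightarrow> pt perms" is slide_fun
  by (rule bij_slide_fun)

lemma app_slide [simp]:
  "app (slide l i) Ctr = Ctr" "app (slide l i) Aux = Aux"
  "j \<noteq> l \<Longrightarrow> j \<noteq> i \<Longrightarrow> app (slide l i) (Ray j p) = Ray j p"
  "l \<noteq> i \<Longrightarrow> app (slide l i) (Ray l 0) = Ray i 0"
  "l \<noteq> i \<Longrightarrow> app (slide l i) (Ray l (Suc p)) = Ray l p"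
  "l \<noteq> i \<Longrightarrow> app (slide l i) (Ray i p) = Ray i (Suc p)"
  by (transfer; simp add: slide_fun_def)+

lemma slide_refl [simp]: "slide l l = 0"
  by (rule perms_eqI) (transfer, simp add: slide_fun_def zero_perms.rep_eq)

lemma app_slide_cases:
  "app (slide l i) x = (if l = i then x else case x of
     Ray j p \<Rightarrow> (if j = l then (case p of 0 \<Rightarrow> Ray i 0 | Suc q \<Rightarrow> Ray l q)
                 else if j = i then Ray i (Suc p) else x)
   | _ \<Rightarrow> x)"
  by transfer (simp add: slide_fun_def)

lemma uminus_slide [simp]: "- slide l i = slide i l"
  by (rule perms_eqI) (simp add: app_uminus_eq_iff, transfer, simp add: slide_fun_inverse)

text \<open>The translations compose exactly, without a finitary correction.  For this reason those out of
  ray 1 generate all others.\<close>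

lemma slide_slide: "slide l j + slide j i = slide l i"
  by (rule perms_eqI) (auto simp: app_slide_cases split: pt.splits nat.splits)

locale houghton_rays =
  fixes n :: nat
  assumes n3: "n \<ge> 3"
begin

definition I :: "nat set" where "I = {1..n}"

lemma one_in_I [simp]: "1 \<in> I"
  using n3 by (simp add: I_def)

text \<open>The place where two rays would not suffice: a translation into ray \<open>i\<close> has to come from a
  ray other than \<open>i\<close> and should leave ray \<open>k\<close> alone.\<close>

lemma third_ray: obtains l where "l \<in> I" "l \<noteq> i" "l \<noteq> k"
proof -
  have "\<exists>l\<in>{1, 2, 3 :: nat}. l \<noteq> i \<and> l \<noteq> k" by auto
  then obtain l where l: "l \<in> {1, 2, 3}" "l \<noteq> i" "l \<noteq> k" by blast
  then have "l \<in> I" using n3 by (auto simp: I_def)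
  then show ?thesis using that l by blast
qed

definition ev :: "nat free_grp \<Rightarrow> pt perms" where
  "ev = free_lift (\<lambda>k. if k = 0 then swap Ctr Aux else if k = 1 then swap Aux (Ray 1 0)
                else if k \<le> n then slide 1 k else 0)"

lemma ev_simps [simp]:
  "ev 0 = 0" "ev (u + v) = ev u + ev v" "ev (- u) = - ev u" "ev (u - v) = ev u - ev v"
  "ev (conj_by u v) = conj_by (ev u) (ev v)"
  by (simp_all add: ev_def)

definition a :: "nat free_grp" where "a = gen 0"
definition b :: "nat free_grp" where "b = gen 1"
text \<open>The translation of ray 1 into itself is the identity, so that all rays can be treated alike.\<close>

definition t :: "nat \<Rightarrow> nat free_grp" where "t k = (if k = 1 then 0 else gen k)"
definition slide_word :: "nat \<Rightarrow> nat \<Rightarrow> nat free_grp" where "slide_word l i = - t l + t i"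

lemma ev_gens [simp]:
  "ev a = swap Ctr Aux" "ev b = swap Aux (Ray 1 0)" "k \<in> I \<Longrightarrow> ev (t k) = slide 1 k"
  by (auto simp: ev_def a_def b_def t_def I_def)

lemma ev_slide_word [simp]: "l \<in> I \<Longrightarrow> i \<in> I \<Longrightarrow> ev (slide_word l i) = slide l i"
  using slide_slide[of l 1 i] by (simp add: slide_word_def)

text \<open>Every true relation of bounded length is a relator.  The bound 40 accommodates the longest
  relation that is used below.\<close>

definition relators :: "nat word set" where
  "relators = {w \<in> words {0..n}. length w \<le> 40 \<and> ev (elt w) = 0}"

abbreviation hom_eq ("(_ /\<approx>[_] _)" [51, 0, 51] 50) where
  "u \<approx>[N] v \<equiv> homotopic (elt ` relators) N u v"

definition short :: "nat \<Rightarrow> nat free_grp \<Rightarrow> bool" where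
  "short k g \<longleftrightarrow> (\<exists>w\<in>words {0..n}. length w \<le> k \<and> elt w = g)"

lemma short_intros:
  "short 1 a" "short 1 b" "k \<in> I \<Longrightarrow> short 1 (t k)" "short 0 0"
  "short p u \<Longrightarrow> short q v \<Longrightarrow> short (p + q) (u + v)"
  "short p u \<Longrightarrow> short p (- u)"
proof -
  show "short 1 a" unfolding short_def
    by (rule bexI[of _ "[(0, True)]"]) (auto simp: a_def gen_def)
  show "short 1 b" unfolding short_def
    using n3 by (intro bexI[of _ "[(1, True)]"]) (auto simp: b_def gen_def)
  show "short 1 (t k)" if "k \<in> I"
  proof (cases "k = 1")
    case True
    then show ?thesis unfolding short_def by (intro bexI[of _ "[]"]) (auto simp: t_def elt_simps)
  next
    case False
    then show ?thesis unfolding short_def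
      using that by (intro bexI[of _ "[(k, True)]"]) (auto simp: t_def gen_def I_def)
  qed
  show "short 0 0" unfolding short_def by (intro bexI[of _ "[]"]) (auto simp: elt_simps)
  show "short (p + q) (u + v)" if u: "short p u" and v: "short q v"
  proof -
    obtain w w' where "w \<in> words {0..n}" "length w \<le> p" "elt w = u"
      "w' \<in> words {0..n}" "length w' \<le> q" "elt w' = v" using u v unfolding short_def by blast
    then show ?thesis unfolding short_def by (intro bexI[of _ "w @ w'"]) (auto simp: elt_simps)
  qed
  show "short p (- u)" if u: "short p u"
  proof -
    obtain w where "w \<in> words {0..n}" "length w \<le> p" "elt w = u" using u unfolding short_def by blast
    then show ?thesis unfolding short_def by (intro bexI[of _ "inv_word w"]) (auto simp: elt_simps)
  qed
qed

lemma short_conj_by: "short p x \<Longrightarrow> short q u \<Longrightarrow> short (q + p + q) (conj_by x u)"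
  unfolding conj_by_def by (intro short_intros)

lemma short_slide_word: "l \<in> I \<Longrightarrow> i \<in> I \<Longrightarrow> short 2 (slide_word l i)"
  using short_intros(5)[OF short_intros(6)[OF short_intros(3)] short_intros(3), of l i] by (simp add: slide_word_def)

lemma relator_step:
  assumes "short p u" "short q v" "ev u = ev v" "p + q \<le> 40"
  shows "u \<approx>[1] v"
proof -
  obtain x y where x: "x \<in> words {0..n}" "length x \<le> p" "elt x = u"
    and y: "y \<in> words {0..n}" "length y \<le> q" "elt y = v"
    using assms(1,2) unfolding short_def by blast
  have "x @ inv_word y \<in> relators"
    using x y assms(3,4) by (auto simp: relators_def elt_simps)
  then have "area_le (elt ` relators) 1 (elt (x @ inv_word y))" by (intro area_le_relator) auto
  then show ?thesis using x y by (simp add: homotopic_def elt_simps)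
qed

text \<open>Represents the transposition of the auxiliary point and the first point of ray \<open>k\<close>.\<close>

definition aux_swap :: "nat \<Rightarrow> nat free_grp" where "aux_swap k = conj_by b (t k)"

text \<open>Some ray other than \<open>i\<close>, from which ray \<open>i\<close> is filled.\<close>

definition source :: "nat \<Rightarrow> nat" where "source i = (if i = 1 then 2 else 1)"

lemma source: "source i \<in> I" "source i \<noteq> i" "i \<noteq> source i"
  using n3 by (auto simp: source_def I_def)

fun path_word :: "nat \<Rightarrow> nat \<Rightarrow> nat free_grp" where
  "path_word i 0 = t i"
| "path_word i (Suc p) = path_word i p + slide_word (source i) i"

text \<open>Represents the transposition of the centre and the point at position \<open>p\<close> of ray \<open>i\<close>: the
  conjugate of \<open>b\<close> by \<open>a\<close> exchanges the centre with the first point of ray 1, and \<open>path_word i p\<close>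
  carries that point to position \<open>p\<close> of ray \<open>i\<close>.\<close>

definition ray_star :: "nat \<Rightarrow> nat \<Rightarrow> nat free_grp" where "ray_star i p = conj_by b (a + path_word i p)"

lemma ray_star_Suc: "ray_star i (Suc p) = conj_by (ray_star i p) (slide_word (source i) i)"
  by (simp add: ray_star_def add.assoc)

lemma ev_aux_swap [simp]: "k \<in> I \<Longrightarrow> ev (aux_swap k) = swap Aux (Ray k 0)"
  by (cases "k = 1") (auto simp: aux_swap_def)

lemma app_path_word [simp]:
  assumes "i \<in> I"
  shows "app (ev (path_word i p)) (Ray 1 0) = Ray i p" "app (ev (path_word i p)) Ctr = Ctr" "app (ev (path_word i p)) Aux = Aux"
  using assms source[of i] by (induction p) (auto simp: app_slide_cases)

lemma ev_ray_star [simp]: "i \<in> I \<Longrightarrow> ev (ray_star i p) = swap Ctr (Ray i p)"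
  by (simp add: ray_star_def swap_commute)

lemma short_path_word: "i \<in> I \<Longrightarrow> short (2 * p + 1) (path_word i p)"
proof (induction p)
  case 0
  then show ?case using short_intros(3)[of i] by simp
next
  case (Suc p)
  then show ?case using short_intros(5)[OF Suc.IH short_slide_word[OF source(1)[of i], of i]] by (simp add: algebra_simps)
qed

lemma short_ray_star: "i \<in> I \<Longrightarrow> short ((1 + (2 * p + 1)) + 1 + (1 + (2 * p + 1))) (ray_star i p)"
  unfolding ray_star_def by (intro short_conj_by short_intros short_path_word)

lemma short_aux_swap: "k \<in> I \<Longrightarrow> short 3 (aux_swap k)"
  using short_conj_by[OF short_intros(2) short_intros(3), of k] by (simp add: aux_swap_def)

lemmas shorts = short_ray_star short_aux_swap short_conj_by short_slide_word short_intros

definition ray_cost :: "nat \<Rightarrow> nat" where "ray_cost p = 11 ^ p"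

lemma ray_cost_Suc: "ray_cost (Suc p) = 11 * ray_cost p"
  by (simp add: ray_cost_def)

lemma ray_star_base:
  assumes i: "i \<in> I" and j: "j \<in> I" "j \<noteq> i" and p: "p \<le> 1"
  shows "conj_by (ray_star i p) (slide_word j i) \<approx>[1] ray_star i (Suc p)"
  by (rule relator_step) (rule shorts i j | use i j p in simp)+

lemma ray_star_commutes_base:
  assumes i: "i \<in> I" and k: "k \<in> I"
  shows "conj_by (ray_star i 1) (aux_swap k) \<approx>[1] ray_star i 1"
  by (rule relator_step) (rule shorts i k | use i k in simp)+

text \<open>Represents the transposition of the first points of the rays \<open>i\<close> and \<open>l\<close>.\<close>

definition end_swap :: "nat \<Rightarrow> nat \<Rightarrow> nat free_grp" where "end_swap i l = aux_swap i + aux_swap l + aux_swap i"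

lemma ev_end_swap: "i \<in> I \<Longrightarrow> l \<in> I \<Longrightarrow> i \<noteq> l \<Longrightarrow> ev (end_swap i l) = swap (Ray i 0) (Ray l 0)"
  by (rule perms_eqI) (auto simp: end_swap_def app_swap)

lemma short_end_swap: "i \<in> I \<Longrightarrow> l \<in> I \<Longrightarrow> short 9 (end_swap i l)"
  using short_intros(5)[OF short_intros(5)[OF short_aux_swap short_aux_swap] short_aux_swap, of i l i] by (simp add: end_swap_def)

lemma pt_cases_two_rays:
  obtains "x = Ctr" | "x = Aux" | p where "x = Ray i p" | "x = Ray j 0"
  | p where "x = Ray j (Suc p)" | "x = Ray k 0" | p where "x = Ray k (Suc p)"
  | l p where "x = Ray l p" "l \<noteq> i" "l \<noteq> j" "l \<noteq> k"
proof (cases x)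
  case (Ray l p)
  show ?thesis
  proof (cases "l = i \<or> l \<noteq> j \<and> l \<noteq> k")
    case True
    then show ?thesis using Ray that(3,8) by blast
  next
    case False
    then show ?thesis using Ray that(4-7) by (cases p) blast+
  qed
qed (use that in blast)+

text \<open>The order in which two rays are pushed into a third one matters only for their two first points.\<close>

lemma slides_into_commute:
  assumes "i \<in> I" "j \<in> I" "k \<in> I" "i \<noteq> j" "i \<noteq> k" "j \<noteq> k"
  shows "slide_word k i + slide_word j i \<approx>[1] end_swap k j + slide_word j i + slide_word k i"
proof (rule relator_step)
  show "short (2 + 2) (slide_word k i + slide_word j i)" "short (9 + 2 + 2) (end_swap k j + slide_word j i + slide_word k i)"
    by (intro short_intros short_slide_word short_end_swap assms)+
  have "slide k i + slide j i = swap (Ray k 0) (Ray j 0) + slide j i + slide k i"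
  proof (rule perms_eqI)
    fix x
    show "app (slide k i + slide j i) x = app (swap (Ray k 0) (Ray j 0) + slide j i + slide k i) x"
      by (rule pt_cases_two_rays[where x = x and i = i and j = j and k = k])
        (use assms in \<open>simp_all add: app_swap\<close>)
  qed
  then show "ev (slide_word k i + slide_word j i) = ev (end_swap k j + slide_word j i + slide_word k i)"
    using assms by (simp add: ev_end_swap)
qed simp

text \<open>The translation of ray \<open>l\<close> into ray \<open>i\<close>, preceded by the exchange of the first points of
  the two rays, fixes the first point of every ray other than \<open>l\<close>.\<close>

lemma slide_fix_commute:
  assumes "i \<in> I" "l \<in> I" "k \<in> I" "l \<noteq> i" "l \<noteq> k"
  shows "end_swap i l + slide_word l i + aux_swap k \<approx>[1] aux_swap k + (end_swap i l + slide_word l i)"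
proof (rule relator_step)
  show "short (9 + 2 + 3) (end_swap i l + slide_word l i + aux_swap k)" "short (3 + (9 + 2)) (aux_swap k + (end_swap i l + slide_word l i))"
    by (intro short_intros short_slide_word short_end_swap short_aux_swap assms)+
  have "conj_by (ev (aux_swap k)) (ev (end_swap i l + slide_word l i)) = ev (aux_swap k)"
    using assms by (cases "k = i") (simp_all add: ev_end_swap)
  then show "ev (end_swap i l + slide_word l i + aux_swap k) = ev (aux_swap k + (end_swap i l + slide_word l i))"
    using add_eq_conj_by[of "ev (aux_swap k)" "ev (end_swap i l + slide_word l i)"] by (simp only: ev_simps add.assoc)
qed simp

lemma conj_by_end_swap:
  assumes "x \<in> I" "y \<in> I" "\<And>k. k \<in> I \<Longrightarrow> conj_by (ray_star i p) (aux_swap k) \<approx>[N] ray_star i p"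
  shows "conj_by (ray_star i p) (end_swap x y) \<approx>[3 * N] ray_star i p"
proof -
  have "conj_by (ray_star i p) (end_swap x y) = conj_by (conj_by (conj_by (ray_star i p) (aux_swap x)) (aux_swap y)) (aux_swap x)" by (simp add: end_swap_def)
  also have "\<dots> \<approx>[N] conj_by (conj_by (ray_star i p) (aux_swap y)) (aux_swap x)" by (intro homotopic_conj_by assms)
  also have "conj_by (conj_by (ray_star i p) (aux_swap y)) (aux_swap x) \<approx>[N] conj_by (ray_star i p) (aux_swap x)" by (intro homotopic_conj_by assms)
  also have "conj_by (ray_star i p) (aux_swap x) \<approx>[N] ray_star i p" by (intro homotopic_conj_by assms)
  finally show ?thesis by (rule homotopic_mono) simp
qed

text \<open>The core of the proof.  For the first claim at \<open>p + 1\<close> the last step of the path is exchanged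
  with the new translation; the correction is a transposition of first points, which commutes with
  the star transposition at depth \<open>p\<close> by the second claim.  For the second claim at \<open>p + 1\<close> the
  last step of the path is replaced by a translation out of a third ray, preceded by an exchange
  that makes it fix the first point of ray \<open>k\<close>; the exchange is again absorbed by the second claim
  at depth \<open>p\<close>.  Each step needs at most nine uses of the claims at depth \<open>p\<close> and two relators,
  hence at most \<open>11 * 11 ^ p\<close>.  The second claim fails at \<open>p = 0\<close> if \<open>k = i\<close>.\<close>

lemma ray_star_slide_commute:
  assumes i: "i \<in> I"
  shows "(\<forall>j\<in>I. j \<noteq> i \<longrightarrow> conj_by (ray_star i p) (slide_word j i) \<approx>[ray_cost p] ray_star i (Suc p)) \<and>
    (p \<ge> 1 \<longrightarrow> (\<forall>k\<in>I. conj_by (ray_star i p) (aux_swap k) \<approx>[ray_cost p] ray_star i p))"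
proof (induction p)
  case 0
  then show ?case using ray_star_base[of i _ 0] i by (auto simp: ray_cost_def)
next
  case (Suc p)
  have c1: "ray_cost p \<ge> 1" by (simp add: ray_cost_def)
  show ?case
  proof (cases "p = 0")
    case True
    have "conj_by (ray_star i (Suc 0)) (slide_word j i) \<approx>[ray_cost (Suc 0)] ray_star i (Suc (Suc 0))" if "j \<in> I" "j \<noteq> i" for j
      by (rule homotopic_mono[OF ray_star_base[OF i that]]) (simp_all add: ray_cost_def)
    moreover have "conj_by (ray_star i (Suc 0)) (aux_swap k) \<approx>[ray_cost (Suc 0)] ray_star i (Suc 0)" if "k \<in> I" for k
      by (rule homotopic_mono[OF ray_star_commutes_base[OF i that, unfolded One_nat_def]]) (simp add: ray_cost_def)
    ultimately show ?thesis using True by blast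
  next
    case False
    have L: "conj_by (ray_star i p) (slide_word j i) \<approx>[ray_cost p] ray_star i (Suc p)" if "j \<in> I" "j \<noteq> i" for j
      using Suc that by blast
    have M: "conj_by (ray_star i p) (aux_swap k) \<approx>[ray_cost p] ray_star i p" if "k \<in> I" for k
      using Suc that False by simp
    have L': "conj_by (ray_star i (Suc p)) (slide_word j i) \<approx>[ray_cost (Suc p)] ray_star i (Suc (Suc p))" if j: "j \<in> I" "j \<noteq> i" for j
    proof (cases "j = source i")
      case True
      then show ?thesis using ray_star_Suc[of i "Suc p"] by auto
    next
      case False
      let ?k = "source i"
      have "conj_by (ray_star i (Suc p)) (slide_word j i) = conj_by (ray_star i p) (slide_word ?k i + slide_word j i)"
        by (simp add: ray_star_Suc)
      also have "\<dots> \<approx>[2 * 1] conj_by (ray_star i p) (end_swap ?k j + slide_word j i + slide_word ?k i)"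
        using i j source[of i] False by (intro homotopic_conj_by_right slides_into_commute) auto
      also have "conj_by (ray_star i p) (end_swap ?k j + slide_word j i + slide_word ?k i) = conj_by (conj_by (ray_star i p) (end_swap ?k j)) (slide_word j i + slide_word ?k i)"
        by (simp add: add.assoc)
      also have "\<dots> \<approx>[3 * ray_cost p] conj_by (ray_star i p) (slide_word j i + slide_word ?k i)"
        using j source[of i] by (intro homotopic_conj_by conj_by_end_swap M) auto
      also have "\<dots> = conj_by (conj_by (ray_star i p) (slide_word j i)) (slide_word ?k i)" by simp
      also have "\<dots> \<approx>[ray_cost p] conj_by (ray_star i (Suc p)) (slide_word ?k i)"
        using j by (intro homotopic_conj_by L) auto
      also have "\<dots> = ray_star i (Suc (Suc p))" by (simp add: ray_star_Suc)
      finally show ?thesis by (rule homotopic_mono) (use c1 in \<open>simp add: ray_cost_Suc\<close>)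
    qed
    have M': "conj_by (ray_star i (Suc p)) (aux_swap k) \<approx>[ray_cost (Suc p)] ray_star i (Suc p)" if k: "k \<in> I" for k
    proof -
      obtain l where l: "l \<in> I" "l \<noteq> i" "l \<noteq> k" by (rule third_ray[of i k])
      let ?g = "end_swap i l + slide_word l i"
      have step: "ray_star i (Suc p) \<approx>[ray_cost p + 3 * ray_cost p] conj_by (ray_star i p) ?g"
      proof -
        have "ray_star i (Suc p) \<approx>[ray_cost p] conj_by (ray_star i p) (slide_word l i)" using homotopic_sym[OF L[of l]] l by blast
        also have "conj_by (ray_star i p) (slide_word l i) \<approx>[3 * ray_cost p] conj_by (conj_by (ray_star i p) (end_swap i l)) (slide_word l i)"
          using i l M by (intro homotopic_conj_by homotopic_sym[OF conj_by_end_swap])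
        also have "\<dots> = conj_by (ray_star i p) ?g" by simp
        finally show ?thesis .
      qed
      have "conj_by (ray_star i (Suc p)) (aux_swap k) \<approx>[ray_cost p + 3 * ray_cost p] conj_by (conj_by (ray_star i p) ?g) (aux_swap k)"
        by (intro homotopic_conj_by step)
      also have "\<dots> = conj_by (ray_star i p) (end_swap i l + slide_word l i + aux_swap k)" by simp
      also have "\<dots> \<approx>[2 * 1] conj_by (ray_star i p) (aux_swap k + (end_swap i l + slide_word l i))"
        using i k l by (intro homotopic_conj_by_right slide_fix_commute) auto
      also have "\<dots> = conj_by (conj_by (ray_star i p) (aux_swap k)) ?g" by simp
      also have "\<dots> \<approx>[ray_cost p] conj_by (ray_star i p) ?g" using k by (intro homotopic_conj_by M)
      also have "\<dots> \<approx>[ray_cost p + 3 * ray_cost p] ray_star i (Suc p)" by (rule homotopic_sym[OF step])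
      finally show ?thesis by (rule homotopic_mono) (use c1 in \<open>simp add: ray_cost_Suc\<close>)
    qed
    show ?thesis using L' M' by blast
  qed
qed

end

section \<open>Star transpositions and the symmetric group\<close>

lemma conj_by_conj_by_distrib: "conj_by (conj_by u v) w = conj_by (conj_by u w) (conj_by v w)"
  by (simp add: conj_by_def group_norm del: add_uminus_conv_diff)

lemma add_eq_cj': "u + v = conj_by v (- u) + u"
  by (simp add: conj_by_def group_norm del: add_uminus_conv_diff)

lemma homotopic_conj_by_swap: 
  assumes "homotopic S N (conj_by u v) u" shows "homotopic S N (conj_by v u) v"
proof -
  have "homotopic S N (v + conj_by u v) (v + u)" by (rule homotopic_add_left[OF assms])
  then have "homotopic S N (u + v) (v + u)" by (simp add: add_eq_conj_by[of u v])
  from homotopic_add_left[OF homotopic_sym[OF this], of "- u"] show ?thesis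
    by (simp add: conj_by_def group_norm del: add_uminus_conv_diff)
qed

lemma homotopic_finish: "homotopic S M u v \<Longrightarrow> M \<le> K \<Longrightarrow> u = u' \<Longrightarrow> v = v' \<Longrightarrow> homotopic S K u' v'"
  using homotopic_mono by blast

text \<open>An abstract form of the situation in Houghton's group: \<open>x y\<close> represents the transposition of
  the centre and \<open>y\<close>.  The conjugate of \<open>x z\<close> by \<open>x aux\<close> represents the transposition of the
  auxiliary point and \<open>z\<close>, and \<open>move\<close> says that it permutes the star transpositions accordingly.\<close>

locale star_system =
  fixes S :: "'f::group_add set" and N :: nat and ctr aux :: 'p and V :: "'p set"
    and x :: "'p \<Rightarrow> 'f" and e :: "'f \<Rightarrow> 'p perms"
  assumes ctr: "ctr \<notin> V" and aux: "aux \<in> V"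
    and square: "y \<in> V \<Longrightarrow> homotopic S N (x y + x y) 0"
    and move: "y \<in> V \<Longrightarrow> z \<in> V \<Longrightarrow> z \<noteq> aux \<Longrightarrow>
      homotopic S N (conj_by (x y) (conj_by (x z) (- x aux))) (x (app (swap aux z) y))"
    and e_add: "e (u + v) = e u + e v"
    and e_homotopic: "homotopic S M u v \<Longrightarrow> e u = e v"
    and e_x: "y \<in> V \<Longrightarrow> e (x y) = swap ctr y"
begin

lemma e_simps [simp]: "e 0 = 0" "e (u + v) = e u + e v" "e (- u) = - e u" "e (conj_by u v) = conj_by (e u) (e v)"
proof -
  have "e 0 + e 0 = e 0 + 0" using e_add[of 0 0] by simp
  then show z: "e 0 = 0" by (rule add_left_imp_eq)
  show p: "e (u + v) = e u + e v" for u v by (rule e_add)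
  show m: "e (- u) = - e u" for u
    using p[of "- u" u] z by (simp add: eq_neg_iff_add_eq_0)
  show "e (conj_by u v) = conj_by (e u) (e v)" by (simp add: conj_by_def p m del: add_uminus_conv_diff)
qed

lemma uminus_x: "y \<in> V \<Longrightarrow> homotopic S N (- x y) (x y)"
  using homotopic_add_left[OF square, of y "- x y"] by (simp add: homotopic_sym)

text \<open>Represents the transposition of the auxiliary point and \<open>z\<close>.\<close>

definition x' :: "'p \<Rightarrow> 'f" where "x' z = conj_by (x z) (- x aux)"

lemma conj_by_x'_aux [simp]: "conj_by (x' z) (x aux) = x z"
  by (simp add: x'_def)

lemma commute_x': "y \<in> V \<Longrightarrow> z \<in> V \<Longrightarrow> z \<noteq> aux \<Longrightarrow> y \<noteq> z \<Longrightarrow> y \<noteq> aux \<Longrightarrow> homotopic S N (conj_by (x y) (x' z)) (x y)"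
  using move[of y z] by (simp add: x'_def)

lemma aux_x': "z \<in> V \<Longrightarrow> z \<noteq> aux \<Longrightarrow> homotopic S N (conj_by (x aux) (x' z)) (x z)"
  using move[of aux z] aux by (simp add: x'_def)

lemma conj_by_aux: "homotopic S (2 * N) (conj_by (x y) (x aux)) (x' y)"
  unfolding x'_def by (rule homotopic_conj_by_right[OF homotopic_sym[OF uminus_x[OF aux]]])

lemma conj_by_aux': 
  assumes "z \<in> V" "z \<noteq> aux" shows "homotopic S (3 * N) (conj_by (x aux) (x z)) (x' z)"
proof -
  have "conj_by (x aux) (x' z) = conj_by (conj_by (x aux) (x z)) (- x aux)"
    by (simp add: x'_def conj_by_def group_norm del: add_uminus_conv_diff)
  then have "homotopic S N (conj_by (conj_by (conj_by (x aux) (x z)) (- x aux)) (x aux)) (conj_by (x z) (x aux))"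
    using homotopic_conj_by[OF aux_x'[OF assms], of "x aux"] by simp
  from homotopic_trans[OF this conj_by_aux] show ?thesis by (rule homotopic_finish) auto
qed

text \<open>The transposition of \<open>y\<close> and \<open>z\<close> can be written with the auxiliary point in place of the
  centre, because \<open>x z\<close> is \<open>x aux\<close> conjugated by \<open>x' z\<close> and \<open>x y\<close> commutes with \<open>x' z\<close>.\<close>

lemma conj_by_eq_x': 
  assumes "y \<in> V" "z \<in> V" "y \<noteq> z" "y \<noteq> aux" "z \<noteq> aux"
  shows "homotopic S (5 * N) (conj_by (x y) (x z)) (conj_by (x' y) (x' z))"
proof -
  have "homotopic S (2 * N) (conj_by (x y) (x z)) (conj_by (x y) (conj_by (x aux) (x' z)))"
    by (rule homotopic_conj_by_right[OF homotopic_sym[OF aux_x']]) fact+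
  also have "conj_by (x y) (conj_by (x aux) (x' z)) = conj_by (conj_by (conj_by (x y) (- x' z)) (x aux)) (x' z)"
    by (simp add: conj_by_def group_norm del: add_uminus_conv_diff)
  also have "homotopic S N \<dots> (conj_by (conj_by (x y) (x aux)) (x' z))"
    by (intro homotopic_conj_by homotopic_conj_by_uminus commute_x') fact+
  also have "homotopic S (2 * N) \<dots> (conj_by (x' y) (x' z))"
    by (intro homotopic_conj_by conj_by_aux)
  finally show ?thesis by (rule homotopic_finish) auto
qed

text \<open>Starting the same calculation from \<open>x y\<close> instead of \<open>x z\<close> produces the two factors in the
  opposite order.\<close>

lemma conj_by_eq_x'_flip: 
  assumes "y \<in> V" "z \<in> V" "y \<noteq> z" "y \<noteq> aux" "z \<noteq> aux"
  shows "homotopic S (6 * N) (conj_by (x y) (x z)) (conj_by (x' z) (x' y))"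
proof -
  have c: "homotopic S N (x' y + x z) (x z + x' y)"
    using homotopic_add_left[OF homotopic_sym[OF commute_x'[of z y]], of "x' y"] assms
    by (simp add: add_eq_conj_by[of "x z" "x' y"])
  have "homotopic S N (conj_by (x y) (x z)) (conj_by (conj_by (x aux) (x' y)) (x z))"
    by (intro homotopic_conj_by homotopic_sym[OF aux_x']) fact+
  also have "\<dots> = conj_by (x aux) (x' y + x z)" by simp
  also have "homotopic S (2 * N) \<dots> (conj_by (x aux) (x z + x' y))"
    by (rule homotopic_conj_by_right[OF c])
  also have "\<dots> = conj_by (conj_by (x aux) (x z)) (x' y)" by simp
  also have "homotopic S (3 * N) \<dots> (conj_by (x' z) (x' y))"
    by (intro homotopic_conj_by conj_by_aux') fact+
  finally show ?thesis by (rule homotopic_finish) auto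
qed

text \<open>The braid relation between two star transpositions.  Away from the auxiliary point the two
  previous lemmas rewrite both sides to the same word.\<close>

lemma conj_by_x_sym: 
  assumes "y \<in> V" "z \<in> V"
  shows "homotopic S (11 * N) (conj_by (x y) (x z)) (conj_by (x z) (x y))"
proof -
  have aux_case: "homotopic S (11 * N) (conj_by (x aux) (x z)) (conj_by (x z) (x aux))" if "z \<in> V" "z \<noteq> aux" for z
    using homotopic_trans[OF conj_by_aux'[OF that] homotopic_sym[OF conj_by_aux]] by (rule homotopic_finish) auto
  consider "y = z" | "y \<noteq> z" "y = aux" | "y \<noteq> z" "z = aux" | "y \<noteq> z" "y \<noteq> aux" "z \<noteq> aux" by blast
  then show ?thesis
  proof cases
    case 4
    then show ?thesis
      by (intro homotopic_finish[OF homotopic_trans[OF conj_by_eq_x'_flip[of y z] homotopic_sym[OF conj_by_eq_x'[of z y]]]])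
        (use assms in auto)
  next
    case 3
    then show ?thesis using homotopic_sym[OF aux_case[of y]] assms by simp
  qed (use assms aux_case in auto)
qed

text \<open>Written with the auxiliary point, the transposition of \<open>y\<close> and \<open>z\<close> is a product of elements
  each of which commutes with \<open>x w\<close>, unless \<open>w\<close> is itself the auxiliary point; then conjugation
  turns that word back into the original one.\<close>

lemma conj_by_x_commute:
  assumes "w \<in> V" "y \<in> V" "z \<in> V" "w \<noteq> y" "w \<noteq> z" "y \<noteq> z"
  shows "homotopic S (13 * N) (conj_by (conj_by (x y) (x z)) (x w)) (conj_by (x y) (x z))"
proof -
  have conj: "homotopic S (M + L + M) (conj_by u (x w)) u"
    if "homotopic S M u v" "homotopic S L (conj_by v (x w)) v" for u v M L
    using homotopic_trans[OF homotopic_trans[OF homotopic_conj_by[OF that(1)] that(2)] homotopic_sym[OF that(1)]] .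
  consider "w = aux" | "w \<noteq> aux" "y = aux" | "w \<noteq> aux" "z = aux" | "w \<noteq> aux" "y \<noteq> aux" "z \<noteq> aux" by blast
  then show ?thesis
  proof cases
    case 1
    have "homotopic S (5 * N) (conj_by (conj_by (x y) (x z)) (x aux)) (conj_by (conj_by (x' y) (x' z)) (x aux))"
      using 1 assms by (intro homotopic_conj_by conj_by_eq_x') auto
    also have "\<dots> = conj_by (conj_by (x' y) (x aux)) (conj_by (x' z) (x aux))" by (rule conj_by_conj_by_distrib)
    also have "\<dots> = conj_by (x y) (x z)" by (simp only: conj_by_x'_aux)
    finally show ?thesis by (rule homotopic_finish) (use 1 in auto)
  next
    case 2
    have "homotopic S (3 * N + N + 3 * N) (conj_by (conj_by (x aux) (x z)) (x w)) (conj_by (x aux) (x z))"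
      using 2 assms by (intro conj[OF conj_by_aux' homotopic_conj_by_swap[OF commute_x']]) auto
    then show ?thesis by (rule homotopic_finish) (use 2 in auto)
  next
    case 3
    have "homotopic S (2 * N + N + 2 * N) (conj_by (conj_by (x y) (x aux)) (x w)) (conj_by (x y) (x aux))"
      using 3 assms by (intro conj[OF conj_by_aux homotopic_conj_by_swap[OF commute_x']]) auto
    then show ?thesis by (rule homotopic_finish) (use 3 in auto)
  next
    case 4
    have "conj_by (x w) (conj_by (x' y) (x' z)) = conj_by (conj_by (conj_by (x w) (- x' z)) (x' y)) (x' z)"
      by (simp add: conj_by_def group_norm del: add_uminus_conv_diff)
    also have "homotopic S N \<dots> (conj_by (conj_by (x w) (x' y)) (x' z))"
      using 4 assms by (intro homotopic_conj_by homotopic_conj_by_uminus commute_x') auto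
    also have "homotopic S N \<dots> (conj_by (x w) (x' z))"
      using 4 assms by (intro homotopic_conj_by commute_x') auto
    also have "homotopic S N \<dots> (x w)"
      using 4 assms by (intro commute_x') auto
    finally have "homotopic S (N + N + N) (conj_by (x w) (conj_by (x' y) (x' z))) (x w)" .
    from homotopic_conj_by_swap[OF this] have "homotopic S (5 * N + (N + N + N) + 5 * N) (conj_by (conj_by (x y) (x z)) (x w)) (conj_by (x y) (x z))"
      using 4 assms by (intro conj[OF conj_by_eq_x']) auto
    then show ?thesis by (rule homotopic_finish) auto
  qed
qed

definition Y :: "'p set" where "Y = insert ctr V"

definition tau :: "'p \<Rightarrow> 'p \<Rightarrow> 'f" where
  "tau u v = (if u = ctr then x v else if v = ctr then x u else conj_by (x u) (x v))"

lemma tau_sym: "u \<in> Y \<Longrightarrow> v \<in> Y \<Longrightarrow> homotopic S (11 * N) (tau u v) (tau v u)"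
  using conj_by_x_sym[of u v] by (auto simp: tau_def Y_def)

lemma e_tau: "u \<in> Y \<Longrightarrow> v \<in> Y \<Longrightarrow> u \<noteq> v \<Longrightarrow> e (tau u v) = swap u v"
  using ctr by (auto simp: tau_def Y_def e_x swap_commute app_swap)

lemma tau_square: "u \<in> Y \<Longrightarrow> v \<in> Y \<Longrightarrow> u \<noteq> v \<Longrightarrow> homotopic S N (tau u v + tau u v) 0"
proof -
  have "homotopic S N (conj_by (x u) (x v) + conj_by (x u) (x v)) 0" if "u \<in> V" for u v
    using homotopic_conj_by[OF square[OF that], of "x v"] by (simp add: conj_by_def group_norm del: add_uminus_conv_diff)
  then show "u \<in> Y \<Longrightarrow> v \<in> Y \<Longrightarrow> u \<noteq> v \<Longrightarrow> ?thesis" using square by (auto simp: tau_def Y_def)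
qed

lemma uminus_tau: "u \<in> Y \<Longrightarrow> v \<in> Y \<Longrightarrow> u \<noteq> v \<Longrightarrow> homotopic S N (- tau u v) (tau u v)"
  using homotopic_add_left[OF tau_square, of u v "- tau u v"] by (simp add: homotopic_sym)

lemma conj_by_tau_x:
  assumes "u \<in> Y" "v \<in> Y" "u \<noteq> v" "w \<in> V"
  shows "homotopic S (13 * N) (conj_by (tau u v) (x w)) (tau (app (swap ctr w) u) (app (swap ctr w) v))"
proof -
  have w: "w \<noteq> ctr" using assms ctr by auto
  have sq: "homotopic S (2 * N) (conj_by (conj_by (x u) (x v)) (x v)) (x u)" if "v \<in> V" for u v
    using homotopic_conj_by_right[OF square[OF that], of "x u"] by simp
  consider "u = ctr" "v = w" | "u = ctr" "v \<noteq> w" | "v = ctr" "u = w" | "v = ctr" "u \<noteq> w"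
    | "u \<noteq> ctr" "v \<noteq> ctr" "w = v" | "u \<noteq> ctr" "v \<noteq> ctr" "w = u"
    | "u \<noteq> ctr" "v \<noteq> ctr" "w \<noteq> u" "w \<noteq> v" by blast
  then show ?thesis
  proof cases
    case 1
    then show ?thesis using w by (simp add: tau_def conj_by_def)
  next
    case 2
    then have "v \<in> V" using assms by (auto simp: Y_def)
    from conj_by_x_sym[OF this assms(4)] show ?thesis
      by (rule homotopic_finish) (use 2 w assms ctr in \<open>auto simp: tau_def Y_def\<close>)
  next
    case 3
    then show ?thesis using w by (simp add: tau_def conj_by_def)
  next
    case 4
    then show ?thesis using w assms by (auto simp: tau_def Y_def)
  next
    case 5
    then have "v \<in> V" using assms by (auto simp: Y_def)
    from sq[OF this, of u] show ?thesis
      by (rule homotopic_finish) (use 5 w assms in \<open>auto simp: tau_def Y_def\<close>)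
  next
    case 6
    have "homotopic S (11 * N) (conj_by (conj_by (x u) (x v)) (x u)) (conj_by (conj_by (x v) (x u)) (x u))"
      using 6 assms by (intro homotopic_conj_by conj_by_x_sym) (auto simp: Y_def)
    also have "homotopic S (2 * N) \<dots> (x v)" using 6 assms by (intro sq) auto
    finally show ?thesis
      by (rule homotopic_finish) (use 6 w assms in \<open>auto simp: tau_def Y_def\<close>)
  next
    case 7
    then show ?thesis using w assms conj_by_x_commute[of w u v] by (auto simp: tau_def Y_def)
  qed
qed

lemma swap_closed: "u \<in> Y \<Longrightarrow> y \<in> Y \<Longrightarrow> z \<in> Y \<Longrightarrow> app (swap y z) u \<in> Y"
  by (auto simp: app_swap)

text \<open>A transposition is a product of at most three star transpositions, so it is enough to conjugate by these.\<close>

lemma conj_by_tau_tau: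
  assumes "u \<in> Y" "v \<in> Y" "u \<noteq> v" "y \<in> Y" "z \<in> Y" "y \<noteq> z"
  shows "homotopic S (41 * N) (conj_by (tau u v) (tau y z)) (tau (app (swap y z) u) (app (swap y z) v))"
proof (cases "y = ctr \<or> z = ctr")
  case True
  then obtain w where w: "w \<in> V" "tau y z = x w" "swap y z = swap ctr w"
    using assms by (auto simp: tau_def Y_def swap_commute[of y ctr])
  from conj_by_tau_x[OF assms(1-3) w(1)] show ?thesis
    by (rule homotopic_finish) (auto simp: w)
next
  case False
  then have yz: "y \<in> V" "z \<in> V" using assms by (auto simp: Y_def)
  let ?s = "\<lambda>w. app (swap ctr w)"
  have cl: "?s w u \<in> Y" if "w \<in> V" "u \<in> Y" for w u
    using that by (intro swap_closed) (auto simp: Y_def)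
  have s3: "?s z (?s y (?s z w)) = app (swap y z) w" for w
    using False assms(6) by (auto simp: app_swap)
  \<comment> \<open>Up to the sign of one involution, \<open>tau y z\<close> is a palindrome of star transpositions.\<close>
  have "homotopic S (2 * N) (conj_by (tau u v) (tau y z)) (conj_by (tau u v) (x z + x y + x z))"
    using False yz unfolding tau_def[of y z] conj_by_def[of "x y"]
    by (auto intro!: homotopic_conj_by_right homotopic_add_right uminus_x)
  also have "\<dots> = conj_by (conj_by (conj_by (tau u v) (x z)) (x y)) (x z)" by (simp add: add.assoc)
  also have "homotopic S (13 * N) \<dots> (conj_by (conj_by (tau (?s z u) (?s z v)) (x y)) (x z))"
    using assms yz by (intro homotopic_conj_by conj_by_tau_x) auto
  also have "homotopic S (13 * N) \<dots> (conj_by (tau (?s y (?s z u)) (?s y (?s z v))) (x z))"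
    using assms yz by (intro homotopic_conj_by conj_by_tau_x cl) auto
  also have "homotopic S (13 * N) \<dots> (tau (?s z (?s y (?s z u))) (?s z (?s y (?s z v))))"
    using assms yz by (intro conj_by_tau_x cl) auto
  finally show ?thesis by (rule homotopic_finish) (auto simp: s3)
qed

section \<open>Relations between transpositions\<close>

definition W :: "('p \<times> 'p) list \<Rightarrow> 'f" where "W ts = sum_list (map (\<lambda>(u, v). tau u v) ts)"

lemma W_simps [simp]: "W [] = 0" "W ((u, v) # ts) = tau u v + W ts"
  by (simp_all add: W_def)

definition transps :: "'p set \<Rightarrow> ('p \<times> 'p) set" where
  "transps Q = {(u, v). u \<in> Q \<and> v \<in> Q \<and> u \<noteq> v}"

text \<open>All transpositions involving \<open>p\<close> are moved to the front.  Two of them merge into at most one such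
  transposition and one that avoids \<open>p\<close>, so the list never gets longer.\<close>

lemma pull_point:
  assumes "Q \<subseteq> Y" "p \<in> Y" "p \<notin> Q" "set ts \<subseteq> transps (insert p Q)"
  shows "\<exists>ts' P. set ts' \<subseteq> transps Q \<and> length ts' \<le> length ts \<and> (P = 0 \<or> (\<exists>q\<in>Q. P = tau p q)) \<and>
    homotopic S (60 * N * length ts) (W ts) (P + W ts')"
  using assms(4)
proof (induction ts)
  case Nil
  then show ?case by (intro exI[of _ "[]"] exI[of _ 0]) auto
next
  case (Cons \<tau> ts)
  obtain r s where \<tau>: "\<tau> = (r, s)" by force
  have rs: "r \<in> insert p Q" "s \<in> insert p Q" "r \<noteq> s" using Cons.prems \<tau> by (auto simp: transps_def)
  obtain ts' P where IH: "set ts' \<subseteq> transps Q" "length ts' \<le> length ts" "P = 0 \<or> (\<exists>q\<in>Q. P = tau p q)"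
    "homotopic S (60 * N * length ts) (W ts) (P + W ts')" using Cons by auto
  have step: "homotopic S (60 * N * length ts) (W (\<tau> # ts)) (tau r s + P + W ts')"
    using homotopic_add_left[OF IH(4), of "tau r s"] by (simp add: \<tau> add.assoc)
  \<comment> \<open>Absorbs a leading transposition of \<open>p\<close> and \<open>s\<close> into the front part \<open>P\<close>.\<close>
  have merge: "\<exists>ts'' P'. set ts'' \<subseteq> transps Q \<and> length ts'' \<le> Suc (length ts') \<and>
      (P' = 0 \<or> (\<exists>q\<in>Q. P' = tau p q)) \<and> homotopic S (43 * N) (tau p s + P + W ts') (P' + W ts'')"
    if s: "s \<in> Q" for s
    using IH(3)
  proof (elim disjE bexE)
    assume "P = 0"
    then show ?thesis using IH(1) s by (intro exI[of _ ts'] exI[of _ "tau p s"]) auto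
  next
    fix q assume q: "q \<in> Q" "P = tau p q"
    show ?thesis
    proof (cases "s = q")
      case True
      have "homotopic S N (tau p s + P + W ts') (0 + W ts')"
        using q True assms by (intro homotopic_add_right) (auto intro!: tau_square)
      then have "homotopic S (43 * N) (tau p s + P + W ts') (0 + W ts')"
        by (rule homotopic_mono) auto
      then show ?thesis using IH(1) by (intro exI[of _ ts'] exI[of _ 0]) auto
    next
      case False
      have "homotopic S (41 * N) (conj_by (tau p s) (tau p q)) (tau (app (swap p q) p) (app (swap p q) s))"
        using s q assms by (intro conj_by_tau_tau) auto
      also have "app (swap p q) p = q" by simp
      also have "app (swap p q) s = s" using s q False assms by (auto simp: app_swap)
      finally have "homotopic S (41 * N) (tau p q + conj_by (tau p s) (tau p q) + W ts') (tau p q + tau q s + W ts')"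
        by (intro homotopic_add_right homotopic_add_left)
      then have "homotopic S (43 * N) (tau p s + P + W ts') (tau p q + W ((q, s) # ts'))"
        by (rule homotopic_finish) (auto simp: q(2) add_eq_conj_by[of "tau p s" "tau p q"] add.assoc)
      moreover have "set ((q, s) # ts') \<subseteq> transps Q" using IH(1) q s False by (auto simp: transps_def)
      ultimately show ?thesis using q
        by (intro exI[of _ "(q, s) # ts'"] exI[of _ "tau p q"]) auto
    qed
  qed
  have "\<exists>ts'' P'. set ts'' \<subseteq> transps Q \<and> length ts'' \<le> Suc (length ts') \<and>
      (P' = 0 \<or> (\<exists>q\<in>Q. P' = tau p q)) \<and> homotopic S (60 * N) (tau r s + P + W ts') (P' + W ts'')"
  proof -
    consider "r = p" "s \<in> Q" | "s = p" "r \<in> Q" | "r \<in> Q" "s \<in> Q" using rs by auto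
    then show ?thesis
    proof cases
      case 1
      obtain ts'' P' where m: "set ts'' \<subseteq> transps Q" "length ts'' \<le> Suc (length ts')"
        "P' = 0 \<or> (\<exists>q\<in>Q. P' = tau p q)" "homotopic S (43 * N) (tau p s + P + W ts') (P' + W ts'')"
        using merge[of s] 1 by blast
      from m(4) have "homotopic S (60 * N) (tau r s + P + W ts') (P' + W ts'')"
        by (rule homotopic_finish) (auto simp: 1)
      then show ?thesis using m by blast
    next
      case 2
      obtain ts'' P' where m: "set ts'' \<subseteq> transps Q" "length ts'' \<le> Suc (length ts')"
        "P' = 0 \<or> (\<exists>q\<in>Q. P' = tau p q)" "homotopic S (43 * N) (tau p r + P + W ts') (P' + W ts'')"
        using merge[of r] 2 by blast
      have "homotopic S (11 * N) (tau r s + P + W ts') (tau p r + P + W ts')"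
        using 2 assms by (intro homotopic_add_right) (auto intro: tau_sym)
      from homotopic_trans[OF this m(4)] have "homotopic S (60 * N) (tau r s + P + W ts') (P' + W ts'')"
        by (rule homotopic_finish) auto
      then show ?thesis using m by blast
    next
      case 3
      from IH(3) show ?thesis
      proof (elim disjE bexE)
        assume "P = 0"
        then show ?thesis using IH(1) 3 rs
          by (intro exI[of _ "(r, s) # ts'"] exI[of _ 0]) (auto simp: transps_def)
      next
        fix q assume q: "q \<in> Q" "P = tau p q"
        have Y: "r \<in> Y" "s \<in> Y" "q \<in> Y" "p \<in> Y" "p \<noteq> q" using 3 q assms by auto
        have "tau r s + P = conj_by (tau p q) (- tau r s) + tau r s" using q add_eq_cj' by auto
        also have "homotopic S (2 * N) \<dots> (conj_by (tau p q) (tau r s) + tau r s)"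
          using Y rs by (intro homotopic_add_right homotopic_conj_by_right uminus_tau) auto
        also have "homotopic S (41 * N) \<dots> (tau (app (swap r s) p) (app (swap r s) q) + tau r s)"
          using Y rs by (intro homotopic_add_right conj_by_tau_tau) auto
        also have "app (swap r s) p = p" using 3 assms by (auto simp: app_swap)
        finally have "homotopic S (60 * N) (tau r s + P) (tau p (app (swap r s) q) + tau r s)"
          by (rule homotopic_mono) auto
        then have "homotopic S (60 * N) (tau r s + P + W ts') (tau p (app (swap r s) q) + tau r s + W ts')"
          by (rule homotopic_add_right)
        moreover have "app (swap r s) q \<in> Q" using 3 q by (auto simp: app_swap)
        ultimately show ?thesis using IH(1) 3 rs
          by (intro exI[of _ "(r, s) # ts'"] exI[of _ "tau p (app (swap r s) q)"]) (auto simp: transps_def add.assoc)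
      qed
    qed
  qed
  then obtain ts'' P' where f: "set ts'' \<subseteq> transps Q" "length ts'' \<le> Suc (length ts')"
    "P' = 0 \<or> (\<exists>q\<in>Q. P' = tau p q)" "homotopic S (60 * N) (tau r s + P + W ts') (P' + W ts'')" by blast
  have "homotopic S (60 * N * length (\<tau> # ts)) (W (\<tau> # ts)) (P' + W ts'')"
    using homotopic_trans[OF step f(4)] by (rule homotopic_finish) auto
  then show ?case using f IH(2) by (intro exI[of _ ts''] exI[of _ P']) auto
qed

lemma e_W_fixes: "set ts \<subseteq> transps Q \<Longrightarrow> Q \<subseteq> Y \<Longrightarrow> p \<notin> Q \<Longrightarrow> app (e (W ts)) p = p"
proof (induction ts)
  case (Cons \<tau> ts)
  obtain r s where \<tau>: "\<tau> = (r, s)" by force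
  have "r \<in> Q" "s \<in> Q" "r \<noteq> s" using Cons.prems \<tau> by (auto simp: transps_def)
  then have "e (tau r s) = swap r s" "p \<noteq> r" "p \<noteq> s" using Cons.prems by (auto intro: e_tau)
  then show ?case using Cons \<tau> by simp
qed simp

text \<open>Points are eliminated one at a time.  After pulling \<open>p\<close> to the front no transposition involving
  \<open>p\<close> can be left, since a trivial permutation fixes \<open>p\<close>.  The cost is linear in the number of
  points and in the length because the number of transpositions does not grow.\<close>

lemma transpositions_area:
  assumes "finite Q" "Q \<subseteq> Y" "set ts \<subseteq> transps Q" "e (W ts) = 0"
  shows "homotopic S (60 * N * length ts * card Q) (W ts) 0"
  using assms
proof (induction Q arbitrary: ts rule: finite_induct)
  case empty
  then have "ts = []" by (auto simp: transps_def)
  then show ?case by simp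
next
  case (insert p Q)
  obtain ts' P where p: "set ts' \<subseteq> transps Q" "length ts' \<le> length ts" "P = 0 \<or> (\<exists>q\<in>Q. P = tau p q)"
    "homotopic S (60 * N * length ts) (W ts) (P + W ts')"
    using pull_point[of Q p ts] insert by auto
  have z: "e P + e (W ts') = 0" using e_homotopic[OF p(4)] insert.prems(3) by simp
  have "P = 0"
  proof (rule ccontr)
    assume "P \<noteq> 0"
    then obtain q where q: "q \<in> Q" "P = tau p q" using p(3) by blast
    then have "e P = swap p q" using insert by (auto intro: e_tau)
    then have "app (e (W ts')) q = p" using arg_cong[OF z, of "\<lambda>g. app g p"] by simp
    also have "p = app (e (W ts')) p" using e_W_fixes[OF p(1), of p] insert by simp
    finally have "q = p" by (simp only: app_eq_iff)
    then show False using insert.hyps q by simp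
  qed
  then have "homotopic S (60 * N * length ts' * card Q) (W ts') 0"
    using insert z p(1) by (intro insert.IH) auto
  then have "homotopic S (60 * N * length ts * card Q) (W ts') 0"
    by (rule homotopic_mono) (use p(2) in auto)
  from homotopic_trans[OF p(4)[unfolded \<open>P = 0\<close> add_0_left] this] show ?case
    by (rule homotopic_finish) (use insert in auto)
qed

end

section \<open>Moving star transpositions\<close>

context houghton_rays
begin

fun star :: "pt \<Rightarrow> nat free_grp" where
  "star Ctr = 0" | "star Aux = a" | "star (Ray i p) = ray_star i p"

fun radius :: "pt \<Rightarrow> nat" where
  "radius (Ray i p) = p" | "radius _ = 0"

definition ball :: "nat \<Rightarrow> pt set" where
  "ball r = {y. (y = Aux \<or> (\<exists>i p. y = Ray i p \<and> i \<in> I)) \<and> radius y \<le> r}"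

lemma ball_simps [simp]: "Ctr \<notin> ball r" "Aux \<in> ball r" "Ray i p \<in> ball r \<longleftrightarrow> i \<in> I \<and> p \<le> r"
  by (auto simp: ball_def)

lemma ball_mono: "r \<le> s \<Longrightarrow> ball r \<subseteq> ball s"
  by (auto simp: ball_def)

lemma ball_cases [consumes 1, case_names Aux Ray]:
  assumes "y \<in> ball r" obtains "y = Aux" | i p where "y = Ray i p" "i \<in> I" "p \<le> r"
  using assms by (auto simp: ball_def)

lemma ev_star [simp]: "y \<in> ball r \<Longrightarrow> ev (star y) = swap Ctr y"
  by (erule ball_cases) auto

definition letter_cost :: "nat \<Rightarrow> nat" where "letter_cost r = 2 * ray_cost (Suc r)"

lemma ray_cost_mono: "p \<le> q \<Longrightarrow> ray_cost p \<le> ray_cost q"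
  by (simp add: ray_cost_def)

lemma letter_cost_mono: "p \<le> q \<Longrightarrow> letter_cost p \<le> letter_cost q"
  by (simp add: letter_cost_def ray_cost_mono)

lemma letter_cost_pos: "1 \<le> letter_cost p"
  using one_le_power[of "11::nat" "Suc p"] unfolding letter_cost_def ray_cost_def by linarith

text \<open>Conjugation by \<open>g\<close> permutes the star transpositions as the permutation
  represented by \<open>g\<close> permutes the points.  The number \<open>m\<close> bounds the word length of
  \<open>g\<close>: it limits how far points move, and the cost is charged at the largest depth reached.\<close>

definition moves_stars1 :: "nat \<Rightarrow> nat free_grp \<Rightarrow> bool" where
  "moves_stars1 m g \<longleftrightarrow> (\<forall>r. \<forall>y\<in>ball r. app (ev g) y \<in> ball (r + m) \<and>
      conj_by (star y) g \<approx>[m * letter_cost (r + m)] star (app (ev g) y))"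

definition moves_stars :: "nat \<Rightarrow> nat free_grp \<Rightarrow> bool" where
  "moves_stars m g \<longleftrightarrow> moves_stars1 m g \<and> moves_stars1 m (- g)"

lemma moves_stars1_add: assumes "moves_stars1 m g" "moves_stars1 k h" shows "moves_stars1 (m + k) (g + h)"
  unfolding moves_stars1_def
proof (intro allI ballI conjI)
  fix r y assume y: "y \<in> ball r"
  have g: "app (ev g) y \<in> ball (r + m)" "conj_by (star y) g \<approx>[m * letter_cost (r + m)] star (app (ev g) y)"
    using assms(1) y unfolding moves_stars1_def by auto
  have h: "app (ev h) (app (ev g) y) \<in> ball (r + m + k)"
    "conj_by (star (app (ev g) y)) h \<approx>[k * letter_cost (r + m + k)] star (app (ev h) (app (ev g) y))"
    using assms(2) g(1) unfolding moves_stars1_def by auto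
  show "app (ev (g + h)) y \<in> ball (r + (m + k))" using h by (simp add: add.assoc)
  have "m * letter_cost (r + m) \<le> m * letter_cost (r + m + k)" by (simp add: letter_cost_mono)
  then have "m * letter_cost (r + m) + k * letter_cost (r + m + k) \<le> (m + k) * letter_cost (r + (m + k))"
    by (simp add: algebra_simps)
  from homotopic_mono[OF homotopic_trans[OF homotopic_conj_by[OF g(2), of h] h(2)] this]
  show "conj_by (star y) (g + h) \<approx>[(m + k) * letter_cost (r + (m + k))] star (app (ev (g + h)) y)"
    by simp
qed

lemma moves_stars_add: "moves_stars m g \<Longrightarrow> moves_stars k h \<Longrightarrow> moves_stars (m + k) (g + h)"
  unfolding moves_stars_def using moves_stars1_add[of m g k h] moves_stars1_add[of k "- h" m "- g"]
  by (simp add: minus_add add.commute[of k m] del: add_uminus_conv_diff)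

lemma moves_stars_uminus: "moves_stars m g \<Longrightarrow> moves_stars m (- g)"
  by (simp add: moves_stars_def)

lemma moves_stars_zero: "moves_stars m 0"
  using ball_mono[OF le_add1] by (auto simp: moves_stars_def moves_stars1_def subset_iff)

text \<open>The inverse of a letter comes for free: its action at depth \<open>r\<close> is that of the letter at a point of
  depth at most \<open>r + 1\<close>, read backwards.\<close>

lemma moves_stars_letter:
  assumes "\<And>r y. y \<in> ball r \<Longrightarrow> app (ev g) y \<in> ball (Suc r)"
    and "\<And>r y. y \<in> ball r \<Longrightarrow> app (- ev g) y \<in> ball (Suc r)"
    and "\<And>r y. y \<in> ball r \<Longrightarrow> conj_by (star y) g \<approx>[letter_cost r] star (app (ev g) y)"
  shows "moves_stars 1 g"
  unfolding moves_stars_def moves_stars1_def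
proof (intro allI ballI conjI)
  fix r y assume y: "y \<in> ball r"
  show "app (ev g) y \<in> ball (r + 1)" "app (ev (- g)) y \<in> ball (r + 1)" using assms(1,2)[OF y] by (simp_all add: One_nat_def)
  show "conj_by (star y) g \<approx>[1 * letter_cost (r + 1)] star (app (ev g) y)"
    by (rule homotopic_mono[OF assms(3)[OF y]]) (simp add: letter_cost_mono)
  have "conj_by (star (app (- ev g) y)) g \<approx>[letter_cost (Suc r)] star y"
    using assms(3)[OF assms(2)[OF y]] by simp
  from homotopic_conj_by_uminus[OF this]
  show "conj_by (star y) (- g) \<approx>[1 * letter_cost (r + 1)] star (app (ev (- g)) y)" by (simp add: One_nat_def)
qed

lemma slide_slide_eq_t: "slide_word 1 i + slide_word i k = t k"
  by (simp add: slide_word_def t_def add.assoc)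

lemma slide_word_one: "slide_word 1 k = t k" "slide_word k 1 = - t k"
  by (simp_all add: slide_word_def t_def)

lemma slide_word_uminus: "- slide_word l i = slide_word i l"
  by (simp add: slide_word_def minus_add del: add_uminus_conv_diff)

text \<open>The translation of ray 1 into ray \<open>k\<close> moves a point of ray \<open>i\<close> only if \<open>i\<close> is 1 or \<open>k\<close>.  For
  other rays it is factored through ray \<open>i\<close>, which moves the point out and back.\<close>

lemma moves_stars_t:
  assumes k: "k \<in> I" shows "moves_stars 1 (t k)"
proof (cases "k = 1")
  case True
  then show ?thesis by (simp add: t_def moves_stars_zero)
next
  case False
  have L: "conj_by (ray_star i p) (slide_word j i) \<approx>[ray_cost p] ray_star i (Suc p)" if "i \<in> I" "j \<in> I" "j \<noteq> i" for i j p
    using ray_star_slide_commute[OF that(1), of p] that(2,3) by simp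
  have cl: "app (slide l i) y \<in> ball (Suc r)" if "y \<in> ball r" "i \<in> I" "l \<in> I" for l i y r
    using that by (auto elim!: ball_cases simp: app_slide_cases split: nat.splits)
  show ?thesis
  proof (rule moves_stars_letter)
    fix r y assume y: "y \<in> ball r"
    show "app (ev (t k)) y \<in> ball (Suc r)" "app (- ev (t k)) y \<in> ball (Suc r)"
      using cl[OF y] k by simp_all
    have cr: "ray_cost p \<le> letter_cost r" "ray_cost p + ray_cost p \<le> letter_cost r" if "p \<le> r" for p
      using that ray_cost_mono[of p "Suc r"] by (auto simp: letter_cost_def)
    from y show "conj_by (star y) (t k) \<approx>[letter_cost r] star (app (ev (t k)) y)"
    proof (cases rule: ball_cases)
      case Aux
      have "conj_by a (t k) \<approx>[1] a"
        by (rule relator_step) (rule shorts k | use k in simp)+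
      from homotopic_mono[OF this letter_cost_pos[of r]] show ?thesis using Aux k by simp
    next
      case (Ray i p)
      consider "i = k" | "i = 1" "p = 0" | q where "i = 1" "p = Suc q" | "i \<noteq> k" "i \<noteq> 1"
        using not0_implies_Suc by blast
      then show ?thesis
      proof cases
        case 1
        have "conj_by (ray_star k p) (t k) \<approx>[ray_cost p] ray_star k (Suc p)"
          using L[of k 1 p] k False by (simp add: slide_word_one)
        from homotopic_mono[OF this cr(1)[OF Ray(3)]] show ?thesis using 1 k False Ray by simp
      next
        case 2
        have "t 1 = 0" by (simp add: t_def)
        then show ?thesis using 2 Ray k False by (simp add: ray_star_def)
      next
        case 3
        have "conj_by (ray_star 1 (Suc q)) (slide_word 1 k) \<approx>[ray_cost q] ray_star 1 q"
          using homotopic_conj_by_uminus[OF L[of 1 k q]] k False by (simp add: slide_word_uminus)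
        from homotopic_mono[OF this cr(1)[of q]] show ?thesis using 3 k False Ray by (simp add: slide_word_one)
      next
        case 4
        have "conj_by (ray_star i p) (t k) = conj_by (conj_by (ray_star i p) (slide_word 1 i)) (slide_word i k)"
          by (simp add: slide_slide_eq_t)
        also have "\<dots> \<approx>[ray_cost p] conj_by (ray_star i (Suc p)) (slide_word i k)"
          using 4 Ray by (intro homotopic_conj_by L) auto
        also have "\<dots> \<approx>[ray_cost p] ray_star i p"
          using homotopic_conj_by_uminus[OF L[of i k p]] k 4 Ray by (simp add: slide_word_uminus)
        finally have "conj_by (ray_star i p) (t k) \<approx>[ray_cost p + ray_cost p] ray_star i p" .
        from homotopic_mono[OF this cr(2)[OF Ray(3)]] show ?thesis using 4 Ray k by simp
      qed
    qed
  qed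
qed

lemma moves_stars_b: "moves_stars 1 b"
proof (rule moves_stars_letter)
  fix r y assume y: "y \<in> ball r"
  show cl: "app (ev b) y \<in> ball (Suc r)" using y by (auto elim!: ball_cases simp: app_swap)
  then show "app (- ev b) y \<in> ball (Suc r)" by simp
  have "conj_by (star y) b \<approx>[ray_cost (radius y)] star (app (ev b) y)"
    using y
  proof (cases rule: ball_cases)
    case Aux
    have "conj_by a b \<approx>[1] ray_star 1 0"
      by (rule relator_step) (rule shorts one_in_I | simp)+
    then show ?thesis using Aux by (simp add: ray_cost_def)
  next
    case (Ray i p)
    have b: "aux_swap 1 = b" by (simp add: aux_swap_def t_def)
    show ?thesis
    proof (cases p)
      case 0
      show ?thesis
      proof (cases "i = 1")
        case True
        have "conj_by (ray_star 1 0) b \<approx>[1] a"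
          by (rule relator_step) (rule shorts one_in_I | simp)+
        then show ?thesis using Ray 0 True by (simp add: ray_cost_def)
      next
        case False
        have "conj_by (ray_star i 0) b \<approx>[1] ray_star i 0"
          by (rule relator_step) (rule shorts Ray | use Ray False in simp)+
        then show ?thesis using Ray 0 False by (simp add: ray_cost_def)
      qed
    next
      case (Suc q)
      have "conj_by (ray_star i p) b \<approx>[ray_cost p] ray_star i p"
        using ray_star_slide_commute[OF Ray(2), of p] b Suc one_in_I by fastforce
      then show ?thesis using Ray Suc by (auto simp: app_swap)
    qed
  qed
  moreover have "radius y \<le> r" using y by (auto simp: ball_def)
  then have "ray_cost (radius y) \<le> letter_cost r" using ray_cost_mono[of "radius y" "Suc r"] by (simp add: letter_cost_def)
  ultimately show "conj_by (star y) b \<approx>[letter_cost r] star (app (ev b) y)" by (rule homotopic_mono)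
qed

lemma moves_stars_path_word: "i \<in> I \<Longrightarrow> moves_stars (2 * p + 1) (path_word i p)"
proof (induction p)
  case 0
  then show ?case using moves_stars_t by simp
next
  case (Suc p)
  have "moves_stars (1 + 1) (slide_word (source i) i)"
    unfolding slide_word_def by (intro moves_stars_add moves_stars_uminus moves_stars_t source Suc.prems)
  from moves_stars_add[OF Suc.IH[OF Suc.prems] this] show ?case by (simp add: algebra_simps)
qed

section \<open>The star system of Houghton's group\<close>

lemma homotopic_ev: "u \<approx>[N] v \<Longrightarrow> ev u = ev v"
proof -
  have "area_le (elt ` relators) N g \<Longrightarrow> ev g = 0" for g N
    by (induction rule: area_le.induct) (auto simp: relators_def)
  then show "u \<approx>[N] v \<Longrightarrow> ev u = ev v" unfolding homotopic_def by fastforce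
qed

lemma swap_square [simp]: "swap u v + swap u v = 0"
  by (rule perms_eqI) (simp add: app_swap)

lemma star_square:
  assumes "y \<in> ball r" shows "star y + star y \<approx>[1] 0"
  using assms
proof (cases rule: ball_cases)
  case Aux
  have "a + a \<approx>[1] 0" by (rule relator_step) (rule shorts | simp)+
  then show ?thesis using Aux by simp
next
  case (Ray i p)
  have "b + b \<approx>[1] 0" by (rule relator_step) (rule shorts | simp)+
  from homotopic_conj_by[OF this, of "a + path_word i p"] show ?thesis
    using Ray by (simp add: ray_star_def conj_by_def group_norm del: add_uminus_conv_diff)
qed

definition star_cost :: "nat \<Rightarrow> nat" where "star_cost r = 12 * Suc r * letter_cost (5 * r + 3)"

lemma star_cost_pos: "1 \<le> star_cost r"
proof -
  have "1 * 1 \<le> 12 * Suc r * letter_cost (5 * r + 3)" by (rule mult_mono) (use letter_cost_pos in auto)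
  then show ?thesis by (simp only: star_cost_def)
qed

text \<open>Conjugating a star transposition by \<open>a\<close> amounts to dropping \<open>a\<close> from its conjugator, since \<open>a\<close>
  commutes with the path.  The result is a word in \<open>b\<close> and the translations, whose action is known.\<close>

lemma star_move:
  assumes y: "y \<in> ball r" and z: "z \<in> ball r" "z \<noteq> Aux"
  shows "conj_by (star y) (conj_by (star z) (- star Aux)) \<approx>[star_cost r] star (app (swap Aux z) y)"
proof -
  obtain i p where ip: "z = Ray i p" "i \<in> I" "p \<le> r" using z by (auto elim: ball_cases)
  let ?u = "path_word i p" and ?m = "2 * p + 1"
  let ?K = "?m * letter_cost ?m"
  have "conj_by a ?u \<approx>[?K] a"
    using moves_stars_path_word[OF ip(2), of p] ball_simps(2)[of 0] ip(2) unfolding moves_stars_def moves_stars1_def by fastforce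
  from homotopic_add_left[OF this, of ?u] have "a + ?u \<approx>[?K] ?u + a"
    by (simp add: add_eq_conj_by[of a ?u])
  from homotopic_add_right[OF this, of "- a"] have "a + ?u - a \<approx>[?K] ?u"
    by simp
  from homotopic_conj_by_right[OF this] have "conj_by b (a + ?u - a) \<approx>[2 * ?K] conj_by b ?u" .
  then have x': "conj_by (star z) (- star Aux) \<approx>[2 * ?K] conj_by b ?u" by (simp add: ip ray_star_def)
  have "moves_stars (?m + 1 + ?m) (conj_by b ?u)"
    unfolding conj_by_def using moves_stars_path_word[OF ip(2), of p] moves_stars_b by (intro moves_stars_add moves_stars_uminus)
  then have "conj_by (star y) (conj_by b ?u) \<approx>[(?m + 1 + ?m) * letter_cost (r + (?m + 1 + ?m))] star (app (ev (conj_by b ?u)) y)"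
    using y unfolding moves_stars_def moves_stars1_def by blast
  moreover have "ev (conj_by b ?u) = swap Aux z" using ip by simp
  ultimately have "conj_by (star y) (conj_by b ?u) \<approx>[(?m + 1 + ?m) * letter_cost (r + (?m + 1 + ?m))] star (app (swap Aux z) y)"
    by (simp only:)
  from homotopic_trans[OF homotopic_conj_by_right[OF x'] this] show ?thesis
  proof (rule homotopic_mono)
    have "letter_cost ?m \<le> letter_cost (5 * r + 3)" "letter_cost (r + (?m + 1 + ?m)) \<le> letter_cost (5 * r + 3)"
      using ip(3) by (auto intro!: letter_cost_mono)
    then have "?m * letter_cost ?m \<le> (2 * r + 1) * letter_cost (5 * r + 3)"
      "(?m + 1 + ?m) * letter_cost (r + (?m + 1 + ?m)) \<le> (4 * r + 3) * letter_cost (5 * r + 3)"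
      using ip(3) by (intro mult_mono; simp)+
    then show "2 * (2 * ?K) + (?m + 1 + ?m) * letter_cost (r + (?m + 1 + ?m)) \<le> star_cost r"
      by (simp add: star_cost_def algebra_simps)
  qed
qed

lemma star_system_ball: "star_system (elt ` relators) (star_cost r) Ctr Aux (ball r) star ev"
proof (rule star_system.intro)
  show "star y + star y \<approx>[star_cost r] 0" if "y \<in> ball r" for y
    using homotopic_mono[OF star_square[OF that] star_cost_pos] .
  show "conj_by (star y) (conj_by (star z) (- star Aux)) \<approx>[star_cost r] star (app (swap Aux z) y)"
    if "y \<in> ball r" "z \<in> ball r" "z \<noteq> Aux" for y z
    by (rule star_move[OF that])
  show "ev u = ev v" if "u \<approx>[M] v" for u v M
    by (rule homotopic_ev[OF that])
qed simp_all

section \<open>The exponential area bound\<close>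

definition stars :: "pt list \<Rightarrow> nat free_grp" where "stars ys = sum_list (map star ys)"

lemma stars_simps [simp]: "stars [] = 0" "stars (y # ys) = star y + stars ys" "stars (ys @ zs) = stars ys + stars zs"
  by (simp_all add: stars_def)

lemma push_stars:
  assumes "moves_stars m g" "set ys \<subseteq> ball r"
  shows "\<exists>zs. length zs = length ys \<and> set zs \<subseteq> ball (r + m) \<and>
    stars ys + g \<approx>[length ys * (m * letter_cost (r + m))] g + stars zs"
  using assms(2)
proof (induction ys)
  case Nil
  then show ?case by simp
next
  case (Cons y ys)
  then obtain zs where zs: "length zs = length ys" "set zs \<subseteq> ball (r + m)"
    "stars ys + g \<approx>[length ys * (m * letter_cost (r + m))] g + stars zs" by auto
  have y: "app (ev g) y \<in> ball (r + m)" "conj_by (star y) g \<approx>[m * letter_cost (r + m)] star (app (ev g) y)"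
    using assms(1) Cons.prems by (auto simp: moves_stars_def moves_stars1_def)
  have "star y + (stars ys + g) \<approx>[length ys * (m * letter_cost (r + m))] star y + (g + stars zs)"
    by (rule homotopic_add_left[OF zs(3)])
  also have "star y + (g + stars zs) = g + conj_by (star y) g + stars zs"
    using add_eq_conj_by[of "star y" g] by (simp only: add.assoc[symmetric])
  also have "\<dots> \<approx>[m * letter_cost (r + m)] g + star (app (ev g) y) + stars zs"
    by (intro homotopic_add_right homotopic_add_left y(2))
  finally have "star y + (stars ys + g) \<approx>[length (y # ys) * (m * letter_cost (r + m))] g + star (app (ev g) y) + stars zs"
    by (rule homotopic_mono) simp
  then show ?case using zs(1,2) y(1)
    by (intro exI[of _ "app (ev g) y # zs"]) (simp add: add.assoc)
qed

definition t_words :: "nat word set" where "t_words = words {2..n}"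

lemma t_words_simps [simp]: "[] \<in> t_words" "x # w \<in> t_words \<longleftrightarrow> fst x \<in> {2..n} \<and> w \<in> t_words" "u @ v \<in> t_words \<longleftrightarrow> u \<in> t_words \<and> v \<in> t_words"
  by (auto simp: t_words_def)

lemma elt_letter:
  assumes "k \<in> {2..n}"
  shows "elt [(k, s)] = (if s then t k else - t k)" "k \<in> I"
  using assms by (auto simp: elt_Cons elt_simps t_def I_def)

lemma moves_stars_letter_t_words: "k \<in> {2..n} \<Longrightarrow> moves_stars 1 (elt [(k, s)])"
  using moves_stars_t[of k] elt_letter(1)[of k s] elt_letter(2)[of k] by (auto intro: moves_stars_uminus)

lemma moves_stars_t_words: "T \<in> t_words \<Longrightarrow> moves_stars (length T) (elt T)"
proof (induction T)
  case Nil
  then show ?case by (simp add: elt_simps moves_stars_zero)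
next
  case (Cons x T)
  have "moves_stars (1 + length T) (elt [x] + elt T)"
    using Cons moves_stars_letter_t_words[of "fst x" "snd x"] by (intro moves_stars_add) auto
  then show ?case using elt_simps(2)[of "[x]" T] by (simp add: One_nat_def)
qed

lemma pt_cases_near:
  obtains "x = Ctr" | "x = Aux" | "x = Ray 1 0" | "x = Ray 1 (Suc 0)" | p where "x = Ray 1 (Suc (Suc p))"
  | "x = Ray j 0" | p where "x = Ray j (Suc p)" | "x = Ray k 0" | p where "x = Ray k (Suc p)"
  | l p where "x = Ray l p" "l \<noteq> 1" "l \<noteq> j" "l \<noteq> k"
proof (rule pt_cases_two_rays[where x = x and i = 1 and j = j and k = k])
  fix p assume "x = Ray 1 p"
  then show thesis
    using that(3-5) by (cases p; cases "p - 1") auto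
qed (use that in blast)+

text \<open>The reason why exchanging two letters creates only boundedly many star transpositions, and only
  of points of bounded depth.\<close>

lemma slide_commutators:
  assumes "j \<noteq> 1" "k \<noteq> 1" "j \<noteq> k"
  shows "slide 1 j + slide 1 k = slide 1 k + slide 1 j + swap (Ray j 0) (Ray k 0)"
    "slide 1 j + slide k 1 = slide k 1 + slide 1 j + swap (Ray 1 0) (Ray j 0)"
    "slide j 1 + slide 1 k = slide 1 k + slide j 1 + swap (Ray 1 0) (Ray k 0)"
    "slide j 1 + slide k 1 = slide k 1 + slide j 1 + swap (Ray 1 0) (Ray 1 (Suc 0))"
proof -
  show "slide 1 j + slide 1 k = slide 1 k + slide 1 j + swap (Ray j 0) (Ray k 0)"
  proof (rule perms_eqI)
    fix x
    show "app (slide 1 j + slide 1 k) x = app (slide 1 k + slide 1 j + swap (Ray j 0) (Ray k 0)) x"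
      by (rule pt_cases_near[where x = x and j = j and k = k]) (use assms in \<open>simp_all add: app_swap\<close>)
  qed
  show "slide 1 j + slide k 1 = slide k 1 + slide 1 j + swap (Ray 1 0) (Ray j 0)"
  proof (rule perms_eqI)
    fix x
    show "app (slide 1 j + slide k 1) x = app (slide k 1 + slide 1 j + swap (Ray 1 0) (Ray j 0)) x"
      by (rule pt_cases_near[where x = x and j = j and k = k]) (use assms in \<open>simp_all add: app_swap\<close>)
  qed
  show "slide j 1 + slide 1 k = slide 1 k + slide j 1 + swap (Ray 1 0) (Ray k 0)"
  proof (rule perms_eqI)
    fix x
    show "app (slide j 1 + slide 1 k) x = app (slide 1 k + slide j 1 + swap (Ray 1 0) (Ray k 0)) x"
      by (rule pt_cases_near[where x = x and j = j and k = k]) (use assms in \<open>simp_all add: app_swap\<close>)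
  qed
  show "slide j 1 + slide k 1 = slide k 1 + slide j 1 + swap (Ray 1 0) (Ray 1 (Suc 0))"
  proof (rule perms_eqI)
    fix x
    show "app (slide j 1 + slide k 1) x = app (slide k 1 + slide j 1 + swap (Ray 1 0) (Ray 1 (Suc 0))) x"
      by (rule pt_cases_near[where x = x and j = j and k = k]) (use assms in \<open>simp_all add: app_swap\<close>)
  qed
qed

lemma short_mono: "short p u \<Longrightarrow> p \<le> q \<Longrightarrow> short q u"
  unfolding short_def by (meson le_trans)

lemma short_star: "u \<in> ball 1 \<Longrightarrow> short 9 (star u)"
proof (erule ball_cases)
  show "short 9 (star u)" if "u = Aux" using short_mono[OF short_intros(1), of 9] that by simp
  show "short 9 (star u)" if "u = Ray i p" "i \<in> I" "p \<le> 1" for i p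
    using short_mono[OF short_ray_star[OF that(2), of p], of 9] that by simp
qed

lemma swap_triple:
  assumes "u \<noteq> v" "u \<noteq> x" "v \<noteq> x" shows "swap x u + (swap x v + swap x u) = swap u v"
proof -
  have "conj_by (swap x v) (swap x u) = swap u v" using assms by simp
  then show ?thesis by (simp add: conj_by_def add.assoc)
qed

lemma letters_commute:
  assumes j: "j \<in> {2..n}" and k: "k \<in> {2..n}"
  shows "\<exists>zs. length zs \<le> 3 \<and> set zs \<subseteq> ball 1 \<and>
    elt [(j, s)] + elt [(k, s')] \<approx>[1] elt [(k, s')] + elt [(j, s)] + stars zs"
proof (cases "j = k")
  case True
  then have "elt [(j, s)] + elt [(k, s')] = elt [(k, s')] + elt [(j, s)]"
    by (simp add: elt_letter(1)[OF k])
  then show ?thesis by (intro exI[of _ "[]"]) simp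
next
  case False
  have jk: "j \<in> I" "k \<in> I" "j \<noteq> 1" "k \<noteq> 1" using elt_letter(2)[OF j] elt_letter(2)[OF k] j k by auto
  have lj: "ev (elt [(j, s)]) = (if s then slide 1 j else slide j 1)"
    and lk: "ev (elt [(k, s)]) = (if s then slide 1 k else slide k 1)" for s
    using elt_letter(1)[OF j, of s] elt_letter(1)[OF k, of s] jk by simp_all
  have near: "Ray j 0 \<in> ball 1" "Ray k 0 \<in> ball 1" "Ray 1 0 \<in> ball 1" "Ray 1 (Suc 0) \<in> ball 1"
    using jk by simp_all
  have "\<exists>u\<in>ball 1. \<exists>v\<in>ball 1. u \<noteq> v \<and>
    ev (elt [(j, s)]) + ev (elt [(k, s')]) = ev (elt [(k, s')]) + ev (elt [(j, s)]) + swap u v"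
  proof -
    consider "s" "s'" | "s" "\<not> s'" | "\<not> s" "s'" | "\<not> s" "\<not> s'" by blast
    then show ?thesis
    proof cases
      case 1
      show ?thesis
        by (rule bexI[of _ "Ray j 0"], rule bexI[of _ "Ray k 0"])
          (use 1 near False jk slide_commutators(1)[of j k] in \<open>simp_all add: lj lk\<close>)
    next
      case 2
      show ?thesis
        by (rule bexI[of _ "Ray 1 0"], rule bexI[of _ "Ray j 0"])
          (use 2 near False jk slide_commutators(2)[of j k] in \<open>simp_all add: lj lk\<close>)
    next
      case 3
      show ?thesis
        by (rule bexI[of _ "Ray 1 0"], rule bexI[of _ "Ray k 0"])
          (use 3 near False jk slide_commutators(3)[of j k] in \<open>simp_all add: lj lk\<close>)
    next
      case 4
      show ?thesis
        by (rule bexI[of _ "Ray 1 0"], rule bexI[of _ "Ray 1 (Suc 0)"])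
          (use 4 near False jk slide_commutators(4)[of j k] in \<open>simp_all add: lj lk\<close>)
    qed
  qed
  then obtain u v where uv: "u \<in> ball 1" "v \<in> ball 1" "u \<noteq> v"
    "ev (elt [(j, s)]) + ev (elt [(k, s')]) = ev (elt [(k, s')]) + ev (elt [(j, s)]) + swap u v" by blast
  have sh: "short 1 (elt [(j, s)])" "short 1 (elt [(k, s')])"
    using short_intros(3,6) jk by (simp_all add: elt_letter(1)[OF j] elt_letter(1)[OF k])
  have "u \<noteq> Ctr" "v \<noteq> Ctr" using uv(1,2) by auto
  then have "ev (stars [u, v, u]) = swap u v"
    using swap_triple[of u v Ctr] uv by (auto simp: ev_star[OF uv(1)] ev_star[OF uv(2)])
  moreover have "short (1 + 1) (elt [(j, s)] + elt [(k, s')])" by (intro short_intros sh)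
  moreover have "short (1 + 1 + (9 + (9 + (9 + 0)))) (elt [(k, s')] + elt [(j, s)] + stars [u, v, u])"
    unfolding stars_simps by (intro short_intros sh short_star uv)
  ultimately have "elt [(j, s)] + elt [(k, s')] \<approx>[1] elt [(k, s')] + elt [(j, s)] + stars [u, v, u]"
    using uv(4) by (intro relator_step) auto
  then show ?thesis using uv by (intro exI[of _ "[u, v, u]"]) auto
qed

lemma push_Xs':
  assumes "moves_stars m g" "set ys \<subseteq> ball r" "r + m \<le> R" "length ys \<le> K" "m \<le> M"
  obtains zs where "length zs = length ys" "set zs \<subseteq> ball R" "stars ys + g \<approx>[K * (M * letter_cost R)] g + stars zs"
proof -
  obtain zs where zs: "length zs = length ys" "set zs \<subseteq> ball (r + m)"
    "stars ys + g \<approx>[length ys * (m * letter_cost (r + m))] g + stars zs"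
    using push_stars[OF assms(1,2)] by blast
  have "length ys * (m * letter_cost (r + m)) \<le> K * (M * letter_cost R)"
    using assms by (intro mult_le_mono letter_cost_mono)
  with zs(3) have "stars ys + g \<approx>[K * (M * letter_cost R)] g + stars zs" by (rule homotopic_mono)
  then show ?thesis using that zs(1,2) ball_mono[OF assms(3)] by blast
qed

lemma letter_past_word:
  assumes "k \<in> {2..n}" "U \<in> t_words"
  shows "\<exists>zs. length zs \<le> 3 * length U \<and> set zs \<subseteq> ball (Suc (length U)) \<and>
    elt [(k, s)] + elt U \<approx>[length U * (1 + 3 * length U * letter_cost (Suc (length U)))] elt U + elt [(k, s)] + stars zs"
  using assms(2)
proof (induction U)
  case Nil
  then show ?case by (intro exI[of _ "[]"]) (simp add: elt_simps)
next
  case (Cons x U)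
  obtain j s' where x: "x = (j, s')" by force
  let ?g = "elt [(k, s)]" and ?h = "elt [(j, s')]" and ?L = "length U"
  have j: "j \<in> {2..n}" "U \<in> t_words" using Cons.prems x by auto
  obtain zs where zs: "length zs \<le> 3 * ?L" "set zs \<subseteq> ball (Suc ?L)"
    "?g + elt U \<approx>[?L * (1 + 3 * ?L * letter_cost (Suc ?L))] elt U + ?g + stars zs"
    using Cons.IH[OF j(2)] by blast
  obtain z0 where z0: "length z0 \<le> 3" "set z0 \<subseteq> ball 1" "?g + ?h \<approx>[1] ?h + ?g + stars z0"
    using letters_commute[OF assms(1) j(1)] by blast
  obtain z1 where z1: "length z1 = length z0" "set z1 \<subseteq> ball (Suc ?L)"
    "stars z0 + elt U \<approx>[3 * (?L * letter_cost (Suc ?L))] elt U + stars z1"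
    using push_Xs'[OF moves_stars_t_words[OF j(2)] z0(2), of "Suc ?L" 3 ?L] z0(1) by auto
  have mkx: "elt (x # U) = ?h + elt U" using elt_simps(2)[of "[x]" U] x by simp
  have "?g + elt (x # U) = ?g + ?h + elt U" by (simp add: mkx add.assoc)
  also have "\<dots> \<approx>[1] ?h + ?g + stars z0 + elt U" by (rule homotopic_add_right[OF z0(3)])
  also have "\<dots> = ?h + ?g + (stars z0 + elt U)" by (simp add: add.assoc)
  also have "\<dots> \<approx>[3 * (?L * letter_cost (Suc ?L))] ?h + ?g + (elt U + stars z1)"
    by (rule homotopic_add_left[OF z1(3)])
  also have "\<dots> = ?h + ((?g + elt U) + stars z1)" by (simp add: add.assoc)
  also have "\<dots> \<approx>[?L * (1 + 3 * ?L * letter_cost (Suc ?L))] ?h + ((elt U + ?g + stars zs) + stars z1)"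
    by (intro homotopic_add_left homotopic_add_right zs(3))
  also have "\<dots> = elt (x # U) + ?g + stars (zs @ z1)" by (simp add: mkx add.assoc)
  finally have "?g + elt (x # U) \<approx>[1 + 3 * (?L * letter_cost (Suc ?L)) + ?L * (1 + 3 * ?L * letter_cost (Suc ?L))]
     elt (x # U) + ?g + stars (zs @ z1)" .
  moreover have "1 + 3 * (?L * letter_cost (Suc ?L)) + ?L * (1 + 3 * ?L * letter_cost (Suc ?L)) \<le>
    length (x # U) * (1 + 3 * length (x # U) * letter_cost (Suc (length (x # U))))"
  proof -
    have "1 + 3 * (?L * letter_cost (Suc ?L)) + ?L * (1 + 3 * ?L * letter_cost (Suc ?L)) = Suc ?L * (1 + 3 * ?L * letter_cost (Suc ?L))"
      by (simp add: algebra_simps)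
    also have "\<dots> \<le> Suc ?L * (1 + 3 * Suc ?L * letter_cost (Suc (Suc ?L)))"
      by (intro mult_le_mono add_le_mono letter_cost_mono) auto
    finally show ?thesis by simp
  qed
  ultimately have "?g + elt (x # U) \<approx>[length (x # U) * (1 + 3 * length (x # U) * letter_cost (Suc (length (x # U))))]
     elt (x # U) + ?g + stars (zs @ z1)" by (rule homotopic_mono)
  moreover have "set (zs @ z1) \<subseteq> ball (Suc (length (x # U)))"
    using zs(2) z1(2) ball_mono[of "Suc ?L" "Suc (Suc ?L)"] by auto
  ultimately show ?case using zs(1) z1(1) z0(1) by (intro exI[of _ "zs @ z1"]) (auto simp: x)
qed

text \<open>The first letter is moved next to an occurrence of its inverse and cancelled.  The star
  transpositions created on the way are pushed to the end of the word at once, so that their depth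
  never exceeds the length of the word.\<close>

lemma balanced_word:
  assumes "T \<in> t_words" "\<And>k. count_list T (k, True) = count_list T (k, False)" "length T \<le> L"
  shows "\<exists>zs. length zs \<le> 3 * length T ^ 2 \<and> set zs \<subseteq> ball L \<and> elt T \<approx>[7 * length T ^ 3 * letter_cost L] stars zs"
  using assms
proof (induction "length T" arbitrary: T rule: less_induct)
  case less
  show ?case
  proof (cases T)
    case Nil
    then show ?thesis by (intro exI[of _ "[]"]) (simp add: elt_simps)
  next
    case (Cons x T')
    obtain k s where x: "x = (k, s)" by force
    have k: "k \<in> {2..n}" using less.prems(1) Cons x by simp
    have "count_list T (k, \<not> s) = count_list T (k, s)" using less.prems(2)[of k] by (cases s) auto
    then have "count_list T' (k, \<not> s) \<noteq> 0" using Cons x by (simp split: if_splits)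
    then have "(k, \<not> s) \<in> set T'" by (simp add: count_list_0_iff)
    then obtain U V where UV: "T' = U @ (k, \<not> s) # V" using split_list by metis
    have T: "T = (k, s) # U @ (k, \<not> s) # V" using Cons x UV by simp
    let ?l = "length T" and ?g = "elt [(k, s)]"
    have t_words: "U \<in> t_words" "V \<in> t_words" "U @ V \<in> t_words" using less.prems(1) T by auto
    have len: "length U + length V + 2 = ?l" using T by simp
    obtain zs where zs: "length zs \<le> 3 * length U" "set zs \<subseteq> ball (Suc (length U))"
      "?g + elt U \<approx>[length U * (1 + 3 * length U * letter_cost (Suc (length U)))] elt U + ?g + stars zs"
      using letter_past_word[OF k t_words(1)] by blast
    have "moves_stars (1 + length V) (- ?g + elt V)"
      using moves_stars_letter_t_words[OF k] moves_stars_t_words[OF t_words(2)] by (intro moves_stars_add moves_stars_uminus)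
    then obtain z1 where z1: "length z1 = length zs" "set z1 \<subseteq> ball L"
      "stars zs + (- ?g + elt V) \<approx>[(3 * ?l) * (?l * letter_cost L)] (- ?g + elt V) + stars z1"
      using push_Xs'[of "1 + length V" "- ?g + elt V" zs "Suc (length U)" L "3 * ?l" ?l] zs(1,2) len less.prems(3)
      by auto
    have bal: "count_list (U @ V) (m, True) = count_list (U @ V) (m, False)" for m
      using less.prems(2)[of m] unfolding T by (cases s) (auto split: if_splits)
    obtain ys where ys: "length ys \<le> 3 * length (U @ V) ^ 2" "set ys \<subseteq> ball L"
      "elt (U @ V) \<approx>[7 * length (U @ V) ^ 3 * letter_cost L] stars ys"
      using less.hyps[OF _ t_words(3) bal] len less.prems(3) by auto
    have inv: "elt [(k, \<not> s)] = - ?g" by (cases s) (simp_all add: elt_Cons elt_simps)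
    have "elt T = ?g + elt U + (- ?g + elt V)"
      unfolding T using elt_simps(2)[of "[(k, s)]" "U @ [(k, \<not> s)] @ V"] elt_simps(2)[of "[(k, \<not> s)]" V] inv
      by (simp add: elt_simps add.assoc)
    also have "\<dots> \<approx>[length U * (1 + 3 * length U * letter_cost (Suc (length U)))] elt U + ?g + stars zs + (- ?g + elt V)"
      by (rule homotopic_add_right[OF zs(3)])
    also have "\<dots> = elt U + ?g + (stars zs + (- ?g + elt V))" by (simp only: add.assoc)
    also have "\<dots> \<approx>[(3 * ?l) * (?l * letter_cost L)] elt U + ?g + ((- ?g + elt V) + stars z1)"
      by (rule homotopic_add_left[OF z1(3)])
    also have "\<dots> = elt (U @ V) + stars z1" by (simp add: elt_simps add.assoc)
    also have "\<dots> \<approx>[7 * length (U @ V) ^ 3 * letter_cost L] stars ys + stars z1"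
      by (rule homotopic_add_right[OF ys(3)])
    also have "\<dots> = stars (ys @ z1)" by simp
    finally have "elt T \<approx>[length U * (1 + 3 * length U * letter_cost (Suc (length U))) + (3 * ?l) * (?l * letter_cost L) +
      7 * length (U @ V) ^ 3 * letter_cost L] stars (ys @ z1)" .
    moreover have "length U * (1 + 3 * length U * letter_cost (Suc (length U))) + (3 * ?l) * (?l * letter_cost L) +
      7 * length (U @ V) ^ 3 * letter_cost L \<le> 7 * ?l ^ 3 * letter_cost L"
    proof -
      define m where "m = length (U @ V)"
      have m: "?l = m + 2" "length U \<le> m" using len by (auto simp: m_def)
      have "length U * (1 + 3 * length U * letter_cost (Suc (length U))) \<le> ?l * (letter_cost L + 3 * ?l * letter_cost L)"
        using m less.prems(3) letter_cost_pos[of L] by (intro mult_le_mono add_le_mono letter_cost_mono) auto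
      then have "length U * (1 + 3 * length U * letter_cost (Suc (length U))) + (3 * ?l) * (?l * letter_cost L) + 7 * m ^ 3 * letter_cost L
        \<le> (?l * (1 + 3 * ?l) + 3 * ?l * ?l + 7 * m ^ 3) * letter_cost L"
        by (simp add: algebra_simps)
      also have "?l * (1 + 3 * ?l) + 3 * ?l * ?l + 7 * m ^ 3 \<le> 7 * ?l ^ 3"
        unfolding m by (simp add: power3_eq_cube algebra_simps)
      finally show ?thesis by (simp add: m_def)
    qed
    ultimately have "elt T \<approx>[7 * ?l ^ 3 * letter_cost L] stars (ys @ z1)" by (rule homotopic_mono)
    moreover have "length (ys @ z1) \<le> 3 * ?l ^ 2"
    proof -
      define m where "m = length (U @ V)"
      have m: "?l = m + 2" "length U \<le> m" using len by (auto simp: m_def)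
      have "length (ys @ z1) \<le> 3 * m ^ 2 + 3 * m" using ys(1) z1(1) zs(1) m by (auto simp: m_def)
      also have "\<dots> \<le> 3 * ?l ^ 2" unfolding m by (simp add: power2_eq_square algebra_simps)
      finally show ?thesis .
    qed
    ultimately show ?thesis using ys(2) z1(2) by (intro exI[of _ "ys @ z1"]) auto
  qed
qed

text \<open>Read from left to right, every letter \<open>a\<close> or \<open>b\<close> becomes at most three star transpositions, and
  every translation passes to the left of those already present.\<close>

lemma split_word:
  assumes "w \<in> words {0..n}" "length w \<le> L"
  shows "\<exists>T ys. T \<in> t_words \<and> length T \<le> length w \<and> length ys \<le> 3 * length w \<and> set ys \<subseteq> ball (length w) \<and>
    elt w \<approx>[3 * length w ^ 2 * letter_cost L + length w] elt T + stars ys"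
  using assms
proof (induction w rule: rev_induct)
  case Nil
  then show ?case by (intro exI[of _ "[]"]) (simp add: elt_simps)
next
  case (snoc x w)
  obtain k s where x: "x = (k, s)" by force
  let ?l = "length w"
  obtain T ys where T: "T \<in> t_words" "length T \<le> ?l" "length ys \<le> 3 * ?l" "set ys \<subseteq> ball ?l"
    "elt w \<approx>[3 * ?l ^ 2 * letter_cost L + ?l] elt T + stars ys" using snoc by auto
  have ys: "set ys \<subseteq> ball (Suc ?l)" using T(4) ball_mono[of ?l "Suc ?l"] by auto
  have step: "elt (w @ [x]) \<approx>[3 * ?l ^ 2 * letter_cost L + ?l] elt T + stars ys + elt [(k, s)]"
    using homotopic_add_right[OF T(5)] by (simp add: elt_simps x)
  have le: "3 * ?l ^ 2 * letter_cost L + ?l + (3 * ?l * letter_cost L + 1) \<le> 3 * length (w @ [x]) ^ 2 * letter_cost L + length (w @ [x])"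
    by (simp add: power2_eq_square algebra_simps)
  have "\<exists>T' ys'. T' \<in> t_words \<and> length T' \<le> Suc ?l \<and> length ys' \<le> 3 + 3 * ?l \<and> set ys' \<subseteq> ball (Suc ?l) \<and>
    elt T + stars ys + elt [(k, s)] \<approx>[3 * ?l * letter_cost L + 1] elt T' + stars ys'"
  proof -
    consider "k = 0" | "k = 1" | "k \<in> {2..n}" using snoc.prems(1) x by force
    then show ?thesis
    proof cases
      case 1
      have "- a \<approx>[1] a" by (rule relator_step) (rule shorts | simp)+
      then have "elt [(k, s)] \<approx>[1] stars [Aux]"
        using 1 by (cases s) (simp_all add: elt_Cons elt_simps a_def[symmetric])
      from homotopic_add_left[OF homotopic_mono[OF this], of "3 * ?l * letter_cost L + 1" "elt T + stars ys"]
      have "elt T + stars ys + elt [(k, s)] \<approx>[3 * ?l * letter_cost L + 1] elt T + stars (ys @ [Aux])"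
        by (simp add: add.assoc)
      then show ?thesis using T ys by (intro exI[of _ T] exI[of _ "ys @ [Aux]"]) auto
    next
      case 2
      have e: "ev b = ev (a + (ray_star 1 0 + a))"
        by (rule perms_eqI) (simp add: app_swap)
      have e': "ev (- b) = ev (a + (ray_star 1 0 + a))" by (simp only: e[symmetric]) simp
      have "b \<approx>[1] a + (ray_star 1 0 + a)"
        by (rule relator_step) (rule shorts one_in_I e | simp)+
      moreover have "- b \<approx>[1] a + (ray_star 1 0 + a)"
        by (rule relator_step) (rule shorts one_in_I e' | simp)+
      ultimately have "elt [(k, s)] \<approx>[1] stars [Aux, Ray 1 0, Aux]"
        using 2 by (cases s) (simp_all add: elt_Cons elt_simps b_def[symmetric])
      from homotopic_add_left[OF homotopic_mono[OF this], of "3 * ?l * letter_cost L + 1" "elt T + stars ys"]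
      have "elt T + stars ys + elt [(k, s)] \<approx>[3 * ?l * letter_cost L + 1] elt T + stars (ys @ [Aux, Ray 1 0, Aux])"
        by (simp add: add.assoc)
      then show ?thesis using T ys by (intro exI[of _ T] exI[of _ "ys @ [Aux, Ray 1 0, Aux]"]) auto
    next
      case 3
      obtain zs where zs: "length zs = length ys" "set zs \<subseteq> ball (Suc ?l)"
        "stars ys + elt [(k, s)] \<approx>[3 * ?l * (1 * letter_cost (Suc ?l))] elt [(k, s)] + stars zs"
        using push_Xs'[OF moves_stars_letter_t_words[OF 3] T(4), of "Suc ?l" "3 * ?l" 1] T(3) by auto
      have "3 * ?l * letter_cost (Suc ?l) \<le> 3 * ?l * letter_cost L"
        using snoc.prems(2) by (intro mult_le_mono2 letter_cost_mono) simp
      then have "3 * ?l * (1 * letter_cost (Suc ?l)) \<le> 3 * ?l * letter_cost L + 1"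
        unfolding mult_1 by (rule trans_le_add1)
      from homotopic_add_left[OF homotopic_mono[OF zs(3) this], of "elt T"]
      have "elt T + stars ys + elt [(k, s)] \<approx>[3 * ?l * letter_cost L + 1] elt (T @ [(k, s)]) + stars zs"
        by (simp add: elt_simps add.assoc)
      then show ?thesis using T zs 3 by (intro exI[of _ "T @ [(k, s)]"] exI[of _ zs]) auto
    qed
  qed
  then obtain T' ys' where T': "T' \<in> t_words" "length T' \<le> Suc ?l" "length ys' \<le> 3 + 3 * ?l" "set ys' \<subseteq> ball (Suc ?l)"
    "elt T + stars ys + elt [(k, s)] \<approx>[3 * ?l * letter_cost L + 1] elt T' + stars ys'" by blast
  from homotopic_mono[OF homotopic_trans[OF step T'(5)] le] show ?case
    using T' by (intro exI[of _ T'] exI[of _ ys']) auto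
qed

text \<open>Far out on ray \<open>k\<close> only the letters \<open>t k\<close> are seen, and they count its exponent.\<close>

lemma ev_t_words_far:
  assumes "T \<in> t_words" "k \<in> {2..n}" "length T \<le> p"
  shows "\<exists>q. app (ev (elt T)) (Ray k p) = Ray k q \<and>
    q + count_list T (k, False) = p + count_list T (k, True)"
  using assms(1,3)
proof (induction T arbitrary: p)
  case Nil
  then show ?case by (simp add: elt_simps)
next
  case (Cons x T)
  obtain j s where x: "x = (j, s)" by force
  have j: "j \<in> {2..n}" using Cons.prems x by simp
  obtain p0 where p0: "p = Suc p0" using Cons.prems(2) by (cases p) auto
  have k1: "k \<noteq> 1" "j \<noteq> 1" using assms(2) j by auto
  have e: "ev (elt [(j, s)]) = (if s then slide 1 j else slide j 1)"
    using elt_letter(1)[OF j, of s] elt_letter(2)[OF j] by simp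
  have m: "app (ev (elt (x # T))) y = app (ev (elt T)) (app (ev (elt [(j, s)])) y)" for y
    using elt_simps(2)[of "[x]" T] x by simp
  define p' where "p' = (if j = k then if s then Suc p else p0 else p)"
  have "app (ev (elt [(j, s)])) (Ray k p) = Ray k p'"
    using k1 p0 by (auto simp: e p'_def)
  moreover have "length T \<le> p'" using Cons.prems(2) p0 by (simp add: p'_def)
  then obtain q where "app (ev (elt T)) (Ray k p') = Ray k q"
    "q + count_list T (k, False) = p' + count_list T (k, True)"
    using Cons.IH[of p'] Cons.prems(1) by auto
  ultimately show ?case using x p0 m by (auto simp: p'_def split: if_splits)
qed

lemma ev_stars_fixes:
  assumes "set ys \<subseteq> ball r" "y \<notin> set ys" "y \<noteq> Ctr" shows "app (ev (stars ys)) y = y"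
  using assms(1,2)
proof (induction ys)
  case (Cons z ys)
  then have "ev (star z) = swap Ctr z" by (intro ev_star[of z r]) auto
  then show ?case using Cons assms(3) by simp
qed simp

lemma stars_area:
  assumes "set ys \<subseteq> ball L" "ev (stars ys) = 0" "length ys \<le> K"
  shows "stars ys \<approx>[60 * star_cost L * K * (K + 1)] 0"
proof -
  interpret star_system "elt ` relators" "star_cost L" Ctr Aux "ball L" star ev by (rule star_system_ball)
  define ts where "ts = map (Pair Ctr) ys"
  have W: "W ts = stars ys" unfolding ts_def by (induction ys) (auto simp: tau_def)
  have "W ts \<approx>[60 * star_cost L * length ts * card (insert Ctr (set ys))] 0"
  proof (rule transpositions_area)
    show "insert Ctr (set ys) \<subseteq> Y" using assms(1) by (auto simp: Y_def)
    show "set ts \<subseteq> transps (insert Ctr (set ys))" using assms(1) by (auto simp: ts_def transps_def)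
    show "ev (W ts) = 0" using W assms(2) by simp
  qed auto
  moreover have "card (insert Ctr (set ys)) \<le> K + 1"
    using card_length[of ys] assms(3) card_insert_le_m1[of "K + 1" "set ys" Ctr] by simp
  then have "60 * star_cost L * length ts * card (insert Ctr (set ys)) \<le> 60 * star_cost L * K * (K + 1)"
    using assms(3) by (intro mult_le_mono) (auto simp: ts_def)
  ultimately show ?thesis unfolding W by (rule homotopic_mono)
qed

text \<open>A polynomial for the number of steps times the largest cost of a single step.\<close>

definition area_bound :: "nat \<Rightarrow> nat" where "area_bound L = 30251 * Suc L ^ 5 * letter_cost (5 * L + 3)"

text \<open>The word acts far out on ray \<open>k\<close> as a translation by the exponent of \<open>t k\<close>, because star
  transpositions of bounded depth do not act there.  So all exponents vanish.\<close>

theorem exponential_area: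
  assumes w: "w \<in> words {0..n}" and ev: "ev (elt w) = 0"
  shows "area_le (elt ` relators) (area_bound (length w)) (elt w)"
proof -
  let ?L = "length w"
  obtain T ys where T: "T \<in> t_words" "length T \<le> ?L" "length ys \<le> 3 * ?L" "set ys \<subseteq> ball ?L"
    "elt w \<approx>[3 * ?L ^ 2 * letter_cost ?L + ?L] elt T + stars ys"
    using split_word[OF w order.refl] by blast
  have e0: "ev (elt T) + ev (stars ys) = 0" using homotopic_ev[OF T(5)] ev by simp
  have bal: "count_list T (k, True) = count_list T (k, False)" for k
  proof (cases "k \<in> {2..n}")
    case True
    obtain q where q: "app (ev (elt T)) (Ray k (Suc ?L)) = Ray k q"
      "q + count_list T (k, False) = Suc ?L + count_list T (k, True)"
      using ev_t_words_far[OF T(1) True, of "Suc ?L"] T(2) by auto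
    have "Ray k (Suc ?L) = app (ev (elt T) + ev (stars ys)) (Ray k (Suc ?L))" by (simp add: e0)
    also have "\<dots> = app (ev (stars ys)) (Ray k q)" using q by simp
    finally have *: "app (ev (stars ys)) (Ray k q) = Ray k (Suc ?L)" by simp
    moreover have "app (ev (stars ys)) (Ray k (Suc ?L)) = Ray k (Suc ?L)"
      using T(4) by (intro ev_stars_fixes) auto
    ultimately have "app (ev (stars ys)) (Ray k q) = app (ev (stars ys)) (Ray k (Suc ?L))" by simp
    then have "q = Suc ?L" by (simp only: app_eq_iff pt.inject)
    then show ?thesis using q(2) by simp
  next
    case False
    then have "(k, s) \<notin> set T" for s using T(1) by (auto simp: t_words_def words_def)
    then show ?thesis by (simp add: count_notin)
  qed
  obtain zs where zs: "length zs \<le> 3 * length T ^ 2" "set zs \<subseteq> ball ?L" "elt T \<approx>[7 * length T ^ 3 * letter_cost ?L] stars zs"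
    using balanced_word[OF T(1) bal T(2)] by blast
  have len: "length (zs @ ys) \<le> 6 * Suc ?L ^ 2"
  proof -
    have "length T ^ 2 \<le> ?L ^ 2" using T(2) by (rule power_mono) simp
    then have "length (zs @ ys) \<le> 3 * ?L ^ 2 + 3 * ?L" using zs(1) T(3) unfolding length_append by linarith
    then show ?thesis by (simp add: power2_eq_square)
  qed
  have st: "elt w \<approx>[3 * ?L ^ 2 * letter_cost ?L + ?L + 7 * length T ^ 3 * letter_cost ?L] stars (zs @ ys)"
    using homotopic_trans[OF T(5) homotopic_add_right[OF zs(3), of "stars ys"]] by simp
  have "ev (stars (zs @ ys)) = 0" using homotopic_ev[OF st] ev by simp
  then have fin: "stars (zs @ ys) \<approx>[60 * star_cost ?L * (6 * Suc ?L ^ 2) * (6 * Suc ?L ^ 2 + 1)] 0"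
    using T(4) zs(2) len by (intro stars_area) auto
  have "3 * ?L ^ 2 * letter_cost ?L + ?L + 7 * length T ^ 3 * letter_cost ?L + 60 * star_cost ?L * (6 * Suc ?L ^ 2) * (6 * Suc ?L ^ 2 + 1) \<le> area_bound ?L"
  proof -
    let ?letter_cost = "letter_cost (5 * ?L + 3)" and ?s = "Suc ?L"
    have pow: "60 * (12 * q * D) * (6 * q ^ 2) * (7 * q ^ 2) = 30240 * q ^ 5 * D" for q D :: nat
      by (simp add: power_numeral_reduce)
    have letter_cost: "letter_cost ?L \<le> ?letter_cost" by (intro letter_cost_mono) simp
    have p: "?s ^ i \<le> ?s ^ 5" if "i \<le> 5" for i by (rule power_increasing) (use that in auto)
    have "?L ^ 2 \<le> ?s ^ 2" "length T ^ 3 \<le> ?s ^ 3" using T(2) by (intro power_mono; simp)+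
    then have L: "?L ^ 2 \<le> ?s ^ 5" "length T ^ 3 \<le> ?s ^ 5" using p[of 2] p[of 3] by linarith+
    have "?L \<le> ?s ^ 5 * ?letter_cost"
      using mult_le_mono[OF p[of 1] letter_cost_pos[of "5 * ?L + 3"]] by simp
    moreover have "3 * ?L ^ 2 * letter_cost ?L \<le> 3 * ?s ^ 5 * ?letter_cost" "7 * length T ^ 3 * letter_cost ?L \<le> 7 * ?s ^ 5 * ?letter_cost"
      using L letter_cost by (intro mult_le_mono; simp)+
    moreover have "60 * star_cost ?L * (6 * ?s ^ 2) * (6 * ?s ^ 2 + 1) \<le> 30240 * ?s ^ 5 * ?letter_cost"
    proof -
      have "6 * ?s ^ 2 + 1 \<le> 7 * ?s ^ 2" by simp
      then have "60 * star_cost ?L * (6 * ?s ^ 2) * (6 * ?s ^ 2 + 1) \<le> 60 * star_cost ?L * (6 * ?s ^ 2) * (7 * ?s ^ 2)"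
        by (rule mult_le_mono2)
      also have "\<dots> = 30240 * ?s ^ 5 * ?letter_cost" unfolding star_cost_def by (rule pow)
      finally show ?thesis .
    qed
    moreover have "area_bound ?L = ?s ^ 5 * ?letter_cost + 3 * ?s ^ 5 * ?letter_cost + 7 * ?s ^ 5 * ?letter_cost + 30240 * ?s ^ 5 * ?letter_cost"
      unfolding area_bound_def by (simp add: distrib_right[symmetric] del: power_Suc)
    ultimately show ?thesis by linarith
  qed
  from homotopic_mono[OF homotopic_trans[OF st fin] this] show ?thesis
    by (simp add: homotopic_def)
qed

lemma mono_area_bound: "mono area_bound"
  unfolding area_bound_def mono_def by (intro allI impI mult_le_mono power_mono letter_cost_mono) auto

section \<open>Houghton's group as a quotient of the free group\<close>

definition points :: "pt set" where "points = {Ctr, Aux} \<union> {Ray i p |i p. i \<in> I}"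

lemma points_simps [simp]: "Ctr \<in> points" "Aux \<in> points" "Ray i p \<in> points \<longleftrightarrow> i \<in> I"
  by (auto simp: points_def)

lemma points_cases [consumes 1, case_names Ctr Aux Ray]:
  assumes "z \<in> points" obtains "z = Ctr" | "z = Aux" | i p where "z = Ray i p" "i \<in> I"
  using assms by (auto simp: points_def)

text \<open>The centre and the auxiliary point are taken from the beginning of ray 1, and positions on
  the rays are counted from 1 in \<open>rays n\<close> but from 0 in the model.\<close>

definition offset :: "nat \<Rightarrow> nat" where "offset i = (if i = 1 then 3 else 1)"

fun \<theta> :: "pt \<Rightarrow> nat \<times> nat" where
  "\<theta> Ctr = (1, 1)" | "\<theta> Aux = (1, 2)" | "\<theta> (Ray i p) = (i, p + offset i)"

definition \<theta>' :: "nat \<times> nat \<Rightarrow> pt" where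
  "\<theta>' y = (if y = (1, 1) then Ctr else if y = (1, 2) then Aux else Ray (fst y) (snd y - offset (fst y)))"

lemma \<theta>'_\<theta> [simp]: "\<theta>' (\<theta> z) = z"
  by (cases z) (auto simp: \<theta>'_def offset_def)

lemma \<theta>_rays: "z \<in> points \<Longrightarrow> \<theta> z \<in> rays n"
  using n3 by (erule_tac points_cases) (auto simp: rays_def offset_def I_def)

lemma \<theta>'_rays: "y \<in> rays n \<Longrightarrow> \<theta>' y \<in> points \<and> \<theta> (\<theta>' y) = y"
  by (cases y) (auto simp: \<theta>'_def offset_def rays_def I_def)

lemma bij_\<theta>: "bij_betw \<theta> points (rays n)" "bij_betw \<theta>' (rays n) points"
proof -
  show "bij_betw \<theta> points (rays n)"
    by (rule bij_betw_byWitness[where f' = \<theta>']) (use \<theta>_rays \<theta>'_rays in auto)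
  show "bij_betw \<theta>' (rays n) points"
    by (rule bij_betw_byWitness[where f' = \<theta>]) (use \<theta>_rays \<theta>'_rays in auto)
qed

definition drift :: "(nat \<Rightarrow> int) \<Rightarrow> nat \<Rightarrow> pt perms \<Rightarrow> bool" where
  "drift m N u \<longleftrightarrow> (\<forall>i\<in>I. \<forall>p\<ge>N. int p + m i \<ge> 0 \<and> app u (Ray i p) = Ray i (nat (int p + m i)))"

lemma drift_add:
  assumes "drift m N u" "drift m' N' v"
  shows "\<exists>N''. drift (\<lambda>i. m i + m' i) N'' (u + v)"
proof -
  define N'' where "N'' = N + N' + nat (\<Sum>i\<in>I. \<bar>m i\<bar>)"
  have b: "\<bar>m i\<bar> \<le> (\<Sum>i\<in>I. \<bar>m i\<bar>)" if "i \<in> I" for i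
    using that by (intro member_le_sum) (auto simp: I_def)
  have "drift (\<lambda>i. m i + m' i) N'' (u + v)"
    unfolding drift_def
  proof (intro ballI allI impI)
    fix i p assume i: "i \<in> I" and p: "p \<ge> N''"
    have 1: "int p + m i \<ge> 0" "app u (Ray i p) = Ray i (nat (int p + m i))"
      using assms(1) i p unfolding drift_def N''_def by auto
    have "nat (int p + m i) \<ge> N'" using p b[OF i] unfolding N''_def by linarith
    then have "int (nat (int p + m i)) + m' i \<ge> 0"
      "app v (Ray i (nat (int p + m i))) = Ray i (nat (int (nat (int p + m i)) + m' i))"
      using assms(2) i unfolding drift_def by blast+
    then show "int p + (m i + m' i) \<ge> 0 \<and> app (u + v) (Ray i p) = Ray i (nat (int p + (m i + m' i)))"
      using 1 by (simp add: add.assoc)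
  qed
  then show ?thesis ..
qed

lemma drift_zero: "drift (\<lambda>i. 0) N 0"
  by (simp add: drift_def)

lemma drift_slide: "l \<noteq> i \<Longrightarrow> drift (\<lambda>j. if j = l then -1 else if j = i then 1 else 0) 1 (slide l i)"
  by (auto simp: drift_def app_slide_cases nat_diff_distrib nat_add_distrib split: nat.splits)

lemma drift_swap: 
  assumes "\<And>i p. y = Ray i p \<Longrightarrow> p < N" "\<And>i p. z = Ray i p \<Longrightarrow> p < N"
  shows "drift (\<lambda>i. 0) N (swap y z)"
  unfolding drift_def by (auto simp: app_swap dest: assms)

lemma ev_letter: "ev (elt [(k, s)]) = (if k = 0 then swap Ctr Aux else if k = 1 then swap Aux (Ray 1 0)
    else if k \<le> n then if s then slide 1 k else slide k 1 else 0)"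
  by (simp add: elt_Cons elt_simps ev_def)

lemma ev_drift: "\<exists>m N. drift m N (ev (elt w))"
proof (induction w)
  case Nil
  then show ?case using drift_zero by (auto simp: elt_simps)
next
  case (Cons x w)
  obtain k s where x: "x = (k, s)" by force
  have "\<exists>m N. drift m N (ev (elt [(k, s)]))"
    unfolding ev_letter using drift_zero drift_slide[of 1 k] drift_slide[of k 1]
      drift_swap[of Ctr 1 Aux] drift_swap[of Aux 1 "Ray 1 0"] by (auto split: if_splits)
  then show ?case using Cons.IH drift_add elt_simps(2)[of "[x]" w] x by fastforce
qed

lemma ev_outside: "z \<notin> points \<Longrightarrow> app (ev (elt w)) z = z"
proof (induction w)
  case (Cons x w)
  obtain k s where x: "x = (k, s)" by force
  obtain i p where z: "z = Ray i p" "i \<notin> I" using Cons.prems by (cases z) auto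
  then have "i \<noteq> 1" "k \<le> n \<Longrightarrow> k \<noteq> 0 \<Longrightarrow> i \<noteq> k" using one_in_I by (auto simp: I_def)
  then have "app (ev (elt [(k, s)])) z = z" by (auto simp: ev_letter z app_swap)
  then show ?case using Cons elt_simps(2)[of "[x]" w] x by simp
qed (simp add: elt_simps)

lemma ev_points: "z \<in> points \<Longrightarrow> app (ev (elt w)) z \<in> points"
proof (rule ccontr)
  assume z: "z \<in> points" "app (ev (elt w)) z \<notin> points"
  then have "app (ev (elt w)) (app (ev (elt w)) z) = app (ev (elt w)) z" by (intro ev_outside)
  then show False using z by simp
qed

definition word_perm :: "nat word \<Rightarrow> nat \<times> nat \<Rightarrow> nat \<times> nat" where
  "word_perm w = (\<lambda>y\<in>rays n. \<theta> (app (ev (elt w)) (\<theta>' y)))"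

lemma word_perm_append: "word_perm (u @ v) = compose (rays n) (word_perm v) (word_perm u)"
  using \<theta>_rays ev_points \<theta>'_rays by (auto simp: word_perm_def compose_def elt_simps fun_eq_iff restrict_def)

lemma word_perm_eqI: "ev (elt u) = ev (elt v) \<Longrightarrow> word_perm u = word_perm v"
  by (simp add: word_perm_def)

lemma word_perm_one: "word_perm [] = (\<lambda>y\<in>rays n. y)"
  using \<theta>'_rays by (auto simp: word_perm_def elt_simps fun_eq_iff restrict_def)

lemma word_perm_eq_one: "word_perm w = (\<lambda>y\<in>rays n. y) \<longleftrightarrow> ev (elt w) = 0"
proof
  assume word_perm: "word_perm w = (\<lambda>y\<in>rays n. y)"
  show "ev (elt w) = 0"
  proof (rule perms_eqI)
    fix z
    show "app (ev (elt w)) z = app 0 z"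
    proof (cases "z \<in> points")
      case True
      then have "\<theta> (app (ev (elt w)) (\<theta>' (\<theta> z))) = \<theta> z"
        using fun_cong[OF word_perm, of "\<theta> z"] \<theta>_rays by (simp add: word_perm_def)
      then have "\<theta>' (\<theta> (app (ev (elt w)) z)) = \<theta>' (\<theta> z)" by simp
      then show ?thesis by (simp only: \<theta>'_\<theta> app_simps)
    qed (simp add: ev_outside)
  qed
qed (use word_perm_one word_perm_eqI[of w "[]"] in \<open>simp add: elt_simps\<close>)

lemma bij_ev_points: "bij_betw (app (ev (elt w))) points points"
proof (rule bij_betw_byWitness[where f' = "app (ev (elt (inv_word w)))"])
  show "app (ev (elt w)) ` points \<subseteq> points" "app (ev (elt (inv_word w))) ` points \<subseteq> points" using ev_points by blast+
qed (simp_all add: elt_simps)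

lemma word_perm_carrier: "word_perm w \<in> carrier (houghton n)"
proof -
  obtain m N where m: "drift m N (ev (elt w))" using ev_drift by blast
  have "bij_betw (\<theta> \<circ> (app (ev (elt w)) \<circ> \<theta>')) (rays n) (rays n)"
    using bij_\<theta> bij_ev_points by (intro bij_betw_trans)
  then have bij: "bij_betw (word_perm w) (rays n) (rays n)"
    by (rule bij_betw_cong[THEN iffD1, rotated]) (simp add: word_perm_def)
  define K where "K = rays n \<inter> ({1..n} \<times> {..N + 3})"
  have "fst (word_perm w (i, q)) = i \<and> int (snd (word_perm w (i, q))) = int q + m i" if q: "(i, q) \<in> rays n - K" for i q
  proof -
    have i: "i \<in> I" and big: "q > N + 3" "(i, q) \<in> rays n" using q by (auto simp: K_def rays_def I_def)
    then have "\<theta>' (i, q) = Ray i (q - offset i)" by (auto simp: \<theta>'_def)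
    moreover have "q - offset i \<ge> N" "offset i \<le> q" using big by (auto simp: offset_def)
    then have "app (ev (elt w)) (Ray i (q - offset i)) = Ray i (nat (int (q - offset i) + m i))"
      "int (q - offset i) + m i \<ge> 0"
      using m i unfolding drift_def by blast+
    ultimately show ?thesis using big \<open>offset i \<le> q\<close> by (simp add: word_perm_def)
  qed
  then have "\<forall>(i, q)\<in>rays n - K. fst (word_perm w (i, q)) = i \<and> int (snd (word_perm w (i, q))) = int q + m i"
    by blast
  moreover have "finite K" "K \<subseteq> rays n" by (auto simp: K_def)
  ultimately have "eventual_translation n (word_perm w)"
    unfolding eventual_translation_def using bij by blast
  then show ?thesis by (simp add: houghton_def word_perm_def)
qed

subsection \<open>Surjectivity\<close>

definition words_image :: "pt perms set" where
  "words_image = {u. \<exists>k g. short k g \<and> ev g = u}"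

lemma words_image_intros:
  "0 \<in> words_image" "u \<in> words_image \<Longrightarrow> v \<in> words_image \<Longrightarrow> u + v \<in> words_image"
  "k \<in> I \<Longrightarrow> slide 1 k \<in> words_image" "k \<in> I \<Longrightarrow> slide k 1 \<in> words_image"
  "z \<in> points \<Longrightarrow> z \<noteq> Ctr \<Longrightarrow> swap Ctr z \<in> words_image"
proof -
  show "0 \<in> words_image" using short_intros(4) by (force simp: words_image_def)
  show "u + v \<in> words_image" if "u \<in> words_image" "v \<in> words_image"
    using that short_intros(5) by (force simp: words_image_def)
  show "slide 1 k \<in> words_image" if "k \<in> I"
    using short_intros(3)[OF that] ev_gens(3)[OF that] by (force simp: words_image_def)
  show "slide k 1 \<in> words_image" if "k \<in> I"
    using short_intros(6)[OF short_intros(3)[OF that]] ev_gens(3)[OF that]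
    unfolding words_image_def by (intro CollectI exI[of _ 1] exI[of _ "- t k"]) simp
  show "swap Ctr z \<in> words_image" if "z \<in> points" "z \<noteq> Ctr"
    using that
  proof (cases rule: points_cases)
    case Aux
    then show ?thesis using short_intros(1) ev_gens(1) by (force simp: words_image_def)
  next
    case (Ray i p)
    then show ?thesis using short_ray_star[of i p] ev_ray_star[of i p] by (force simp: words_image_def)
  qed auto
qed

lemma swap_in_words_image:
  assumes "y \<in> points" "z \<in> points" shows "swap y z \<in> words_image"
proof -
  consider "y = z" | "y = Ctr" "y \<noteq> z" | "z = Ctr" "y \<noteq> z" | "y \<noteq> Ctr" "z \<noteq> Ctr" "y \<noteq> z" by blast
  then show ?thesis
  proof cases
    case 1
    then have "swap y z = 0" by (intro perms_eqI) (simp add: app_swap)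
    then show ?thesis by (simp add: words_image_intros)
  next
    case 4
    then show ?thesis using swap_triple[of y z Ctr] assms words_image_intros(2,5) by metis
  qed (use assms words_image_intros(5) in \<open>auto simp: swap_commute[of _ Ctr]\<close>)
qed

lemma finitary_in_words_image:
  assumes "finite {z. app u z \<noteq> z}" "\<And>z. z \<notin> points \<Longrightarrow> app u z = z"
  shows "u \<in> words_image"
proof -
  have "\<exists>v\<in>words_image. app v = p" if "p permutes S" "finite S" "S \<subseteq> points" for p S
    using that
  proof (induction rule: permutes_induct)
    case id
    have "app 0 = id" by (simp add: zero_perms.rep_eq)
    then show ?case using words_image_intros(1) by blast
  next
    case (swap y z p)
    then obtain v where v: "v \<in> words_image" "app v = p" by blast
    have "app (v + swap y z) = Transposition.transpose y z \<circ> p"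
      by (simp add: plus_perms.rep_eq swap.rep_eq v)
    moreover have "v + swap y z \<in> words_image"
      using swap.hyps swap.prems v(1) by (intro words_image_intros(2) swap_in_words_image) auto
    ultimately show ?case by blast
  qed
  moreover have "app u permutes {z. app u z \<noteq> z}"
    using bij_app[of u] by (simp add: permutes_def bij_iff)
  moreover have "{z. app u z \<noteq> z} \<subseteq> points" using assms(2) by blast
  ultimately obtain v where "v \<in> words_image" "app v = app u" using assms(1) by blast
  then show ?thesis by (simp add: app_inject)
qed

lemma drift_finite_support:
  assumes "drift (\<lambda>i. 0) N u" "\<And>z. z \<notin> points \<Longrightarrow> app u z = z"
  shows "finite {z. app u z \<noteq> z}"
proof (rule finite_subset)
  show "{z. app u z \<noteq> z} \<subseteq> {Ctr, Aux} \<union> (\<lambda>(i, p). Ray i p) ` (I \<times> {..<N})"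
  proof
    fix z assume z: "z \<in> {z. app u z \<noteq> z}"
    then have "z \<in> points" using assms(2) by blast
    then show "z \<in> {Ctr, Aux} \<union> (\<lambda>(i, p). Ray i p) ` (I \<times> {..<N})"
    proof (cases rule: points_cases)
      case (Ray i p)
      then have "\<not> N \<le> p" using assms(1) z unfolding drift_def by auto
      then show ?thesis using Ray by auto
    qed auto
  qed
qed (simp add: I_def)

text \<open>A translation along ray 1 alone would change the number of points below a large level, while a
  permutation that is the identity far out on the other rays preserves it.\<close>

lemma no_single_drift:
  assumes "drift m N u" "\<And>i. i \<in> I \<Longrightarrow> i \<noteq> 1 \<Longrightarrow> m i = 0" "\<And>z. z \<notin> points \<Longrightarrow> app u z = z"
  shows "m 1 = 0"
proof -
  \<comment> \<open>The model without ray 1 is split into the finite part \<open>B\<close> and the part \<open>H\<close> fixed by \<open>u\<close>.\<close>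
  define B where "B = {Ctr, Aux} \<union> (\<lambda>(i, p). Ray i p) ` ((I - {1}) \<times> {..<N})"
  define H where "H = (\<lambda>(i, p). Ray i p) ` ((I - {1}) \<times> {N..})"
  have ZN: "points = (B \<union> Ray 1 ` {..<M}) \<union> (H \<union> Ray 1 ` {M..})" for M
  proof (rule Set.set_eqI)
    fix z show "z \<in> points \<longleftrightarrow> z \<in> (B \<union> Ray 1 ` {..<M}) \<union> (H \<union> Ray 1 ` {M..})"
    proof (cases z)
      case (Ray i p)
      then show ?thesis using one_in_I by (cases "i = 1") (auto simp: B_def H_def image_iff not_less)
    qed (auto simp: B_def)
  qed
  have dis: "(B \<union> Ray 1 ` {..<M}) \<inter> (H \<union> Ray 1 ` {M..}) = {}" for M
    by (auto simp: B_def H_def)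
  have Zu: "app u ` points = points"
  proof -
    have iff: "app u z \<in> points \<longleftrightarrow> z \<in> points" for z
      using assms(3)[of z] assms(3)[of "app u z"] by (metis app_eq_iff)
    show ?thesis
    proof
      show "app u ` points \<subseteq> points" using iff by blast
      show "points \<subseteq> app u ` points"
      proof
        fix z assume "z \<in> points"
        then have "app (- u) z \<in> points" using iff[of "app (- u) z"] by simp
        then show "z \<in> app u ` points" by (intro image_eqI[of _ _ "app (- u) z"]) simp_all
      qed
    qed
  qed
  let ?M = "nat (int N + m 1)"
  have ge: "int N + m 1 \<ge> 0" using assms(1) one_in_I unfolding drift_def by blast
  have H: "app u ` H = H"
  proof -
    have "app u z = z" if z: "z \<in> H" for z
    proof -
      obtain i p where "z = Ray i p" "i \<in> I" "i \<noteq> 1" "N \<le> p" using z by (auto simp: H_def)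
      then show ?thesis using assms(1) assms(2)[of i] unfolding drift_def by auto
    qed
    then show ?thesis by simp
  qed
  have R: "app u ` Ray 1 ` {N..} = Ray 1 ` {?M..}"
  proof
    show "app u ` Ray 1 ` {N..} \<subseteq> Ray 1 ` {?M..}"
      using assms(1) one_in_I unfolding drift_def by auto
    show "Ray 1 ` {?M..} \<subseteq> app u ` Ray 1 ` {N..}"
    proof
      fix z assume "z \<in> Ray 1 ` {?M..}"
      then obtain q where q: "z = Ray 1 q" "?M \<le> q" by auto
      define p where "p = nat (int q - m 1)"
      have p: "p \<ge> N" "nat (int p + m 1) = q" using q(2) ge by (auto simp: p_def)
      then have "app u (Ray 1 p) = Ray 1 q" using assms(1) one_in_I unfolding drift_def by auto
      then show "z \<in> app u ` Ray 1 ` {N..}" using p(1) q(1) by (force simp: image_iff)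
    qed
  qed
  have "B \<union> Ray 1 ` {..<N} = points - (H \<union> Ray 1 ` {N..})"
    using ZN[of N] dis[of N] by blast
  then have "app u ` (B \<union> Ray 1 ` {..<N}) = app u ` (points - (H \<union> Ray 1 ` {N..}))"
    by (simp only:)
  also have "\<dots> = app u ` points - app u ` (H \<union> Ray 1 ` {N..})"
    by (rule image_set_diff[OF bij_is_inj[OF bij_app]])
  also have "\<dots> = points - (H \<union> Ray 1 ` {?M..})" by (simp only: Zu image_Un H R)
  also have "\<dots> = B \<union> Ray 1 ` {..<?M}" using ZN[of ?M] dis[of ?M] by blast
  finally have "card (app u ` (B \<union> Ray 1 ` {..<N})) = card (B \<union> Ray 1 ` {..<?M})" by simp
  moreover have "card (app u ` (B \<union> Ray 1 ` {..<N})) = card (B \<union> Ray 1 ` {..<N})"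
    by (rule card_image) (auto simp: inj_on_def)
  moreover have "card (B \<union> Ray 1 ` {..<M}) = card B + M" for M
  proof -
    have "card (B \<union> Ray 1 ` {..<M}) = card B + card (Ray 1 ` {..<M})"
      by (rule card_Un_disjoint) (auto simp: B_def I_def)
    also have "card (Ray 1 ` {..<M}) = M" by (subst card_image) (auto simp: inj_on_def)
    finally show ?thesis .
  qed
  ultimately show ?thesis using ge by simp
qed

text \<open>Composing with translations between ray 1 and ray \<open>k\<close> removes the drift on ray \<open>k\<close>.  When no
  drift is left on the rays other than ray 1, there is none on ray 1 either, and the permutation is finitary.\<close>

lemma drift_in_words_image:
  assumes "drift m N u" "\<And>z. z \<notin> points \<Longrightarrow> app u z = z"
  shows "u \<in> words_image"
  using assms
proof (induction "\<Sum>i\<in>I - {1}. nat \<bar>m i\<bar>" arbitrary: m N u rule: less_induct)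
  case less
  show ?case
  proof (cases "\<exists>k\<in>I - {1}. m k \<noteq> 0")
    case True
    then obtain k where k: "k \<in> I" "k \<noteq> 1" "m k \<noteq> 0" by blast
    \<comment> \<open>One translation brings the drift on ray \<open>k\<close> one step closer to zero.\<close>
    define s where "s = (if m k > 0 then slide k 1 else slide 1 k)"
    define m1 where "m1 = (\<lambda>j. if j = 1 then sgn (m k) else if j = k then - sgn (m k) else 0 :: int)"
    have s: "drift m1 1 s"
      using drift_slide[of k 1] drift_slide[of 1 k] k
      by (cases "m k > 0") (auto simp: s_def m1_def drift_def)
    then obtain N' where N': "drift (\<lambda>i. m i + m1 i) N' (u + s)" using drift_add[OF less.prems(1)] by blast
    have outside: "app (u + s) z = z" if z: "z \<notin> points" for z
    proof -
      obtain i p where "z = Ray i p" "i \<notin> I" using z by (cases z) auto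
      then show ?thesis using less.prems(2)[OF z] k one_in_I
        by (auto simp: s_def app_slide_cases)
    qed
    have "(\<Sum>i\<in>I - {1}. nat \<bar>m i + m1 i\<bar>) < (\<Sum>i\<in>I - {1}. nat \<bar>m i\<bar>)"
    proof (rule sum_strict_mono_ex1)
      show "\<forall>i\<in>I - {1}. nat \<bar>m i + m1 i\<bar> \<le> nat \<bar>m i\<bar>"
        using k by (auto simp: m1_def sgn_if)
      show "\<exists>i\<in>I - {1}. nat \<bar>m i + m1 i\<bar> < nat \<bar>m i\<bar>"
        using k by (intro bexI[of _ k]) (auto simp: m1_def sgn_if)
    qed (simp add: I_def)
    from less.hyps[OF this N' outside] have "u + s \<in> words_image" .
    moreover have "- s \<in> words_image"
      using k words_image_intros(3,4) by (auto simp: s_def)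
    ultimately have "(u + s) + - s \<in> words_image" by (rule words_image_intros(2))
    then show ?thesis by (simp add: add.assoc)
  next
    case False
    then have z: "m i = 0" if "i \<in> I" for i
      using no_single_drift[OF less.prems(1) _ less.prems(2)] that by (cases "i = 1") auto
    then have "drift (\<lambda>i. 0) N u" using less.prems(1) by (simp add: drift_def)
    then show ?thesis using less.prems(2) drift_finite_support finitary_in_words_image by blast
  qed
qed

lemma word_perm_surj:
  assumes g: "g \<in> carrier (houghton n)"
  shows "\<exists>w\<in>words {0..n}. word_perm w = g"
proof -
  have ext: "g \<in> extensional (rays n)" and ev: "eventual_translation n g"
    using g by (auto simp: houghton_def)
  obtain m K where bij: "bij_betw g (rays n) (rays n)" and K: "finite K" "K \<subseteq> rays n"
    "\<And>k p. (k, p) \<in> rays n - K \<Longrightarrow> fst (g (k, p)) = k \<and> int (snd (g (k, p))) = int p + m k"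
    using ev unfolding eventual_translation_def by blast
  define f where "f z = (if z \<in> points then \<theta>' (g (\<theta> z)) else z)" for z
  have "bij_betw (\<theta>' \<circ> (g \<circ> \<theta>)) points points"
    using bij_\<theta> bij by (intro bij_betw_trans)
  then have "bij_betw f points points" by (rule bij_betw_cong[THEN iffD1, rotated]) (simp add: f_def)
  moreover have "bij_betw f (- points) (- points)"
    by (rule bij_betw_cong[THEN iffD1, OF _ bij_betw_id]) (simp add: f_def)
  ultimately have "bij_betw f (points \<union> - points) (points \<union> - points)" by (rule bij_betw_combine) auto
  then have bf: "bij f" by simp
  define u where "u = Perm f"
  have u: "app u = f" using bf by (simp add: u_def Perm_inverse)
  obtain N0 where N0: "\<And>k p. (k, p) \<in> K \<Longrightarrow> p < N0"
    using finite_nat_set_iff_bounded[of "snd ` K"] K(1) by force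
  \<comment> \<open>Beyond \<open>N0\<close> there are no exceptional points; the sum keeps translated positions non-negative.\<close>
  define N where "N = N0 + nat (\<Sum>i\<in>I. \<bar>m i\<bar>)"
  have "drift m N u"
    unfolding drift_def
  proof (intro ballI allI impI)
    fix i p assume i: "i \<in> I" and p: "N \<le> p"
    have "\<bar>m i\<bar> \<le> (\<Sum>i\<in>I. \<bar>m i\<bar>)"
      using i by (intro member_le_sum) (auto simp: I_def)
    then have pos: "int p + m i \<ge> 0" using p by (simp add: N_def)
    have "(i, p + offset i) \<in> rays n - K"
      using i p N0[of i "p + offset i"] by (auto simp: rays_def I_def N_def offset_def)
    from K(3)[OF this] have "fst (g (i, p + offset i)) = i" "int (snd (g (i, p + offset i))) = int (p + offset i) + m i"
      by auto
    then have "g (i, p + offset i) = (i, nat (int p + m i) + offset i)"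
      using pos by (simp add: prod_eq_iff)
    also have "\<dots> = \<theta> (Ray i (nat (int p + m i)))" by simp
    finally have "\<theta>' (g (i, p + offset i)) = Ray i (nat (int p + m i))"
      by (simp only: \<theta>'_\<theta>)
    then have "f (Ray i p) = Ray i (nat (int p + m i))"
      using i by (simp add: f_def)
    then show "int p + m i \<ge> 0 \<and> app u (Ray i p) = Ray i (nat (int p + m i))"
      using pos u by simp
  qed
  moreover have "app u z = z" if "z \<notin> points" for z using that by (simp add: u f_def)
  ultimately have "u \<in> words_image" by (rule drift_in_words_image)
  then obtain w where w: "w \<in> words {0..n}" "ev (elt w) = u"
    unfolding words_image_def short_def by blast
  have "word_perm w = g"
  proof (rule extensionalityI[OF _ ext])
    show "word_perm w \<in> extensional (rays n)" by (simp add: word_perm_def)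
    fix y assume y: "y \<in> rays n"
    then have "g y \<in> rays n" using bij by (auto simp: bij_betw_def)
    then show "word_perm w y = g y" using y \<theta>'_rays by (simp add: word_perm_def w u f_def)
  qed
  then show ?thesis using w(1) by blast
qed

text \<open>As every element is the action of a word, the group laws are inherited from words.\<close>

lemma group_houghton: "Group.group (houghton n)"
proof (rule groupI)
  have mult: "word_perm u \<otimes>\<^bsub>houghton n\<^esub> word_perm v = word_perm (u @ v)" for u v by (simp add: houghton_def word_perm_append)
  have one: "\<one>\<^bsub>houghton n\<^esub> = word_perm []" by (simp add: houghton_def word_perm_one)
  show "\<one>\<^bsub>houghton n\<^esub> \<in> carrier (houghton n)" by (simp add: one word_perm_carrier)
  fix x assume "x \<in> carrier (houghton n)"
  then obtain u where u: "x = word_perm u" using word_perm_surj by blast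
  show "\<one>\<^bsub>houghton n\<^esub> \<otimes>\<^bsub>houghton n\<^esub> x = x" by (simp add: one u mult)
  show "\<exists>y\<in>carrier (houghton n). y \<otimes>\<^bsub>houghton n\<^esub> x = \<one>\<^bsub>houghton n\<^esub>"
    by (rule bexI[of _ "word_perm (inv_word u)"])
      (auto simp: one u mult word_perm_carrier elt_simps intro: word_perm_eqI)
  fix y assume "y \<in> carrier (houghton n)"
  then obtain v where v: "y = word_perm v" using word_perm_surj by blast
  show "x \<otimes>\<^bsub>houghton n\<^esub> y \<in> carrier (houghton n)" by (simp add: u v mult word_perm_carrier)
  fix z assume "z \<in> carrier (houghton n)"
  then obtain w where w: "z = word_perm w" using word_perm_surj by blast
  show "x \<otimes>\<^bsub>houghton n\<^esub> y \<otimes>\<^bsub>houghton n\<^esub> z = x \<otimes>\<^bsub>houghton n\<^esub> (y \<otimes>\<^bsub>houghton n\<^esub> z)"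
    by (simp add: u v w mult)
qed

lemma marked_houghton: "marked_group (houghton n) {0..n} word_perm"
proof -
  interpret Group.group "houghton n" by (rule group_houghton)
  show ?thesis
  proof
    show "word_perm (u @ v) = word_perm u \<otimes>\<^bsub>houghton n\<^esub> word_perm v" for u v by (simp add: houghton_def word_perm_append)
    show "word_perm [] = \<one>\<^bsub>houghton n\<^esub>" by (simp add: houghton_def word_perm_one)
    show "word_perm [(k, s), (k, \<not> s)] = \<one>\<^bsub>houghton n\<^esub>" for k s
      using word_perm_eqI[of "[(k, s), (k, \<not> s)]" "[]"] by (auto simp: houghton_def word_perm_one elt_Cons elt_simps)
  qed (rule word_perm_carrier)
qed

end

section \<open>The Dehn function\<close>

lemma dehn_le:
  assumes "finite A" "\<And>w. null_homotopic A R w \<Longrightarrow> length w \<le> x \<Longrightarrow> area A R w \<le> N"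
    and "null_homotopic A R []"
  shows "dehn A R x \<le> N"
proof -
  have "finite {w. null_homotopic A R w \<and> length w \<le> x}"
  proof (rule finite_subset)
    show "{w. null_homotopic A R w \<and> length w \<le> x} \<subseteq> {w. set w \<subseteq> A \<times> UNIV \<and> length w \<le> x}"
      by (auto simp: null_homotopic_def words_def)
    show "finite {w :: 'a word. set w \<subseteq> A \<times> UNIV \<and> length w \<le> x}"
      by (rule finite_lists_length_le) (simp add: assms(1))
  qed
  then show ?thesis unfolding dehn_def using assms(2,3) by (subst Max_le_iff) auto
qed

lemma (in houghton_rays) area_bound_le_exponential: "area_bound L \<le> 30251 * 2 * 11 ^ 4 * (2 * 11) ^ (5 * L)"
proof -
  have "Suc L \<le> 2 ^ L" by (induction L) auto
  then have "Suc L ^ 5 \<le> (2 ^ L) ^ 5" by (rule power_mono) simp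
  then have "Suc L ^ 5 \<le> 2 ^ (5 * L)" by (simp add: power_mult[symmetric] mult.commute)
  moreover have "letter_cost (5 * L + 3) = 2 * 11 ^ 4 * 11 ^ (5 * L)"
    by (simp add: letter_cost_def ray_cost_def power_add)
  ultimately have "area_bound L \<le> 30251 * 2 ^ (5 * L) * (2 * 11 ^ 4 * 11 ^ (5 * L))"
    unfolding area_bound_def by (simp del: power_Suc)
  then show ?thesis by (simp only: power_mult_distrib mult_ac)
qed

lemma dominated_exp:
  fixes f :: "nat \<Rightarrow> nat"
  assumes "\<And>x. f x \<le> k * (a * b ^ (5 * (k * x))) + k * x" and "b \<ge> 1"
  shows "(\<lambda>x. real (f x)) \<preceq> exp"
proof -
  define C where "C = 1 + real k * real a + real k + 5 * real k * ln (real b)"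
  have lnb: "ln (real b) \<ge> 0" using assms(2) by simp
  then have C: "C > 0" "real k * real a \<le> C" "real k \<le> C" "5 * real k * ln (real b) \<le> C"
    unfolding C_def by (simp_all add: add_nonneg_nonneg add_pos_nonneg)
  have "real (f x) \<le> C * exp (C * real x + C) + C * real x + C" for x
  proof -
    have "real b ^ (5 * (k * x)) = exp (ln (real b)) ^ (5 * (k * x))" using assms(2) by simp
    also have "\<dots> = exp (5 * real k * ln (real b) * real x)"
      by (simp add: exp_of_nat_mult[symmetric] mult_ac)
    also have "\<dots> \<le> exp (C * real x + C)"
      using C mult_right_mono[OF C(4), of "real x"] by simp
    finally have e: "real b ^ (5 * (k * x)) \<le> exp (C * real x + C)" .
    have "real (f x) \<le> real (k * (a * b ^ (5 * (k * x))) + k * x)"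
      using assms(1) by (simp only: of_nat_le_iff)
    also have "\<dots> = (real k * real a) * real b ^ (5 * (k * x)) + real k * real x" by simp
    also have "\<dots> \<le> C * exp (C * real x + C) + C * real x"
      using C e by (intro add_mono mult_mono) auto
    finally show ?thesis using C by simp
  qed
  then show ?thesis unfolding dominated_def using C(1) by blast
qed

theorem theorem4:
  fixes n :: nat
  assumes "n \<ge> 3"
  shows "finitely_presented (houghton n) \<and>
         (\<forall>(A :: 'a set) R. finite_presentation A R (houghton n) \<longrightarrow>
            (\<lambda>x. real (dehn A R x)) \<preceq> exp)"
proof (intro conjI allI impI)
  interpret houghton_rays n by unfold_locales (rule assms)
  have one: "word_perm w = \<one>\<^bsub>houghton n\<^esub> \<longleftrightarrow> ev (elt w) = 0" for w
    by (simp add: houghton_def word_perm_eq_one)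
  have rel: "relators \<subseteq> words {0..n}" "finite relators"
  proof -
    show "relators \<subseteq> words {0..n}" by (auto simp: relators_def)
    have "finite {w :: nat word. set w \<subseteq> {0..n} \<times> UNIV \<and> length w \<le> 40}"
      by (rule finite_lists_length_le) simp
    then show "finite relators" by (rule finite_subset[rotated]) (auto simp: relators_def words_def)
  qed
  have triv: "word_perm s = \<one>\<^bsub>houghton n\<^esub>" if "s \<in> relators" for s
    using that one by (simp add: relators_def)
  have surj: "carrier (houghton n) \<subseteq> word_perm ` words {0..n}"
    using word_perm_surj by blast
  have area: "area_le (elt ` relators) (area_bound (length w)) (elt w)"
    if "w \<in> words {0..n}" "word_perm w = \<one>\<^bsub>houghton n\<^esub>" for w
    using exponential_area that one by blast
  have "presented_group {0..n} relators \<cong> houghton n"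
    using area_le_imp_area(2)[OF rel(1)] area
    by (intro marked_group.presented_groupI[OF marked_houghton rel(1) surj triv]) blast+
  then show "finitely_presented (houghton n)"
    unfolding finitely_presented_def finite_presentation_def using rel by blast

  fix A :: "'a set" and R assume P: "finite_presentation A R (houghton n)"
  then have A: "finite A" "R \<subseteq> words A" by (auto simp: finite_presentation_def)
  obtain E where E: "marked_group (houghton n) A E" "carrier (houghton n) \<subseteq> E ` words A"
    "\<And>w. w \<in> words A \<Longrightarrow> E w = \<one>\<^bsub>houghton n\<^esub> \<longleftrightarrow> null_homotopic A R w"
    using presentation_marking[OF P group_houghton] by blast
  obtain K where K: "\<And>w. null_homotopic A R w \<Longrightarrow>
      area_le (elt ` R) (K * area_bound (K * length w) + K * length w) (elt w)"
    by (rule change_of_presentation[OF A E finite_atLeastAtMost rel(2,1) marked_houghton surj triv area mono_area_bound]) blast+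
  show "(\<lambda>x. real (dehn A R x)) \<preceq> exp"
  proof (rule dominated_exp)
    fix x
    show "dehn A R x \<le> K * ((30251 * 2 * 11 ^ 4) * (2 * 11) ^ (5 * (K * x))) + K * x"
    proof (rule dehn_le[OF A(1)])
      show "null_homotopic A R []"
        by (rule area_le_imp_area(2)[OF A(2), of _ 0]) (auto simp: elt_simps intro: area_le.zero)
      fix w assume w: "null_homotopic A R w" "length w \<le> x"
      have "area A R w \<le> K * area_bound (K * length w) + K * length w"
        using w(1) by (intro area_le_imp_area(1)[OF A(2)] K) (auto simp: null_homotopic_def)
      also have "\<dots> \<le> K * area_bound (K * x) + K * x"
        using w(2) by (intro add_mono mult_le_mono2 monoD[OF mono_area_bound]) auto
      also have "\<dots> \<le> K * (30251 * 2 * 11 ^ 4 * (2 * 11) ^ (5 * (K * x))) + K * x"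
        by (intro add_mono mult_le_mono2 area_bound_le_exponential) auto
      finally show "area A R w \<le> K * ((30251 * 2 * 11 ^ 4) * (2 * 11) ^ (5 * (K * x))) + K * x" .
    qed
  qed simp
qed

end
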